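(* Let $(Y_n)$ satisfy Condition 1 with constant $\alpha$, fix an integer $a\ge1$, and let $X_n^{(a)}$ be the number of rounds of the leader election process started with $n$ players and stopped as soon as the number of remaining players is at most $a$ (so $X^{(a)}_n=\min\{k:N_k\le a\}$). Then all conclusions of the following statement hold for $X^{(a)}_n$, with $F$ and $\phi$ depending on $a$: there is a distribution function $F$ with bounded density such that $\sup_{k\in\mathbb Z}|\Pr(X^{(a)}_n\le k)-F(k-\log_{1/\alpha}n)|\to0$; $d_{TV}(X^{(a)}_n,\lceil Z+\log_{1/\alpha}n\rceil)\to0$ and $d_W(X^{(a)}_n,\lceil Z+\log_{1/\alpha}n\rceil)\to0$ for $Z\sim F$; $\sup_k|\Pr(X^{(a)}_n=k)-(F(k-\log_{1/\alpha}n)-F(k-1-\log_{1/\alpha}n))|\to0$; and $\mathbb E X^{(a)}_n=\log_{1/\alpha}n+\phi(n)+o(1)$ for a continuous, locally Lipschitz $\phi$ on $(0,\infty)$ with $\phi(\alpha t)=\phi(t)$.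
   Context: Condition 1: $(Y_n)_{n\ge1}$ is a sequence of random variables with $1\le Y_n\le n$ for all $n$ and $\Pr(Y_n=n)<1$ for $n\ge2$, such that: (i) $\Pr(Y_n\le k)\ge\Pr(Y_{n+1}\le k)$ for all $n,k\ge1$; (ii) there are constants $\alpha\in(0,1)$, $\varepsilon>0$ and $\delta_n=O((\log n)^{-1-\varepsilon})$ with $\mathbb E Y_{n+1}-\mathbb E Y_n=\alpha+O(\delta_n)$; (iii) $\Pr(|Y_n-\alpha n|>\delta_n n)=O(n^{-2-\varepsilon})$. Leader election process: $N_0=n$ and $(N_k)$ is the Markov chain on $\{1,2,\dots\}$ with $\Pr(N_{k+1}=j\mid N_k=i)=\Pr(Y_i=j)$. $d_{TV}$ and $d_W$ are total variation and Wasserstein distance; limits are as $n\to\infty$. *)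

theory Defs
  imports "HOL-Probability.Probability" "HOL-Library.Landau_Symbols"
begin

definition condition1 :: "(nat \<Rightarrow> nat pmf) \<Rightarrow> real \<Rightarrow> bool" where
  "condition1 Y \<alpha> \<longleftrightarrow>
     (\<forall>n\<ge>1. set_pmf (Y n) \<subseteq> {1..n}) \<and>
     (\<forall>n\<ge>2. pmf (Y n) n < 1) \<and>
     (\<forall>n\<ge>1. \<forall>k\<ge>1. measure_pmf.prob (Y (Suc n)) {..k} \<le> measure_pmf.prob (Y n) {..k}) \<and>
     0 < \<alpha> \<and> \<alpha> < 1 \<and>
     (\<exists>(\<epsilon>::real) (\<delta>::nat \<Rightarrow> real). \<epsilon> > 0 \<and>
        \<delta> \<in> O(\<lambda>n. ln (real n) powr (-1 - \<epsilon>)) \<and>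
        (\<lambda>n. measure_pmf.expectation (Y (Suc n)) real
              - measure_pmf.expectation (Y n) real - \<alpha>) \<in> O(\<delta>) \<and>
        (\<lambda>n. measure_pmf.prob (Y n) {j. \<bar>real j - \<alpha> * real n\<bar> > \<delta> n * real n})
           \<in> O(\<lambda>n. real n powr (-2 - \<epsilon>)))"

definition stop_step :: "(nat \<Rightarrow> nat pmf) \<Rightarrow> nat \<Rightarrow> nat \<Rightarrow> nat pmf" where
  "stop_step Y a i = (if i \<le> a then return_pmf i else Y i)"

text \<open>Law of the stopped chain N_{min(k, X)} started at N_0 = n.\<close>
definition stopped_chain :: "(nat \<Rightarrow> nat pmf) \<Rightarrow> nat \<Rightarrow> nat \<Rightarrow> nat \<Rightarrow> nat pmf" where
  "stopped_chain Y a n k = ((\<lambda>p. bind_pmf p (stop_step Y a)) ^^ k) (return_pmf n)"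

text \<open>Pr(X_n^(a) \<le> k) = Pr(\<exists>j\<le>k. N_j \<le> a) = Pr(N_{min(k,X)} \<le> a).\<close>
definition rounds_cdf :: "(nat \<Rightarrow> nat pmf) \<Rightarrow> nat \<Rightarrow> nat \<Rightarrow> nat \<Rightarrow> real" where
  "rounds_cdf Y a n k = measure_pmf.prob (stopped_chain Y a n k) {..a}"

text \<open>Law of X_n^(a) = min{k. N_k \<le> a}.\<close>
definition rounds :: "(nat \<Rightarrow> nat pmf) \<Rightarrow> nat \<Rightarrow> nat \<Rightarrow> nat pmf" where
  "rounds Y a n = embed_pmf (\<lambda>k. if k = 0 then rounds_cdf Y a n 0
                                  else rounds_cdf Y a n k - rounds_cdf Y a n (k - 1))"

definition dTV :: "'a measure \<Rightarrow> 'a measure \<Rightarrow> real" where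
  "dTV M N = (SUP A\<in>sets M. \<bar>measure M A - measure N A\<bar>)"

definition couplings :: "'a measure \<Rightarrow> 'a measure \<Rightarrow> ('a \<times> 'a) measure set" where
  "couplings M N = {\<mu>. prob_space \<mu> \<and> sets \<mu> = sets (M \<Otimes>\<^sub>M N) \<and>
                       distr \<mu> M fst = M \<and> distr \<mu> N snd = N}"

definition dW :: "int measure \<Rightarrow> int measure \<Rightarrow> ennreal" where
  "dW M N = (INF \<mu>\<in>couplings M N. \<integral>\<^sup>+ z. ennreal (real_of_int \<bar>fst z - snd z\<bar>) \<partial>\<mu>)"

end

theory Submission
  imports Defs "HOL-Real_Asymp.Real_Asymp"
begin

text \<open>
  Let \<open>h k n\<close> be the probability that the chain started at \<open>n\<close> is still above \<open>a\<close> after \<open>k\<close> rounds.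
  Stochastic monotonicity and summation by parts turn the first-step recursion into one for the increments
  \<open>h k (n+1) - h k n\<close>, with nonnegative weights of total mass
  \<open>E Y(n+1) - E Y(n) = \<alpha> + O((ln n)^(-1-\<epsilon>))\<close> concentrated near \<open>\<alpha> n\<close>. Comparison with
  \<open>n^s exp (-c (ln n)^(-\<epsilon>))\<close>, whose second factor absorbs the relative errors accumulated over all scales,
  bounds the increments by \<open>(K / n) min ((\<alpha>^k n)^r) ((\<alpha>^k n)^(-r))\<close> for some \<open>r > 0\<close>, and similarly the two tails.
  Hence \<open>h (k+1) x = h k (\<alpha> x) + O((ln x)^(-1-\<epsilon>))\<close>. These errors are summable along \<open>x = t \<alpha>^(-k)\<close>, so
  \<open>h k (t \<alpha>^(-k))\<close> converges to a limit \<open>H t\<close>, and \<open>F x = 1 - H (\<alpha>^x)\<close> is Lipschitz. Pointwise convergence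
  together with the two-sided tail bounds gives convergence of the sum over \<open>k\<close> of the differences of the
  distribution functions, which controls both distances (quantile coupling) and the mean.
\<close>

section \<open>Lyapunov functions\<close>

text \<open>Replacing the random \<open>Y n\<close> by its typical value \<open>\<alpha> n\<close>
  costs the deviation of \<open>Y n\<close> times the slope of the survival probability, plus the
  chance of a large deviation. This helps only if the slope is at most a constant over
  \<open>n\<close>, uniformly in the number of rounds; hence increments are controlled before any
  limit is taken. Their kernel is positive, so bounds propagate without cancellation. The exponent
  \<open>-1-e\<close> closes the scheme: along the scales \<open>x / \<alpha> ^ m\<close> the
  logarithm grows linearly, so the errors form a convergent series. The asymptotic hypotheses say
  nothing about small \<open>n\<close>; there the positive probability of leaving \<open>n\<close>
  yields some geometric rate, and \<open>r\<close> is cut down until that rate is fast enough. Both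
  exponents \<open>r\<close> and \<open>-r\<close> are carried along because sums over all integers
  \<open>k\<close> need decay on both sides of \<open>log (1/\<alpha>) n\<close>. As the laws live
  on the integers, one coupling serves both distances.\<close>

lemma powr_neg_diff_ge:
  fixes e b y :: real
  assumes "0 < e" "0 < b" "b < y"
  shows "e * b * y powr (-1-e) \<le> (y-b) powr (-e) - y powr (-e)"
proof -
  have der: "((\<lambda>x. x powr (-e)) has_real_derivative (-e * x powr (-e-1))) (at x)" if "x > 0" for x
    using that by (auto intro!: derivative_eq_intros)
  obtain z where z: "y - b < z" "z < y" and eq: "y powr (-e) - (y-b) powr (-e) = (y-(y-b)) * (-e * z powr (-e-1))"
    using MVT2[of "y-b" y "\<lambda>x. x powr (-e)" "\<lambda>x. -e * x powr (-e-1)"] der assms by force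
  have "y powr (-1-e) \<le> z powr (-1-e)"
    using z assms by (intro powr_mono2') auto
  then have "e * b * y powr (-1-e) \<le> e * b * z powr (-1-e)"
    using assms by (intro mult_left_mono) auto
  then show ?thesis using eq by (simp add: algebra_simps minus_diff_commute)
qed

lemma abs_ln_le_twice:
  fixes u :: real
  assumes "\<bar>u\<bar> \<le> 1/2"
  shows "\<bar>ln (1+u)\<bar> \<le> 2 * \<bar>u\<bar>"
proof -
  have "\<bar>ln (1+u) - u\<bar> \<le> 2 * u\<^sup>2"
    using assms abs_ln_one_plus_x_minus_x_bound by blast
  moreover have "2 * u\<^sup>2 \<le> \<bar>u\<bar>"
    using mult_right_mono[OF assms, of "\<bar>u\<bar>"] by (simp add: power2_eq_square abs_mult_self_eq flip: abs_mult)
  ultimately show ?thesis by linarith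
qed

text \<open>With \<open>j = x * (1+u)\<close> the quotient of the powers is
  \<open>exp (s * ln (1+u))\<close>; the 4 is the bound 2 on \<open>\<bar>s\<bar>\<close> times the
  2 of \<open>abs_ln_le_twice\<close>. A constant valid for all these \<open>s\<close> keeps later
  thresholds independent of \<open>s\<close>.\<close>

lemma powr_le_near:
  fixes j x t s :: real
  assumes "0 < x" "\<bar>j - x\<bar> \<le> t * x" "t \<le> 1/2" "-2 \<le> s" "s \<le> 2"
  shows "j powr s \<le> x powr s * exp (4 * t)"
proof -
  define u where "u = j / x - 1"
  have u: "\<bar>u\<bar> \<le> t"
  proof -
    have "u = (j - x) / x" using assms(1) by (simp add: u_def field_simps)
    then have "\<bar>u\<bar> = \<bar>j - x\<bar> / x" using assms(1) by simp
    also have "\<dots> \<le> t" using assms by (simp add: field_simps)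
    finally show ?thesis .
  qed
  have j: "j = x * (1+u)" using assms by (simp add: u_def)
  have "\<bar>ln (1+u)\<bar> \<le> 2 * \<bar>u\<bar>" using u assms by (intro abs_ln_le_twice) auto
  then have "\<bar>s * ln (1+u)\<bar> \<le> 2 * (2 * t)"
    unfolding abs_mult using assms u by (intro mult_mono) auto
  then have "exp (s * ln (1+u)) \<le> exp (4 * t)" by simp
  moreover have "(1+u) powr s = exp (s * ln (1+u))" using u assms by (simp add: powr_def)
  ultimately show ?thesis
    using assms u by (simp add: j powr_mult mult_left_mono)
qed

text \<open>The rate of \<open>\<delta>\<close> in Condition 1. By \<open>powr_neg_diff_ge\<close>
  with \<open>y = ln x\<close> it is at most a constant times the decrease of
  \<open>ln x powr (-e)\<close> over one scale; the correction factor in \<open>lyapunov\<close> and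
  the later telescoping both rest on this.\<close>

definition log_decay :: "real \<Rightarrow> real \<Rightarrow> real" where
  "log_decay e x = ln x powr (-1-e)"

definition lyapunov :: "real \<Rightarrow> real \<Rightarrow> real \<Rightarrow> nat \<Rightarrow> real" where
  "lyapunov e c s n = real n powr s * exp (- (c * ln (real n) powr (-e)))"

lemma ln_powr_tendsto_0: "e > 0 \<Longrightarrow> ((\<lambda>x::real. ln x powr (-e)) \<longlongrightarrow> 0) at_top"
  by real_asymp

lemma log_decay_tendsto_0: "e > 0 \<Longrightarrow> (log_decay e \<longlongrightarrow> 0) at_top"
  unfolding log_decay_def by real_asymp

lemma powr_le_log_decay:
  assumes "e > 0" "C > 0" "d > 0"
  shows "eventually (\<lambda>x. d * x powr (-e/2) \<le> C * log_decay e x) at_top"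
proof -
  have "((\<lambda>x::real. x powr (-e/2) / log_decay e x) \<longlongrightarrow> 0) at_top"
    unfolding log_decay_def using assms by real_asymp
  then have "eventually (\<lambda>x. x powr (-e/2) / log_decay e x < C / d) at_top"
    using assms by (intro order_tendstoD) auto
  moreover have "eventually (\<lambda>x. log_decay e x > 0) at_top"
    using eventually_gt_at_top[of 1] by eventually_elim (simp add: log_decay_def)
  ultimately show ?thesis
    by eventually_elim (use assms in \<open>simp add: field_simps\<close>)
qed

text \<open>
  The constants \<open>c\<close> and \<open>n0\<close> must not depend on the exponent \<open>s\<close>: below, \<open>s\<close> is chosen only after \<open>n0\<close>,
  because it has to match the geometric decay rate of the chain on \<open>{1..n0}\<close>.
\<close>

lemma weighted_lyapunov:
  fixes \<alpha> e C A :: real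
  assumes \<alpha>: "0 < \<alpha>" "\<alpha> < 1" and e: "0 < e" and C: "0 < C" and A: "0 < A"
  shows "\<exists>c n0. 0 \<le> c \<and>
    (\<forall>n s w. n0 \<le> n \<longrightarrow> -(1+e/2) \<le> s \<longrightarrow> -2 \<le> s \<longrightarrow> s \<le> 1 \<longrightarrow>
      (\<forall>j\<in>{1..n}. 0 \<le> w j) \<longrightarrow>
      (\<Sum>j=1..n. w j) \<le> A * (1 + C * log_decay e (real n)) \<longrightarrow>
      (\<Sum>j\<in>{j\<in>{1..n}. \<bar>real j - \<alpha> * real n\<bar> > C * log_decay e (real n) * real n}. w j)
        \<le> C * real n powr (-1-e) \<longrightarrow>
      (\<Sum>j=1..n. w j * lyapunov e c s j) \<le> A * \<alpha> powr s * lyapunov e c s n)"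
proof -
  \<comment> \<open>Any number strictly between \<alpha> and 1 would do; it will bound
    \<open>j / n\<close> for the \<open>j\<close> near \<open>\<alpha> n\<close>.\<close>
  define \<beta> where "\<beta> = (1+\<alpha>)/2"
  have \<beta>: "\<alpha> < \<beta>" "\<beta> < 1" "0 < \<beta>" using \<alpha> by (auto simp: \<beta>_def)
  \<comment> \<open>Total relative error of the near terms on the logarithmic scale:
    \<open>C\<close> from the excess mass, \<open>4 * C / \<alpha>\<close> from
    \<open>powr_le_near\<close> at relative distance
    \<open>C / \<alpha> * log_decay e n\<close>.\<close>
  define C1 where "C1 = C + 4 * C / \<alpha>"
  have C1: "C1 > 0" using C \<alpha> by (simp add: C1_def add_pos_pos)
  \<comment> \<open>Between \<open>n\<close> and \<open>\<beta> n\<close> the exponent of the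
    correction factor changes by at least \<open>c * e * (- ln \<beta>) * log_decay e n\<close>,
    which is now \<open>(C1 + 1) * log_decay e n\<close>; the extra 1 pays for the far
    terms.\<close>
  define c where "c = (C1 + 1) / (e * (- ln \<beta>))"
  have lnb: "- ln \<beta> > 0" using \<beta> by simp
  have c: "c > 0" unfolding c_def using C1 e lnb by (intro divide_pos_pos mult_pos_pos) auto
  have ev: "eventually (\<lambda>x. C / \<alpha> * log_decay e x \<le> 1/2 \<and> C * log_decay e x \<le> \<beta> - \<alpha> \<and>
       ln x > - ln \<beta> \<and> ln 2 \<ge> c * ln (\<beta> * x) powr (-e) \<and>
       C * x powr (-e/2) \<le> A * \<alpha> / 2 * log_decay e x \<and> \<alpha> * x \<ge> 4 \<and> x \<ge> 2) at_top"
  proof (intro eventually_conj)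
    have "((\<lambda>x. C / \<alpha> * log_decay e x) \<longlongrightarrow> C / \<alpha> * 0) at_top"
      by (intro tendsto_intros log_decay_tendsto_0 e)
    from order_tendstoD(2)[OF this, of "1/2"]
    show "eventually (\<lambda>x. C / \<alpha> * log_decay e x \<le> 1/2) at_top"
      by (auto elim: eventually_mono)
    have "((\<lambda>x. C * log_decay e x) \<longlongrightarrow> C * 0) at_top"
      by (intro tendsto_intros log_decay_tendsto_0 e)
    from order_tendstoD(2)[OF this, of "\<beta> - \<alpha>"]
    show "eventually (\<lambda>x. C * log_decay e x \<le> \<beta> - \<alpha>) at_top"
      using \<beta> by (auto elim: eventually_mono)
    show "eventually (\<lambda>x. ln x > - ln \<beta>) at_top"
      using ln_at_top by (rule filterlim_at_top_dense[THEN iffD1, rule_format])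
    have "((\<lambda>x. c * ln (\<beta> * x) powr (-e)) \<longlongrightarrow> 0) at_top"
      using c e \<beta>(3) by real_asymp
    from order_tendstoD(2)[OF this, of "ln 2"]
    show "eventually (\<lambda>x. ln 2 \<ge> c * ln (\<beta> * x) powr (-e)) at_top"
      by (auto elim: eventually_mono)
    show "eventually (\<lambda>x. C * x powr (-e/2) \<le> A * \<alpha> / 2 * log_decay e x) at_top"
      using A \<alpha> C e by (intro powr_le_log_decay) auto
    show "eventually (\<lambda>x. \<alpha> * x \<ge> 4) at_top"
      using \<alpha> eventually_ge_at_top[of "4/\<alpha>"] by (simp add: field_simps)
    show "eventually (\<lambda>x. x \<ge> (2::real)) at_top" by (rule eventually_ge_at_top)
  qed
  from eventually_compose_filterlim[OF this filterlim_real_sequentially]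
  obtain n0 where n0: "\<And>n. n \<ge> n0 \<Longrightarrow> C / \<alpha> * log_decay e (real n) \<le> 1/2 \<and> C * log_decay e (real n) \<le> \<beta> - \<alpha> \<and>
       ln (real n) > - ln \<beta> \<and> ln 2 \<ge> c * ln (\<beta> * real n) powr (-e) \<and>
       C * real n powr (-e/2) \<le> A * \<alpha> / 2 * log_decay e (real n) \<and> \<alpha> * real n \<ge> 4 \<and> real n \<ge> 2"
    by (auto simp: eventually_sequentially)
  show ?thesis
  proof (intro exI[of _ c] exI[of _ n0] conjI allI impI)
    show "0 \<le> c" using c by simp
  next
    fix n s and w :: "nat \<Rightarrow> real"
    assume n: "n0 \<le> n" and s: "-(1+e/2) \<le> s" "-2 \<le> s" "s \<le> 1"
      and w0: "\<forall>j\<in>{1..n}. 0 \<le> w j"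
      and w1: "(\<Sum>j=1..n. w j) \<le> A * (1 + C * log_decay e (real n))"
      and w2: "(\<Sum>j\<in>{j\<in>{1..n}. \<bar>real j - \<alpha> * real n\<bar> > C * log_decay e (real n) * real n}. w j)
        \<le> C * real n powr (-1-e)"
    define x where "x = real n"
    define l where "l = log_decay e x"
    define far where "far = {j\<in>{1..n}. \<bar>real j - \<alpha> * x\<bar> > C * l * x}"
    define E where "E = exp (- (c * ln (\<beta> * x) powr (-e)))"
    have N: "C / \<alpha> * l \<le> 1/2" "C * l \<le> \<beta> - \<alpha>" "ln x > - ln \<beta>" "ln 2 \<ge> c * ln (\<beta> * x) powr (-e)"
        "C * x powr (-e/2) \<le> A * \<alpha> / 2 * l" "\<alpha> * x \<ge> 4" "x \<ge> 2"
      using n0[OF n] by (auto simp: x_def l_def)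
    have l0: "l > 0" using N by (simp add: l_def log_decay_def)
    have E: "E \<ge> 1/2"
    proof -
      have "exp (- ln 2) \<le> E" unfolding E_def using N(4) by simp
      then show ?thesis by (simp add: exp_minus)
    qed
    have near: "lyapunov e c s j \<le> \<alpha> powr s * x powr s * (exp (4 * (C / \<alpha> * l)) * E)" if "j \<in> {1..n} - far" for j
    proof -
      have dj: "\<bar>real j - \<alpha> * x\<bar> \<le> C * l * x" using that by (auto simp: far_def)
      have Clx: "C * l * x \<le> (\<beta> - \<alpha>) * x" using N(2,7) by (intro mult_right_mono) auto
      have jb: "real j \<le> \<beta> * x" using dj Clx by (auto simp: algebra_simps abs_if split: if_splits)
      have "C * l * x = C / \<alpha> * l * (\<alpha> * x)" using \<alpha> by simp
      also have "\<dots> \<le> 1/2 * (\<alpha> * x)" using N by (intro mult_right_mono) auto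
      finally have "real j \<ge> \<alpha> * x / 2" using dj by linarith
      then have j2: "real j \<ge> 2" using N by linarith
      have "real j powr s \<le> (\<alpha> * x) powr s * exp (4 * (C / \<alpha> * l))"
        using N dj \<alpha> s by (intro powr_le_near) (auto simp: mult.assoc)
      also have "(\<alpha> * x) powr s = \<alpha> powr s * x powr s" using \<alpha> N by (simp add: powr_mult)
      finally have 1: "real j powr s \<le> \<alpha> powr s * x powr s * exp (4 * (C / \<alpha> * l))" .
      have "ln (\<beta> * x) powr (-e) \<le> ln (real j) powr (-e)"
        using j2 jb e \<beta> N by (intro powr_mono2') auto
      then have 2: "exp (- (c * ln (real j) powr (-e))) \<le> E"
        unfolding E_def using c by simp
      show ?thesis using mult_mono[OF 1 2] by (simp add: lyapunov_def mult.assoc)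
    qed
    have "(\<Sum>j\<in>{1..n} - far. w j * lyapunov e c s j)
        \<le> (\<Sum>j\<in>{1..n} - far. w j * (\<alpha> powr s * x powr s * (exp (4 * (C / \<alpha> * l)) * E)))"
      using w0 near by (intro sum_mono mult_left_mono) auto
    also have "\<dots> = (\<Sum>j\<in>{1..n} - far. w j) * (\<alpha> powr s * x powr s * (exp (4 * (C / \<alpha> * l)) * E))"
      by (simp add: sum_distrib_right)
    also have "\<dots> \<le> (A * exp (C * l)) * (\<alpha> powr s * x powr s * (exp (4 * (C / \<alpha> * l)) * E))"
    proof (intro mult_right_mono)
      have "(\<Sum>j\<in>{1..n} - far. w j) \<le> (\<Sum>j=1..n. w j)" using w0 by (intro sum_mono2) auto
      also have "\<dots> \<le> A * (1 + C * l)" using w1 by (simp add: l_def x_def)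
      also have "\<dots> \<le> A * exp (C * l)" using A by (intro mult_left_mono) auto
      finally show "(\<Sum>j\<in>{1..n} - far. w j) \<le> A * exp (C * l)" .
      show "0 \<le> \<alpha> powr s * x powr s * (exp (4 * (C / \<alpha> * l)) * E)" by (simp add: E_def)
    qed
    also have "\<dots> = A * \<alpha> powr s * x powr s * E * exp (C1 * l)"
      by (simp add: C1_def exp_add algebra_simps)
    finally have sn: "(\<Sum>j\<in>{1..n} - far. w j * lyapunov e c s j) \<le> A * \<alpha> powr s * x powr s * E * exp (C1 * l)" .
    \<comment> \<open>Here \<open>-(1+e/2) \<le> s\<close> enters: \<open>s + (1+e/2)\<close> is
      nonnegative, so \<open>j\<close> may be replaced by \<open>x\<close>. Against the far mass
      \<open>x powr (-1-e)\<close> there remains \<open>x powr (-e/2)\<close>, which is negligible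
      beside \<open>log_decay\<close>.\<close>
    have Vfar: "lyapunov e c s j \<le> x powr s * x powr (1 + e/2)" if "j \<in> far" for j
    proof -
      have j: "1 \<le> real j" "real j \<le> x" using that by (auto simp: far_def x_def)
      have "lyapunov e c s j \<le> real j powr s * 1"
        unfolding lyapunov_def using c by (intro mult_left_mono) auto
      also have "\<dots> \<le> x powr (s + (1 + e/2))"
      proof -
        have "real j powr s \<le> real j powr (s + (1 + e/2))" using j e by (intro powr_mono) auto
        also have "\<dots> \<le> x powr (s + (1 + e/2))" using j s by (intro powr_mono2) auto
        finally show ?thesis by simp
      qed
      also have "\<dots> = x powr s * x powr (1 + e/2)" by (rule powr_add)
      finally show ?thesis .
    qed
    have "(\<Sum>j\<in>far. w j * lyapunov e c s j) \<le> (\<Sum>j\<in>far. w j * (x powr s * x powr (1 + e/2)))"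
      using w0 Vfar by (intro sum_mono mult_left_mono) (auto simp: far_def)
    also have "\<dots> = (\<Sum>j\<in>far. w j) * (x powr s * x powr (1 + e/2))" by (simp add: sum_distrib_right)
    also have "\<dots> \<le> (C * x powr (-1-e)) * (x powr s * x powr (1 + e/2))"
      using w2 by (intro mult_right_mono) (auto simp: far_def x_def l_def)
    also have "\<dots> = x powr s * (C * x powr (-e/2))"
      using N by (simp add: powr_add[symmetric] algebra_simps)
    also have "\<dots> \<le> x powr s * (A * \<alpha> / 2 * l)"
      using N by (intro mult_left_mono) auto
    also have "\<dots> \<le> x powr s * (A * \<alpha> powr s * E * l)"
    proof (intro mult_left_mono)
      \<comment> \<open>Uses \<open>s \<le> 1\<close> and the lower bound 1/2 for \<open>E\<close>,
        so the threshold for the far terms is free of \<open>s\<close>.\<close>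
      have "\<alpha> * (1/2) \<le> \<alpha> powr s * E"
        using powr_mono'[of s 1 \<alpha>] s \<alpha> E by (intro mult_mono) auto
      then have "(A * l) * (\<alpha> * (1/2)) \<le> (A * l) * (\<alpha> powr s * E)"
        using A l0 by (intro mult_left_mono) auto
      then show "A * \<alpha> / 2 * l \<le> A * \<alpha> powr s * E * l" by (simp add: algebra_simps)
    qed auto
    finally have sf: "(\<Sum>j\<in>far. w j * lyapunov e c s j) \<le> A * \<alpha> powr s * x powr s * E * l"
      by (simp add: algebra_simps)
    have "(\<Sum>j=1..n. w j * lyapunov e c s j) = (\<Sum>j\<in>far. w j * lyapunov e c s j) + (\<Sum>j\<in>{1..n} - far. w j * lyapunov e c s j)"
      by (rule sum.subset_diff[THEN trans, OF _ _ add.commute]) (auto simp: far_def)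
    also have "\<dots> \<le> A * \<alpha> powr s * x powr s * E * l + A * \<alpha> powr s * x powr s * E * exp (C1 * l)"
      using sn sf by linarith
    also have "\<dots> = A * \<alpha> powr s * x powr s * (E * (exp (C1 * l) + l))" by (simp add: algebra_simps)
    also have "\<dots> \<le> A * \<alpha> powr s * x powr s * exp (- (c * ln x powr (-e)))"
    proof (intro mult_left_mono)
      have "exp (C1 * l) + l \<le> exp (C1 * l) * (1 + l)"
        using C1 l0 by (simp add: algebra_simps)
      also have "\<dots> \<le> exp (C1 * l) * exp l" by (intro mult_left_mono) auto
      also have "\<dots> = exp ((C1 + 1) * l)" by (simp add: exp_add algebra_simps)
      finally have "E * (exp (C1 * l) + l) \<le> E * exp ((C1 + 1) * l)" by (intro mult_left_mono) (auto simp: E_def)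
      also have "\<dots> = exp ((C1+1) * l - c * ln (\<beta> * x) powr (-e))" by (simp add: E_def exp_diff exp_minus field_simps)
      also have "\<dots> \<le> exp (- (c * ln x powr (-e)))"
      proof -
        have "e * (- ln \<beta>) * ln x powr (-1-e) \<le> (ln x - (- ln \<beta>)) powr (-e) - ln x powr (-e)"
          using N lnb e by (intro powr_neg_diff_ge) auto
        also have "ln x - (- ln \<beta>) = ln (\<beta> * x)" using N \<beta> by (simp add: ln_mult)
        finally have "c * (e * (- ln \<beta>) * l) \<le> c * (ln (\<beta> * x) powr (-e) - ln x powr (-e))"
          using c by (intro mult_left_mono) (auto simp: l_def log_decay_def)
        moreover have "c * (e * (- ln \<beta>) * l) = (C1 + 1) * l"
          using e lnb by (simp add: c_def)
        ultimately show ?thesis by (simp add: algebra_simps)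
      qed
      finally show "E * (exp (C1 * l) + l) \<le> exp (- (c * ln x powr (-e)))" .
    qed (use A in auto)
    finally show "(\<Sum>j=1..n. w j * lyapunov e c s j) \<le> A * \<alpha> powr s * lyapunov e c s n"
      by (simp add: lyapunov_def x_def algebra_simps)
  qed
qed

lemma lyapunov_lower:
  assumes "n \<ge> 1" "c \<ge> 0" "e > 0"
  shows "exp (- (c * ln 2 powr (-e))) * real n powr s \<le> lyapunov e c s n"
proof -
  have "ln (real n) powr (-e) \<le> ln 2 powr (-e)"
  \<comment> \<open>At \<open>n = 1\<close> the convention \<open>0 powr (-e) = 0\<close> makes the
    correction factor 1; otherwise it is smallest at \<open>n = 2\<close>.\<close>
  proof (cases "n = 1")
    case False
    then show ?thesis using assms by (intro powr_mono2') auto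
  qed simp
  then have "exp (- (c * ln 2 powr (-e))) \<le> exp (- (c * ln (real n) powr (-e)))"
    using assms by (simp add: mult_left_mono)
  then show ?thesis unfolding lyapunov_def by (simp add: mult.commute mult_left_mono)
qed

lemma lyapunov_upper: "c \<ge> 0 \<Longrightarrow> lyapunov e c s n \<le> real n powr s"
  unfolding lyapunov_def by (simp add: mult_left_le)

text \<open>Induction on \<open>k\<close> with the Lyapunov function as majorant: nonnegative
  weights carry it from round to round. Below \<open>n0\<close>, where no drift estimate is
  available, decay at the same rate \<open>q ^ k\<close> has to come from outside.\<close>

lemma lyapunov_comparison:
  fixes u :: "nat \<Rightarrow> nat \<Rightarrow> real" and w :: "nat \<Rightarrow> nat \<Rightarrow> real"
  assumes c: "c \<ge> 0" and e: "e > 0" and q: "0 < q"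
    and V: "\<And>n. n \<ge> n0 \<Longrightarrow> n \<ge> 1 \<Longrightarrow> (\<Sum>j=1..n. w n j * lyapunov e c s j) \<le> q * lyapunov e c s n"
    and w: "\<And>n j. n \<ge> n0 \<Longrightarrow> j \<in> {1..n} \<Longrightarrow> 0 \<le> w n j"
    and u: "\<And>k n. n \<ge> n0 \<Longrightarrow> n \<ge> 1 \<Longrightarrow> u (Suc k) n \<le> (\<Sum>j=1..n. w n j * u k j)"
    and u0: "\<And>n. n \<ge> 1 \<Longrightarrow> u 0 n \<le> K * real n powr s"
    and small: "\<And>k n. 1 \<le> n \<Longrightarrow> n < n0 \<Longrightarrow> u k n \<le> K * q ^ k"
    and K: "K > 0"
  shows "\<exists>K'>0. \<forall>k n. n \<ge> 1 \<longrightarrow> u k n \<le> K' * q ^ k * real n powr s"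
proof -
  define m where "m = exp (- (c * ln 2 powr (-e)))"
  have m0: "m > 0" by (simp add: m_def)
  have Vm: "m * real n powr s \<le> lyapunov e c s n" if "n \<ge> 1" for n
    unfolding m_def by (rule lyapunov_lower[OF that c e])
  \<comment> \<open>For negative \<open>s\<close> the powers are not bounded below by 1, so the
    minimum over the finite range is taken.\<close>
  have "\<exists>b>0. \<forall>n\<in>{1..<n0}. b \<le> real n powr s"
  proof (cases "{1..<n0} = {}")
    case True
    then show ?thesis by (metis empty_iff zero_less_one)
  next
    case False
    then have "Min ((\<lambda>n. real n powr s) ` {1..<n0}) \<in> (\<lambda>n. real n powr s) ` {1..<n0}"
      by (intro Min_in) auto
    then have "Min ((\<lambda>n. real n powr s) ` {1..<n0}) > 0" by auto
    then show ?thesis by (intro exI[of _ "Min ((\<lambda>n. real n powr s) ` {1..<n0})"]) auto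
  qed
  then obtain b where b: "b > 0" "\<And>n. 1 \<le> n \<Longrightarrow> n < n0 \<Longrightarrow> b \<le> real n powr s" by auto
  \<comment> \<open>\<open>K / m\<close> is what \<open>k = 0\<close> requires,
    \<open>K / m / b\<close> what \<open>n < n0\<close> requires.\<close>
  define L where "L = K / m * (1 + 1 / b)"
  have L: "L \<ge> K / m" "L \<ge> K / m / b" "L > 0"
    using K m0 b by (auto simp: L_def algebra_simps add_pos_pos)
  have main: "u k n \<le> L * q ^ k * lyapunov e c s n" if "n \<ge> 1" for k n
    using that
  proof (induction k arbitrary: n)
    case 0
    have "u 0 n \<le> K / m * (m * real n powr s)" using u0[OF 0] m0 by simp
    also have "\<dots> \<le> L * lyapunov e c s n"
      using L Vm[OF 0] m0 by (intro mult_mono) auto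
    finally show ?case by simp
  next
    case (Suc k)
    show ?case
    proof (cases "n \<ge> n0")
      case True
      have "u (Suc k) n \<le> (\<Sum>j=1..n. w n j * u k j)" by (rule u[OF True Suc.prems])
      also have "\<dots> \<le> (\<Sum>j=1..n. w n j * (L * q ^ k * lyapunov e c s j))"
        using w[OF True] Suc.IH by (intro sum_mono mult_left_mono) auto
      also have "\<dots> = L * q ^ k * (\<Sum>j=1..n. w n j * lyapunov e c s j)"
        by (simp add: sum_distrib_left algebra_simps)
      also have "\<dots> \<le> L * q ^ k * (q * lyapunov e c s n)"
        using V[OF True Suc.prems] L q by (intro mult_left_mono) auto
      finally show ?thesis by (simp add: algebra_simps)
    next
      case False
      then have n: "n < n0" by simp
      have "u (Suc k) n \<le> q ^ Suc k * (K / m / b * (m * b))"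
        using small[OF Suc.prems n, of "Suc k"] m0 b by (simp add: mult.commute)
      also have "\<dots> \<le> q ^ Suc k * (L * lyapunov e c s n)"
      proof (intro mult_left_mono mult_mono)
        have "m * b \<le> m * real n powr s" using m0 b(2)[OF Suc.prems n] by simp
        then show "m * b \<le> lyapunov e c s n" using Vm[OF Suc.prems] by simp
      qed (use L q m0 b in auto)
      finally show ?thesis by (simp add: algebra_simps)
    qed
  qed
  show ?thesis
  proof (intro exI[of _ L] conjI allI impI)
    fix k n assume n: "n \<ge> (1::nat)"
    have "L * q ^ k * lyapunov e c s n \<le> L * q ^ k * real n powr s"
      using L q lyapunov_upper[OF c] by (intro mult_left_mono) auto
    then show "u k n \<le> L * q ^ k * real n powr s" using main[OF n, of k] by linarith
  qed (use L in auto)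
qed

section \<open>Laws on the real line and on the integers\<close>

lemma emeasure_interval_measure_Ioo:
  assumes "l \<le> u" and mono: "\<And>x y. x \<le> y \<Longrightarrow> F x \<le> F y" and cont: "continuous_on UNIV F"
  shows "emeasure (interval_measure F) {l<..<u} = ennreal (F u - F l)"
proof (cases "l = u")
  case False
  then have lu: "l < u" using assms by simp
  have rc: "continuous (at_right x) F" for x
    using cont by (metis UNIV_I continuous_on_eq_continuous_within continuous_within_subset subset_UNIV)
  have eq: "{l<..u} = {l<..<u} \<union> {u..u}" using lu by auto
  have "emeasure (interval_measure F) {l<..u} = emeasure (interval_measure F) {l<..<u} + emeasure (interval_measure F) {u..u}"
    unfolding eq by (rule plus_emeasure[symmetric]) auto
  moreover have "emeasure (interval_measure F) {u..u} = 0"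
    using emeasure_interval_measure_Icc[of u u F] mono cont by simp
  moreover have "emeasure (interval_measure F) {l<..u} = ennreal (F u - F l)"
    using emeasure_interval_measure_Ioc[of l u F] lu mono rc by simp
  ultimately show ?thesis by simp
qed simp

lemma add_measures:
  assumes "sets M = sets N"
  shows "\<exists>R. sets R = sets M \<and> (\<forall>A\<in>sets M. emeasure R A = emeasure M A + emeasure N A)"
proof -
  define R where "R = measure_of (space M) (sets M) (\<lambda>A. emeasure M A + emeasure N A)"
  have "countably_additive (sets M) (\<lambda>A. emeasure M A + emeasure N A)"
    unfolding countably_additive_def using assms
    by (auto simp: suminf_add[OF summableI summableI, symmetric] suminf_emeasure)
  then have "emeasure R A = emeasure M A + emeasure N A" if "A \<in> sets M" for A
    unfolding R_def using that
    by (intro emeasure_measure_of_sigma) (auto simp: positive_def sets.sigma_algebra_axioms)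
  moreover have "sets R = sets M" by (simp add: R_def)
  ultimately show ?thesis by blast
qed

text \<open>The Lipschitz condition says that \<open>L * x - F x\<close> is nondecreasing too. Its
  Stieltjes measure and that of \<open>F\<close> add up to \<open>L\<close> times Lebesgue measure,
  so each of them is dominated by it; no differentiation of \<open>F\<close> is involved.\<close>

lemma interval_measure_lipschitz_le:
  fixes F :: "real \<Rightarrow> real"
  assumes L: "0 < L" and mono: "\<And>x y. x \<le> y \<Longrightarrow> F x \<le> F y"
    and lip: "\<And>x y. x \<le> y \<Longrightarrow> F y - F x \<le> L * (y - x)"
    and cont: "continuous_on UNIV F" and A: "A \<in> sets borel"
  shows "emeasure (interval_measure F) A \<le> ennreal L * emeasure lborel A"
proof -
  define G where "G x = L * x - F x" for x
  have G: "G x \<le> G y" if "x \<le> y" for x y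
    using lip[OF that] by (simp add: G_def algebra_simps)
  have cG: "continuous_on UNIV G"
    unfolding G_def by (intro continuous_intros cont)
  obtain R where R: "sets R = sets (interval_measure F)"
    "\<forall>A\<in>sets (interval_measure F). emeasure R A = emeasure (interval_measure F) A + emeasure (interval_measure G) A"
    using add_measures[of "interval_measure F" "interval_measure G"] by auto
  have "lborel = scale_measure (1 / L) R"
  proof (rule lborel_eqI)
    fix l u :: real assume "\<And>b. b \<in> Basis \<Longrightarrow> l \<bullet> b \<le> u \<bullet> b"
    then have lu: "l \<le> u" by simp
    have "emeasure R {l<..<u} = ennreal (F u - F l) + ennreal (G u - G l)"
      using R emeasure_interval_measure_Ioo[OF lu mono cont] emeasure_interval_measure_Ioo[OF lu G cG] by simp
    also have "\<dots> = ennreal (L * (u - l))"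
      using mono[OF lu] G[OF lu] by (subst ennreal_plus[symmetric]) (auto simp: G_def algebra_simps)
    finally have "emeasure (scale_measure (1 / L) R) {l<..<u} = ennreal (1 / L) * ennreal (L * (u - l))"
      by simp
    also have "\<dots> = ennreal (u - l)" using L lu by (subst ennreal_mult[symmetric]) auto
    finally show "emeasure (scale_measure (1 / L) R) (box l u) = (\<Prod>b\<in>Basis. (u - l) \<bullet> b)"
      by (simp add: box_real)
  qed (use R in simp)
  from arg_cong[OF this, of "\<lambda>M. emeasure M A"]
  have "emeasure lborel A = ennreal (1 / L) * emeasure R A"
    by (simp only: emeasure_scale_measure)
  then have "ennreal L * emeasure lborel A = ennreal L * (ennreal (1 / L) * emeasure R A)"
    by (simp only:)
  also have "\<dots> = emeasure R A"
    using L by (simp flip: mult.assoc ennreal_mult)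
  also have "\<dots> \<ge> emeasure (interval_measure F) A" using R A by simp
  finally show ?thesis .
qed

lemma bounded_density_exists:
  fixes M :: "real measure"
  assumes sM: "sets M = sets borel" and L: "0 < L"
    and le: "\<And>A. A \<in> sets borel \<Longrightarrow> emeasure M A \<le> ennreal L * emeasure lborel A"
  shows "\<exists>f. f \<in> borel_measurable borel \<and> (\<forall>x. 0 \<le> f x \<and> f x \<le> L) \<and> density lborel (\<lambda>x. ennreal (f x)) = M"
proof -
  have "absolutely_continuous lborel M"
    unfolding absolutely_continuous_def using le sM by (force simp: null_sets_def)
  then obtain g where g[measurable]: "g \<in> borel_measurable lborel" and dg: "density lborel g = M"
    using sigma_finite_measure.Radon_Nikodym[OF sigma_finite_lborel, of M] sM by auto
  have "AE x in lborel. \<not> (x \<in> {-real n..real n} \<and> g x > ennreal L)" for n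
  proof -
    define A where "A = {x. x \<in> {-real n..real n} \<and> g x > ennreal L}"
    have A[measurable]: "A \<in> sets borel" unfolding A_def by measurable
    have "emeasure lborel A \<le> emeasure lborel {-real n..real n}"
      by (intro emeasure_mono) (auto simp: A_def)
    then have fin: "emeasure lborel A < \<infinity>" by (simp add: le_less_trans)
    have finL: "(\<integral>\<^sup>+x. ennreal L * indicator A x \<partial>lborel) \<noteq> \<infinity>"
      using fin by (simp add: nn_integral_cmult_indicator ennreal_mult_eq_top_iff)
    have "(\<integral>\<^sup>+x. g x * indicator A x - ennreal L * indicator A x \<partial>lborel)
        = (\<integral>\<^sup>+x. g x * indicator A x \<partial>lborel) - (\<integral>\<^sup>+x. ennreal L * indicator A x \<partial>lborel)"
      using finL by (intro nn_integral_diff) (auto simp: A_def indicator_def)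
    also have "(\<integral>\<^sup>+x. g x * indicator A x \<partial>lborel) = emeasure M A"
      unfolding dg[symmetric] by (intro emeasure_density[symmetric]) auto
    also have "(\<integral>\<^sup>+x. ennreal L * indicator A x \<partial>lborel) = ennreal L * emeasure lborel A"
      by (simp add: nn_integral_cmult_indicator)
    also have "emeasure M A - ennreal L * emeasure lborel A = 0"
    proof -
      have "ennreal L * emeasure lborel A < top" using fin by (simp add: ennreal_mult_less_top)
      then have "emeasure M A < top" using le[OF A] by (rule le_less_trans[rotated])
      then show ?thesis using le[OF A] by (simp add: diff_eq_0_iff_ennreal)
    qed
    finally have "AE x in lborel. g x * indicator A x - ennreal L * indicator A x = 0"
      by (subst (asm) nn_integral_0_iff_AE) auto
    then show ?thesis
    proof eventually_elim
      case (elim x)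
      then show ?case
        by (auto simp: A_def indicator_def diff_eq_0_iff_ennreal split: if_splits)
    qed
  qed
  then have "AE x in lborel. \<forall>n. \<not> (x \<in> {-real n..real n} \<and> g x > ennreal L)"
    by (simp add: AE_all_countable)
  then have bd: "AE x in lborel. g x \<le> ennreal L"
  proof eventually_elim
    case (elim x)
    obtain n :: nat where "\<bar>x\<bar> \<le> real n" using real_arch_simple by blast
    then have "x \<in> {-real n..real n}" by auto
    then show ?case using elim by (auto simp: not_less)
  qed
  \<comment> \<open>Truncation changes \<open>g\<close> only on a null set and turns the almost sure
    bound into a pointwise one.\<close>
  define f where "f x = enn2real (min (g x) (ennreal L))" for x
  have f: "ennreal (f x) = min (g x) (ennreal L)" for x
    unfolding f_def by (intro ennreal_enn2real) (simp add: min.strict_coboundedI2)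
  have "f x \<le> L" for x
    using L by (simp add: ennreal_le_iff[symmetric] f)
  moreover have "0 \<le> f x" for x by (simp add: f_def)
  moreover have "f \<in> borel_measurable borel" unfolding f_def by measurable
  moreover have "density lborel (\<lambda>x. ennreal (f x)) = M"
    unfolding dg[symmetric] using bd
    by (intro density_cong) (auto simp: f min_def)
  ultimately show ?thesis by blast
qed

lemma lipschitz_cdf_density:
  fixes F :: "real \<Rightarrow> real"
  assumes L: "0 < L" and mono: "\<And>x y. x \<le> y \<Longrightarrow> F x \<le> F y"
    and lip: "\<And>x y. x \<le> y \<Longrightarrow> F y - F x \<le> L * (y - x)"
    and bot: "(F \<longlongrightarrow> 0) at_bot" and top: "(F \<longlongrightarrow> 1) at_top"
  shows "\<exists>f. f \<in> borel_measurable borel \<and> (\<forall>x. 0 \<le> f x \<and> f x \<le> L) \<and>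
    prob_space (density lborel (\<lambda>x. ennreal (f x))) \<and>
    (\<forall>x. F x = measure (density lborel (\<lambda>x. ennreal (f x))) {..x})"
proof -
  have "\<bar>F y - F x\<bar> \<le> L * \<bar>y - x\<bar>" for x y
    using lip[of x y] lip[of y x] mono[of x y] mono[of y x] by (cases "x \<le> y") auto
  then have "L-lipschitz_on UNIV F"
    using L by (intro lipschitz_onI) (auto simp: dist_real_def abs_minus_commute)
  then have cont: "continuous_on UNIV F" by (rule lipschitz_on_continuous_on)
  then have rc: "continuous (at_right x) F" for x
    by (metis UNIV_I continuous_on_eq_continuous_within continuous_within_subset subset_UNIV)
  interpret real_distribution "interval_measure F"
    by (rule real_distribution_interval_measure[OF mono rc bot top])
  obtain f where f: "f \<in> borel_measurable borel" "\<forall>x. 0 \<le> f x \<and> f x \<le> L"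
      "density lborel (\<lambda>x. ennreal (f x)) = interval_measure F"
    using bounded_density_exists[of "interval_measure F" L] interval_measure_lipschitz_le[OF L mono lip cont] L
    by auto
  have "cdf (interval_measure F) x = F x" for x
    by (rule cdf_interval_measure[OF mono rc bot, THEN fun_cong])
  then show ?thesis
    using f prob_space_axioms by (auto simp: cdf_def intro!: exI[of _ f])
qed

section \<open>Quantile coupling and the two distances on the integers\<close>

text \<open>The half-open interval consists of the levels \<open>k\<close> for which exactly one of
  \<open>x \<le> k\<close> and \<open>w \<le> k\<close> holds; this converts a distance into a sum
  of events seen by distribution functions.\<close>

lemma nn_integral_int_interval:
  "(\<integral>\<^sup>+k. indicator {min x w..<max x w} k \<partial>count_space UNIV) = ennreal \<bar>real_of_int x - real_of_int w\<bar>"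
proof -
  have "(\<integral>\<^sup>+k. indicator {min x w..<max x w} k \<partial>count_space UNIV) = emeasure (count_space UNIV) {min x w..<max x w}"
    by (rule nn_integral_indicator) simp
  also have "\<dots> = of_nat (card {min x w..<max x w})" by (subst emeasure_count_space) auto
  also have "real (card {min x w..<max x w}) = \<bar>real_of_int x - real_of_int w\<bar>"
    by (auto simp: min_def max_def)
  then have "of_nat (card {min x w..<max x w}) = ennreal \<bar>real_of_int x - real_of_int w\<bar>"
    by (simp add: ennreal_of_nat_eq_real_of_nat)
  finally show ?thesis .
qed

text \<open>On the reals the pseudoinverse of the distribution function is at hand. Rounding it up
  gives integer values and keeps the equivalence with \<open>u \<le> measure M {..k}\<close>, since
  a ceiling is at most \<open>k\<close> iff its argument is.\<close>

lemma quantile_exists: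
  fixes M :: "int measure"
  assumes "prob_space M" and sM: "sets M = sets (count_space UNIV)"
  shows "\<exists>X. X \<in> measurable (restrict_space lborel {0<..<1::real}) (count_space UNIV) \<and>
    distr (restrict_space lborel {0<..<1}) M X = M \<and>
    (\<forall>u\<in>{0<..<1}. \<forall>k. X u \<le> k \<longleftrightarrow> u \<le> measure M {..k})"
proof -
  interpret M: prob_space M by fact
  have spM: "space M = UNIV" using sets_eq_imp_space_eq[OF sM] by simp
  have mM[measurable]: "real_of_int \<in> borel_measurable M"
    unfolding measurable_cong_sets[OF sM refl] by simp
  define D where "D = distr M borel real_of_int"
  interpret D: prob_space D unfolding D_def by (rule M.prob_space_distr) simp
  interpret D: real_distribution D by standard (simp add: D_def)
  interpret D: cdf_distribution D ..
  have cdfD: "cdf D (real_of_int k) = measure M {..k}" for k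
    unfolding cdf_def D_def by (subst measure_distr) (auto simp: spM intro!: arg_cong[where f = "measure M"])
  let ?P = "restrict_space lborel {0<..<1::real}"
  have mI: "D.I \<in> borel_measurable ?P"
    using D.measurable_CI by (simp add: measurable_def space_restrict_space sets_restrict_space)
  define X where "X u = \<lceil>D.I u\<rceil>" for u
  have X: "X \<in> measurable ?P (count_space UNIV)" unfolding X_def using mI by measurable
  have "distr ?P M X = distr ?P (count_space UNIV) X"
    by (intro distr_cong) (auto simp: sM)
  also have "\<dots> = distr (distr ?P borel D.I) (count_space UNIV) ceiling"
    using mI by (subst distr_distr) (auto simp: comp_def X_def[abs_def])
  also have "distr ?P borel D.I = D" by (rule D.distr_I_eq_M)
  also have "distr D (count_space UNIV) ceiling = distr M (count_space UNIV) (\<lambda>k. k)"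
    unfolding D_def by (subst distr_distr) (auto simp: comp_def)
  also have "\<dots> = M" by (rule distr_id2) (simp add: sM)
  finally have "distr ?P M X = M" .
  moreover have "X u \<le> k \<longleftrightarrow> u \<le> measure M {..k}" if "u \<in> {0<..<1}" for u k
    using D.pseudoinverse[of u "real_of_int k"] that by (simp add: X_def ceiling_le_iff cdfD)
  ultimately show ?thesis using X by blast
qed

text \<open>Both laws are realised on the unit interval by their quantile functions.\<close>

lemma coupling_exists:
  fixes M N :: "int measure"
  assumes M: "prob_space M" "sets M = sets (count_space UNIV)"
    and N: "prob_space N" "sets N = sets (count_space UNIV)"
  shows "\<exists>\<mu>\<in>couplings M N. (\<integral>\<^sup>+ z. ennreal (real_of_int \<bar>fst z - snd z\<bar>) \<partial>\<mu>)
    \<le> (\<integral>\<^sup>+k. ennreal \<bar>measure M {..k} - measure N {..k}\<bar> \<partial>count_space UNIV)"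
proof -
  let ?P = "restrict_space lborel {0<..<1::real}"
  interpret P: prob_space ?P
    by (auto simp: emeasure_restrict_space space_restrict_space intro!: prob_spaceI)
  interpret M: prob_space M by fact
  interpret N: prob_space N by fact
  obtain X where X[measurable]: "X \<in> measurable ?P (count_space UNIV)" and dX: "distr ?P M X = M"
    and X': "\<And>u k. u \<in> {0<..<1} \<Longrightarrow> X u \<le> k \<longleftrightarrow> u \<le> measure M {..k}"
    using quantile_exists[OF M] by blast
  obtain W where W[measurable]: "W \<in> measurable ?P (count_space UNIV)" and dW: "distr ?P N W = N"
    and W': "\<And>u k. u \<in> {0<..<1} \<Longrightarrow> W u \<le> k \<longleftrightarrow> u \<le> measure N {..k}"
    using quantile_exists[OF N] by blast
  have XM[measurable]: "X \<in> measurable ?P M" unfolding measurable_cong_sets[OF refl M(2)] by (rule X)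
  have WN[measurable]: "W \<in> measurable ?P N" unfolding measurable_cong_sets[OF refl N(2)] by (rule W)
  define \<mu> where "\<mu> = distr ?P (M \<Otimes>\<^sub>M N) (\<lambda>u. (X u, W u))"
  have sMN: "sets (M \<Otimes>\<^sub>M N) = UNIV"
    unfolding sets_pair_measure_cong[OF M(2) N(2)] by (subst pair_measure_countable) auto
  have "\<mu> \<in> couplings M N"
    unfolding couplings_def
  proof (intro CollectI conjI)
    show "prob_space \<mu>" unfolding \<mu>_def by (intro P.prob_space_distr) measurable
    show "sets \<mu> = sets (M \<Otimes>\<^sub>M N)" by (simp add: \<mu>_def)
    show "distr \<mu> M fst = M" unfolding \<mu>_def by (subst distr_distr) (auto simp: comp_def dX)
    show "distr \<mu> N snd = N" unfolding \<mu>_def by (subst distr_distr) (auto simp: comp_def dW)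
  qed
  moreover have "(\<integral>\<^sup>+ z. ennreal (real_of_int \<bar>fst z - snd z\<bar>) \<partial>\<mu>)
      \<le> (\<integral>\<^sup>+k. ennreal \<bar>measure M {..k} - measure N {..k}\<bar> \<partial>count_space UNIV)"
  proof -
    \<comment> \<open>The \<open>u\<close> at which level \<open>k\<close> separates the two
      quantiles; its length is the difference of the distribution functions at
      \<open>k\<close>.\<close>
    define J where "J k = {min (measure M {..k}) (measure N {..k})<..max (measure M {..k}) (measure N {..k})}" for k :: int
    \<comment> \<open>Enumerating the integers turns the interchange of sum and integral into
      monotone convergence for a series.\<close>
    have decode: "(\<integral>\<^sup>+k. g k \<partial>count_space UNIV) = (\<Sum>i. g (int_decode i))" for g :: "int \<Rightarrow> ennreal"
      using nn_integral_bij_count_space[OF bij_int_decode, of g] by (simp add: nn_integral_count_space_nat)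
    have "(\<integral>\<^sup>+ z. ennreal (real_of_int \<bar>fst z - snd z\<bar>) \<partial>\<mu>) = (\<integral>\<^sup>+u. ennreal \<bar>real_of_int (X u) - real_of_int (W u)\<bar> \<partial>?P)"
    proof -
      have "(\<lambda>u. (X u, W u)) \<in> measurable ?P (M \<Otimes>\<^sub>M N)" by measurable
      moreover have "(\<lambda>z. ennreal (real_of_int \<bar>fst z - snd z\<bar>)) \<in> borel_measurable (M \<Otimes>\<^sub>M N)"
        by (simp add: measurable_def sMN)
      ultimately show ?thesis unfolding \<mu>_def by (subst nn_integral_distr) auto
    qed
    also have "\<dots> = (\<integral>\<^sup>+u. (\<integral>\<^sup>+k. indicator (J k) u \<partial>count_space UNIV) \<partial>?P)"
    proof (intro nn_integral_cong)
      fix u assume "u \<in> space ?P"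
      then have u: "u \<in> {0<..<1}" by (simp add: space_restrict_space)
      have "indicator {min (X u) (W u)..<max (X u) (W u)} k = (indicator (J k) u :: ennreal)" for k
        using X'[OF u, of k] W'[OF u, of k] by (auto simp: J_def indicator_def min_def max_def)
      then show "ennreal \<bar>real_of_int (X u) - real_of_int (W u)\<bar> = (\<integral>\<^sup>+k. indicator (J k) u \<partial>count_space UNIV)"
        unfolding nn_integral_int_interval[symmetric] by (intro nn_integral_cong)
    qed
    also have "\<dots> = (\<integral>\<^sup>+u. (\<Sum>i. indicator (J (int_decode i)) u) \<partial>?P)"
      by (simp only: decode)
    also have "\<dots> = (\<Sum>i. \<integral>\<^sup>+u. indicator (J (int_decode i)) u \<partial>?P)"
      by (intro nn_integral_suminf measurable_restrict_space1) (auto simp: J_def)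
    also have "\<dots> = (\<integral>\<^sup>+k. (\<integral>\<^sup>+u. indicator (J k) u \<partial>?P) \<partial>count_space UNIV)"
      by (simp only: decode)
    also have "\<dots> \<le> (\<integral>\<^sup>+k. ennreal \<bar>measure M {..k} - measure N {..k}\<bar> \<partial>count_space UNIV)"
    proof (intro nn_integral_mono)
      fix k
      have "(\<integral>\<^sup>+u. indicator (J k) u \<partial>?P) = (\<integral>\<^sup>+u. indicator (J k) u * indicator {0<..<1} u \<partial>lborel)"
        by (subst nn_integral_restrict_space) auto
      also have "\<dots> \<le> (\<integral>\<^sup>+u. indicator (J k) u \<partial>lborel)"
        by (intro nn_integral_mono) (auto simp: indicator_def)
      also have "\<dots> = ennreal \<bar>measure M {..k} - measure N {..k}\<bar>"
        by (auto simp: J_def min_def max_def)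
      finally show "(\<integral>\<^sup>+u. indicator (J k) u \<partial>?P) \<le> ennreal \<bar>measure M {..k} - measure N {..k}\<bar>" .
    qed
    finally show ?thesis .
  qed
  ultimately show ?thesis by blast
qed

lemma dW_le_cdf_diff:
  fixes M N :: "int measure"
  assumes M: "prob_space M" "sets M = sets (count_space UNIV)"
    and N: "prob_space N" "sets N = sets (count_space UNIV)"
  shows "dW M N \<le> (\<integral>\<^sup>+k. ennreal \<bar>measure M {..k} - measure N {..k}\<bar> \<partial>count_space UNIV)"
proof -
  obtain \<mu> where "\<mu> \<in> couplings M N" "(\<integral>\<^sup>+ z. ennreal (real_of_int \<bar>fst z - snd z\<bar>) \<partial>\<mu>)
    \<le> (\<integral>\<^sup>+k. ennreal \<bar>measure M {..k} - measure N {..k}\<bar> \<partial>count_space UNIV)"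
    using coupling_exists[OF assms] by blast
  then show ?thesis unfolding dW_def by (rule INF_lower2)
qed

text \<open>Distinct integers are at distance at least 1, so under the coupling the probability of
  disagreement is at most the expected distance, and it bounds the difference on every
  event.\<close>

lemma dTV_le_cdf_diff:
  fixes M N :: "int measure"
  assumes M: "prob_space M" "sets M = sets (count_space UNIV)"
    and N: "prob_space N" "sets N = sets (count_space UNIV)"
    and s: "(\<integral>\<^sup>+k. ennreal \<bar>measure M {..k} - measure N {..k}\<bar> \<partial>count_space UNIV) \<le> ennreal s" "0 \<le> s"
  shows "0 \<le> dTV M N \<and> dTV M N \<le> s"
proof -
  interpret M: prob_space M by fact
  interpret N: prob_space N by fact
  obtain \<mu> where \<mu>: "\<mu> \<in> couplings M N" and c: "(\<integral>\<^sup>+ z. ennreal (real_of_int \<bar>fst z - snd z\<bar>) \<partial>\<mu>)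
    \<le> (\<integral>\<^sup>+k. ennreal \<bar>measure M {..k} - measure N {..k}\<bar> \<partial>count_space UNIV)"
    using coupling_exists[OF M N] by blast
  interpret \<mu>: prob_space \<mu> using \<mu> by (simp add: couplings_def)
  have "sets (M \<Otimes>\<^sub>M N) = UNIV"
    unfolding sets_pair_measure_cong[OF M(2) N(2)] by (subst pair_measure_countable) auto
  then have s\<mu>: "sets \<mu> = UNIV"
    using \<mu> by (simp add: couplings_def)
  have sp\<mu>: "space \<mu> = UNIV" using sets_eq_imp_space_eq[of \<mu> "count_space UNIV"] s\<mu> by simp
  have d: "measure M A = measure \<mu> {z. fst z \<in> A}" "measure N A = measure \<mu> {z. snd z \<in> A}" for A
  proof -
    have "fst \<in> measurable \<mu> M" "snd \<in> measurable \<mu> N"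
      using s\<mu> sp\<mu> sets_eq_imp_space_eq[OF M(2)] sets_eq_imp_space_eq[OF N(2)] by (auto simp: measurable_def)
    from measure_distr[OF this(1), of A] measure_distr[OF this(2), of A]
    show "measure M A = measure \<mu> {z. fst z \<in> A}" "measure N A = measure \<mu> {z. snd z \<in> A}"
      using \<mu> M(2) N(2) by (auto simp: couplings_def sp\<mu> vimage_def)
  qed
  have ne: "measure \<mu> {z. fst z \<noteq> snd z} \<le> s"
  proof -
    have "ennreal (measure \<mu> {z. fst z \<noteq> snd z}) = (\<integral>\<^sup>+z. indicator {z. fst z \<noteq> snd z} z \<partial>\<mu>)"
      using s\<mu> by (simp add: \<mu>.emeasure_eq_measure)
    also have "\<dots> \<le> (\<integral>\<^sup>+ z. ennreal (real_of_int \<bar>fst z - snd z\<bar>) \<partial>\<mu>)"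
    proof (intro nn_integral_mono)
      fix z :: "int \<times> int"
      show "indicator {z. fst z \<noteq> snd z} z \<le> ennreal (real_of_int \<bar>fst z - snd z\<bar>)"
      proof (cases "fst z = snd z")
        case False
        then have "1 \<le> real_of_int \<bar>fst z - snd z\<bar>" by linarith
        then show ?thesis using False by (simp add: ennreal_1[symmetric] del: ennreal_1)
      qed simp
    qed
    also note c
    also note s(1)
    finally show ?thesis using s(2) by simp
  qed
  have bd: "\<bar>measure M A - measure N A\<bar> \<le> s" for A
  proof -
    have "measure \<mu> {z. fst z \<in> A} \<le> measure \<mu> {z. snd z \<in> A} + measure \<mu> {z. fst z \<noteq> snd z}"
      by (rule order_trans[OF \<mu>.finite_measure_mono measure_Un_le]) (auto simp: s\<mu>)
    moreover have "measure \<mu> {z. snd z \<in> A} \<le> measure \<mu> {z. fst z \<in> A} + measure \<mu> {z. fst z \<noteq> snd z}"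
      by (rule order_trans[OF \<mu>.finite_measure_mono measure_Un_le]) (auto simp: s\<mu>)
    ultimately show ?thesis using ne d[of A] by linarith
  qed
  have "bdd_above ((\<lambda>A. \<bar>measure M A - measure N A\<bar>) ` sets M)"
    using bd by (intro bdd_aboveI[of _ s]) auto
  then have "\<bar>measure M {} - measure N {}\<bar> \<le> dTV M N"
    unfolding dTV_def by (rule cSUP_upper[rotated]) simp
  moreover have "dTV M N \<le> s"
    unfolding dTV_def using bd by (intro cSUP_least) auto
  ultimately show ?thesis by simp
qed

section \<open>Sums over the integers and limits of rescaled integer parts\<close>

lemma int_power_sum_bound:
  fixes q :: real
  assumes q: "0 < q" "q < 1"
  shows "\<exists>S\<ge>0. \<forall>y::real. (\<integral>\<^sup>+k. ennreal (q powr \<bar>real_of_int k - y\<bar>) \<partial>count_space UNIV) \<le> ennreal S"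
proof -
  \<comment> \<open>\<open>int_decode\<close> runs through 0, -1, 1, -2, ..., so its absolute value
    is at least \<open>i div 2\<close>, and the powers of \<open>q\<close> become powers of
    \<open>sqrt q\<close> up to one lost factor \<open>1/p\<close>.\<close>
  define p where "p = sqrt q"
  have p: "0 < p" "p < 1" "p * p = q" using q by (auto simp: p_def)
  have sp: "summable (\<lambda>i. (1/p) * p ^ i)"
    using p by (intro summable_mult summable_geometric) auto
  define S where "S = (1/q) * (\<Sum>i. (1/p) * p ^ i)"
  have S0: "0 \<le> S" unfolding S_def using p q by (intro mult_nonneg_nonneg suminf_nonneg sp) auto
  have dec: "q powr \<bar>real_of_int (int_decode i)\<bar> \<le> (1/p) * p ^ i" for i
  proof -
    have "int (i div 2) \<le> \<bar>int_decode i\<bar>"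
      by (auto simp: int_decode_def sum_decode_def)
    then have "real_of_int (int (i div 2)) \<le> \<bar>real_of_int (int_decode i)\<bar>" by linarith
    then have "q powr \<bar>real_of_int (int_decode i)\<bar> \<le> q powr real (i div 2)"
      using q by (intro powr_mono') auto
    also have "\<dots> = q ^ (i div 2)" using q by (simp add: powr_realpow)
    also have "\<dots> = p ^ (2 * (i div 2))" using p by (simp add: power_mult power2_eq_square)
    also have "p * p ^ (2 * (i div 2)) \<le> p ^ i"
    proof -
      have "p ^ Suc (2 * (i div 2)) \<le> p ^ i" using p by (intro power_decreasing) auto
      then show ?thesis by simp
    qed
    then have "p ^ (2 * (i div 2)) \<le> (1/p) * p ^ i" using p by (simp add: field_simps)
    finally show ?thesis .
  qed
  have "(\<integral>\<^sup>+k. ennreal (q powr \<bar>real_of_int k - y\<bar>) \<partial>count_space UNIV) \<le> ennreal S" for y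
  proof -
    \<comment> \<open>Recentring at the integer part of \<open>y\<close> changes each exponent by at
      most 1, hence costs a factor \<open>1/q\<close> and makes the bound uniform in
      \<open>y\<close>.\<close>
    define m where "m = \<lfloor>y\<rfloor>"
    have bij: "bij (\<lambda>k. k + m)"
      by (intro bij_betwI[where g = "\<lambda>k. k - m"]) auto
    have "(\<integral>\<^sup>+k. ennreal (q powr \<bar>real_of_int k - y\<bar>) \<partial>count_space UNIV)
        = (\<integral>\<^sup>+k. ennreal (q powr \<bar>real_of_int (k + m) - y\<bar>) \<partial>count_space UNIV)"
      by (rule nn_integral_bij_count_space[OF bij, symmetric])
    also have "\<dots> \<le> (\<integral>\<^sup>+k. ennreal ((1/q) * q powr \<bar>real_of_int k\<bar>) \<partial>count_space UNIV)"
    proof (intro nn_integral_mono ennreal_leI)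
      fix k :: int
      have "\<bar>real_of_int m - y\<bar> \<le> 1" unfolding m_def by linarith
      then have "\<bar>real_of_int k\<bar> - 1 \<le> \<bar>real_of_int (k + m) - y\<bar>" by simp
      then have "q powr \<bar>real_of_int (k + m) - y\<bar> \<le> q powr (\<bar>real_of_int k\<bar> - 1)"
        using q by (intro powr_mono') auto
      also have "\<dots> = (1/q) * q powr \<bar>real_of_int k\<bar>" using q by (simp add: powr_diff)
      finally show "q powr \<bar>real_of_int (k + m) - y\<bar> \<le> (1/q) * q powr \<bar>real_of_int k\<bar>" .
    qed
    also have "\<dots> = (\<Sum>i. ennreal ((1/q) * q powr \<bar>real_of_int (int_decode i)\<bar>))"
      using nn_integral_bij_count_space[OF bij_int_decode, of "\<lambda>k. ennreal ((1/q) * q powr \<bar>real_of_int k\<bar>)"]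
      by (simp add: nn_integral_count_space_nat)
    also have "\<dots> \<le> (\<Sum>i. ennreal ((1/q) * ((1/p) * p ^ i)))"
      using dec q by (intro suminf_le summableI ennreal_leI mult_left_mono) auto
    also have "\<dots> = ennreal S"
    proof (rule suminf_ennreal_eq)
      show "(\<lambda>i. (1/q) * ((1/p) * p ^ i)) sums S"
        unfolding S_def by (intro sums_mult summable_sums sp)
    qed (use p q in auto)
    finally show ?thesis .
  qed
  then show ?thesis using S0 by blast
qed

lemma integral_count_space_bound:
  fixes g :: "'i \<Rightarrow> real"
  assumes "(\<integral>\<^sup>+k. ennreal \<bar>g k\<bar> \<partial>count_space UNIV) \<le> ennreal B" "0 \<le> B"
  shows "integrable (count_space UNIV) g" "\<bar>\<integral>k. g k \<partial>count_space UNIV\<bar> \<le> B"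
proof -
  show int: "integrable (count_space UNIV) g"
    using assms(1) by (auto simp: integrable_iff_bounded intro: le_less_trans)
  have "ennreal \<bar>\<integral>k. g k \<partial>count_space UNIV\<bar> \<le> (\<integral>\<^sup>+k. ennreal \<bar>g k\<bar> \<partial>count_space UNIV)"
    using integral_norm_bound_ennreal[OF int] by simp
  also note assms(1)
  finally show "\<bar>\<integral>k. g k \<partial>count_space UNIV\<bar> \<le> B" using assms(2) by simp
qed

lemma nn_integral_int_nat:
  fixes g :: "nat \<Rightarrow> ennreal"
  shows "(\<integral>\<^sup>+k. (if k < 0 then 0 else g (nat k)) \<partial>count_space UNIV) = (\<Sum>i. g i)"
proof -
  have bij: "bij_betw int UNIV {0..}"
    by (rule bij_betwI[where g = nat]) auto
  have "(\<integral>\<^sup>+k. (if k < 0 then 0 else g (nat k)) \<partial>count_space UNIV)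
      = (\<integral>\<^sup>+k. g (nat k) * indicator {0..} k \<partial>count_space UNIV)"
    by (intro nn_integral_cong) (auto simp: indicator_def)
  also have "\<dots> = (\<integral>\<^sup>+k. g (nat k) \<partial>count_space {0..})"
    by (rule nn_integral_count_space_indicator[symmetric]) simp
  also have "\<dots> = (\<integral>\<^sup>+i. g (nat (int i)) \<partial>count_space UNIV)"
    by (rule nn_integral_bij_count_space[OF bij, symmetric])
  finally show ?thesis by (simp add: nn_integral_count_space_nat)
qed

lemma SUP_abs_tendsto_0:
  fixes g :: "nat \<Rightarrow> int \<Rightarrow> real"
  assumes "\<eta> \<longlonglongrightarrow> 0" and "eventually (\<lambda>n. \<forall>k. \<bar>g n k\<bar> \<le> \<eta> n) sequentially"
  shows "(\<lambda>n. SUP k. \<bar>g n k\<bar>) \<longlonglongrightarrow> 0"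
proof (rule tendsto_sandwich[OF _ _ tendsto_const assms(1)])
  show "eventually (\<lambda>n. 0 \<le> (SUP k. \<bar>g n k\<bar>)) sequentially"
    using assms(2)
  proof eventually_elim
    case (elim n)
    then have "bdd_above (range (\<lambda>k. \<bar>g n k\<bar>))" by (intro bdd_aboveI[of _ "\<eta> n"]) auto
    then have "\<bar>g n 0\<bar> \<le> (SUP k. \<bar>g n k\<bar>)" by (intro cSUP_upper) auto
    then show ?case by simp
  qed
  show "eventually (\<lambda>n. (SUP k. \<bar>g n k\<bar>) \<le> \<eta> n) sequentially"
    using assms(2) by eventually_elim (auto intro!: cSUP_least)
qed

lemma filterlim_divide_power_at_top:
  fixes t q :: real
  assumes "0 < t" "0 < q" "q < 1"
  shows "filterlim (\<lambda>m. t / q ^ m) at_top sequentially"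
  using assms by real_asymp

lemma floor_nat_bounds:
  assumes "0 \<le> (x::real)"
  shows "x - 1 < real (nat \<lfloor>x\<rfloor>)" "real (nat \<lfloor>x\<rfloor>) \<le> x"
  using assms by linarith+

text \<open>Serves to pass bounds at the integer starting points
  \<open>nat \<lfloor>t / \<alpha> ^ m\<rfloor>\<close> to bounds on the limit function at
  \<open>t\<close>.\<close>

lemma floor_scaled_tendsto:
  fixes t q :: real
  assumes "0 < t" "0 < q" "q < 1"
  shows "(\<lambda>m. q ^ m * real (nat \<lfloor>t / q ^ m\<rfloor>)) \<longlonglongrightarrow> t"
proof (rule tendsto_sandwich)
  have "(\<lambda>m. q ^ m) \<longlonglongrightarrow> 0" using assms by (intro LIMSEQ_realpow_zero) auto
  then show "(\<lambda>m. t - q ^ m) \<longlonglongrightarrow> t" using tendsto_diff[OF tendsto_const] by fastforce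
  have *: "t / q ^ m - 1 \<le> real (nat \<lfloor>t / q ^ m\<rfloor>)" "real (nat \<lfloor>t / q ^ m\<rfloor>) \<le> t / q ^ m" for m
    using assms floor_nat_bounds[of "t / q ^ m"] by simp_all
  show "eventually (\<lambda>m. t - q ^ m \<le> q ^ m * real (nat \<lfloor>t / q ^ m\<rfloor>)) sequentially"
  proof (intro always_eventually allI)
    show "t - q ^ m \<le> q ^ m * real (nat \<lfloor>t / q ^ m\<rfloor>)" for m
      using mult_left_mono[OF *(1)[of m], of "q ^ m"] assms by (simp add: right_diff_distrib)
  qed
  show "eventually (\<lambda>m. q ^ m * real (nat \<lfloor>t / q ^ m\<rfloor>) \<le> t) sequentially"
  proof (intro always_eventually allI)
    show "q ^ m * real (nat \<lfloor>t / q ^ m\<rfloor>) \<le> t" for m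
      using mult_left_mono[OF *(2)[of m], of "q ^ m"] assms by simp
  qed
qed auto

lemma floor_scaled_powr_tendsto:
  fixes t q p :: real
  assumes "0 < t" "0 < q" "q < 1"
  shows "(\<lambda>m. (q powr p) ^ m * real (nat \<lfloor>t / q ^ m\<rfloor>) powr p) \<longlonglongrightarrow> t powr p"
proof -
  have "(\<lambda>m. (q ^ m * real (nat \<lfloor>t / q ^ m\<rfloor>)) powr p) \<longlonglongrightarrow> t powr p"
    using assms by (intro tendsto_powr floor_scaled_tendsto tendsto_const) auto
  moreover have "(q ^ m) powr p = (q powr p) ^ m" for m
    using assms by (simp add: powr_power powr_powr mult.commute flip: powr_realpow)
  ultimately show ?thesis using assms by (simp add: powr_mult)
qed

section \<open>Tail and increment bounds for the chain\<close>

lemma expectation_pmf_sum: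
  fixes g :: "nat \<Rightarrow> real"
  assumes "set_pmf p \<subseteq> {1..N}"
  shows "measure_pmf.expectation p g = (\<Sum>j=1..N. pmf p j * g j)"
  using assms by (subst integral_measure_pmf_real[of "{1..N}"]) (auto simp: mult.commute)

text \<open>Abel summation. \<open>N\<close> may exceed the support, so that \<open>Y n\<close> and
  \<open>Y (Suc n)\<close> can later share one range of summation.\<close>

lemma expectation_by_parts:
  fixes g :: "nat \<Rightarrow> real"
  assumes p: "set_pmf p \<subseteq> {1..N}"
  shows "measure_pmf.expectation p g
    = g 1 + (\<Sum>j=1..N. (g (Suc j) - g j) * measure_pmf.prob p {j<..})"
proof -
  have *: "g i = g 1 + (\<Sum>j=1..N. (g (Suc j) - g j) * indicator {j<..} i)" if "i \<in> set_pmf p" for i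
  proof -
    have i: "1 \<le> i" "i \<le> N" using that p by auto
    have "(\<Sum>j=1..N. (g (Suc j) - g j) * indicator {j<..} i) = (\<Sum>j\<in>{1..<i}. g (Suc j) - g j)"
      using i by (intro sum.mono_neutral_cong_right) (auto simp: indicator_def)
    also have "\<dots> = g i - g 1" using i by (simp add: sum_Suc_diff')
    finally show ?thesis by simp
  qed
  have "finite (set_pmf p)" using p finite_subset by blast
  note int = integrable_measure_pmf_finite[OF this]
  have "measure_pmf.expectation p g
      = measure_pmf.expectation p (\<lambda>i. g 1 + (\<Sum>j=1..N. (g (Suc j) - g j) * indicator {j<..} i))"
    using * by (intro integral_cong_AE) (auto intro!: AE_pmfI)
  also have "\<dots> = measure_pmf.expectation p (\<lambda>i. g 1)
      + measure_pmf.expectation p (\<lambda>i. \<Sum>j=1..N. (g (Suc j) - g j) * indicator {j<..} i)"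
    by (intro Bochner_Integration.integral_add int)
  also have "measure_pmf.expectation p (\<lambda>i. \<Sum>j=1..N. (g (Suc j) - g j) * indicator {j<..} i)
      = (\<Sum>j=1..N. measure_pmf.expectation p (\<lambda>i. (g (Suc j) - g j) * indicator {j<..} i))"
    by (intro Bochner_Integration.integral_sum int)
  finally show ?thesis by simp
qed

lemma measure_bind_pmf:
  "measure_pmf.prob (bind_pmf p f) X = measure_pmf.expectation p (\<lambda>i. measure_pmf.prob (f i) X)"
proof -
  have "ennreal (measure_pmf.prob (bind_pmf p f) X) = (\<integral>\<^sup>+i. ennreal (measure_pmf.prob (f i) X) \<partial>measure_pmf p)"
    by (simp flip: measure_pmf.emeasure_eq_measure)
  also have "\<dots> = ennreal (measure_pmf.expectation p (\<lambda>i. measure_pmf.prob (f i) X))"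
    by (intro nn_integral_eq_integral measure_pmf.integrable_const_bound[where B=1]) auto
  finally show ?thesis by (simp add: integral_nonneg_AE)
qed

lemma stopped_chain_0: "stopped_chain Y a n 0 = return_pmf n"
  by (simp add: stopped_chain_def)

text \<open>The definition appends a step at the end, whereas the recursion needs conditioning on
  the first step. The two agree because the iterated kernel acts on an initial law as a mixture of
  its actions on point masses.\<close>

lemma stopped_chain_Suc:
  "stopped_chain Y a n (Suc k) = bind_pmf (stop_step Y a n) (\<lambda>i. stopped_chain Y a i k)"
proof -
  have "((\<lambda>p. bind_pmf p K) ^^ k) p = bind_pmf p (\<lambda>i. ((\<lambda>p. bind_pmf p K) ^^ k) (return_pmf i))"
    for K :: "nat \<Rightarrow> nat pmf" and p
    by (induction k) (auto simp: bind_return_pmf' bind_assoc_pmf)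
  from this[where K = "stop_step Y a" and p = "stop_step Y a n"] show ?thesis
    by (simp add: stopped_chain_def funpow_Suc_right bind_return_pmf del: funpow.simps)
qed

text \<open>Condition 1 with all O-constants merged into one \<open>C\<close> and one threshold
  \<open>n1\<close>, and with \<open>\<delta>\<close> replaced by its bound. The error in
  \<open>incr\<close> is taken relative to \<alpha> to match the mass bound
  \<open>A * (1 + C * log_decay e n)\<close> of \<open>weighted_lyapunov\<close> with
  \<open>A = \<alpha>\<close>.\<close>

locale election =
  fixes Y :: "nat \<Rightarrow> nat pmf" and \<alpha> :: real and a :: nat and e C :: real and n1 :: nat
  assumes supp: "\<And>n. n \<ge> 1 \<Longrightarrow> set_pmf (Y n) \<subseteq> {1..n}"
    and stay: "\<And>n. n \<ge> 2 \<Longrightarrow> pmf (Y n) n < 1"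
    and stoch: "\<And>n k. n \<ge> 1 \<Longrightarrow> k \<ge> 1 \<Longrightarrow>
      measure_pmf.prob (Y (Suc n)) {..k} \<le> measure_pmf.prob (Y n) {..k}"
    and \<alpha>: "0 < \<alpha>" "\<alpha> < 1"
    and e: "0 < e" and C: "0 < C" and a: "1 \<le> a"
    and incr: "\<And>n. n \<ge> n1 \<Longrightarrow>
      \<bar>measure_pmf.expectation (Y (Suc n)) real - measure_pmf.expectation (Y n) real - \<alpha>\<bar>
        \<le> \<alpha> * (C * log_decay e (real n))"
    and conc: "\<And>n. n \<ge> n1 \<Longrightarrow>
      measure_pmf.prob (Y n) {j. \<bar>real j - \<alpha> * real n\<bar> > C * log_decay e (real n) * real n}
        \<le> C * real n powr (-2-e)"

lemma condition1_imp_election: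
  assumes "condition1 Y \<alpha>" "a \<ge> 1"
  shows "\<exists>e C n1. election Y \<alpha> a e C n1"
proof -
  from assms(1) obtain e \<delta> where e: "e > 0"
    and d: "\<delta> \<in> O(\<lambda>n. ln (real n) powr (-1 - e))"
    and i: "(\<lambda>n. measure_pmf.expectation (Y (Suc n)) real
              - measure_pmf.expectation (Y n) real - \<alpha>) \<in> O(\<delta>)"
    and p: "(\<lambda>n. measure_pmf.prob (Y n) {j. \<bar>real j - \<alpha> * real n\<bar> > \<delta> n * real n})
           \<in> O(\<lambda>n. real n powr (-2 - e))"
    unfolding condition1_def by blast
  have \<alpha>: "0 < \<alpha>" "\<alpha> < 1" using assms(1) by (auto simp: condition1_def)
  from landau_o.big_trans[OF i d] obtain c1 where c1: "c1 > 0"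
    "eventually (\<lambda>n. \<bar>measure_pmf.expectation (Y (Suc n)) real
              - measure_pmf.expectation (Y n) real - \<alpha>\<bar> \<le> c1 * log_decay e (real n)) sequentially"
    by (elim landau_o.bigE) (simp add: log_decay_def)
  from d obtain c2 where c2: "c2 > 0"
    "eventually (\<lambda>n. \<bar>\<delta> n\<bar> \<le> c2 * log_decay e (real n)) sequentially"
    by (elim landau_o.bigE) (simp add: log_decay_def)
  from p obtain c3 where c3: "c3 > 0"
    "eventually (\<lambda>n. measure_pmf.prob (Y n) {j. \<bar>real j - \<alpha> * real n\<bar> > \<delta> n * real n}
        \<le> c3 * real n powr (-2 - e)) sequentially"
    by (elim landau_o.bigE) simp
  define C where "C = c1 / \<alpha> + c2 + c3"
  have C: "C > 0" "c1 \<le> \<alpha> * C" "c2 \<le> C" "c3 \<le> C"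
    using c1 c2 c3 \<alpha> by (auto simp: C_def field_simps add_pos_pos)
  from eventually_conj[OF eventually_conj[OF c1(2) c2(2)] c3(2)]
  obtain n1 where n1: "\<And>n. n \<ge> n1 \<Longrightarrow> \<bar>measure_pmf.expectation (Y (Suc n)) real
              - measure_pmf.expectation (Y n) real - \<alpha>\<bar> \<le> c1 * log_decay e (real n)"
      "\<And>n. n \<ge> n1 \<Longrightarrow> \<bar>\<delta> n\<bar> \<le> c2 * log_decay e (real n)"
      "\<And>n. n \<ge> n1 \<Longrightarrow> measure_pmf.prob (Y n) {j. \<bar>real j - \<alpha> * real n\<bar> > \<delta> n * real n}
        \<le> c3 * real n powr (-2 - e)"
    by (auto simp: eventually_sequentially)
  have ell0: "log_decay e (real n) \<ge> 0" for n by (simp add: log_decay_def)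
  have "election Y \<alpha> a e C n1"
  proof
    fix n assume n: "n1 \<le> n"
    have "c1 * log_decay e (real n) \<le> (\<alpha> * C) * log_decay e (real n)"
      using C ell0 by (intro mult_right_mono) auto
    then show "\<bar>measure_pmf.expectation (Y (Suc n)) real - measure_pmf.expectation (Y n) real - \<alpha>\<bar>
        \<le> \<alpha> * (C * log_decay e (real n))" using n1(1)[OF n] by simp
    \<comment> \<open>Enlarging the allowed deviation shrinks the exceptional event, so the tail
      bound survives the replacement of \<open>\<delta>\<close>.\<close>
    have "\<delta> n \<le> C * log_decay e (real n)"
      using n1(2)[OF n] mult_right_mono[OF C(3) ell0[of n]] by linarith
    then have "\<delta> n * real n \<le> C * log_decay e (real n) * real n"
      by (intro mult_right_mono) auto
    then have "measure_pmf.prob (Y n) {j. \<bar>real j - \<alpha> * real n\<bar> > C * log_decay e (real n) * real n}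
        \<le> measure_pmf.prob (Y n) {j. \<bar>real j - \<alpha> * real n\<bar> > \<delta> n * real n}"
      by (intro measure_pmf.finite_measure_mono) auto
    also have "\<dots> \<le> C * real n powr (-2-e)"
      using n1(3)[OF n] mult_right_mono[OF C(4), of "real n powr (-2-e)"] by simp
    finally show "measure_pmf.prob (Y n) {j. \<bar>real j - \<alpha> * real n\<bar> > C * log_decay e (real n) * real n}
        \<le> C * real n powr (-2-e)" .
  qed (use assms e C in \<open>auto simp: condition1_def\<close>)
  then show ?thesis by blast
qed

context election
begin

section \<open>Survival probabilities, their increments and the increment kernel\<close>

text \<open>The \<open>h\<close> of the overview: rounds first, starting point second.\<close>

definition surv :: "nat \<Rightarrow> nat \<Rightarrow> real" where
  "surv k n = 1 - rounds_cdf Y a n k"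

lemma surv_nonneg: "0 \<le> surv k n" and surv_le_1: "surv k n \<le> 1"
  by (simp_all add: surv_def rounds_cdf_def)

lemma surv_0: "surv 0 n = (if n \<le> a then 0 else 1)"
  by (simp add: surv_def rounds_cdf_def stopped_chain_0)

lemma surv_stopped: "n \<le> a \<Longrightarrow> surv k n = 0"
  by (induction k) (auto simp: surv_def rounds_cdf_def stopped_chain_0 stopped_chain_Suc stop_step_def bind_return_pmf)

lemma surv_Suc:
  assumes "a < n"
  shows "surv (Suc k) n = measure_pmf.expectation (Y n) (surv k)"
proof -
  have "measure_pmf.expectation (Y n) (surv k) = 1 - measure_pmf.expectation (Y n) (\<lambda>i. rounds_cdf Y a i k)"
    unfolding surv_def
    by (subst Bochner_Integration.integral_diff)
       (auto simp: rounds_cdf_def intro!: measure_pmf.integrable_const_bound[where B=1])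
  then show ?thesis
    using assms by (simp add: surv_def rounds_cdf_def stopped_chain_Suc stop_step_def measure_bind_pmf)
qed

lemma surv_Suc_sum:
  assumes "a < n"
  shows "surv (Suc k) n = (\<Sum>j=1..n. pmf (Y n) j * surv k j)"
  using assms a by (simp add: surv_Suc expectation_pmf_sum[OF supp])

definition weight :: "nat \<Rightarrow> nat \<Rightarrow> real" where
  "weight n j = measure_pmf.prob (Y (Suc n)) {j<..} - measure_pmf.prob (Y n) {j<..}"

lemma prob_greater: "measure_pmf.prob (Y n) {j<..} = 1 - measure_pmf.prob (Y n) {..j}"
  using measure_pmf.prob_compl[of "{..j}" "Y n"] by (simp add: Compl_eq_Diff_UNIV[symmetric] not_le)

lemma weight_nonneg: "n \<ge> 1 \<Longrightarrow> j \<ge> 1 \<Longrightarrow> 0 \<le> weight n j"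
  using stoch[of n j] by (simp add: weight_def prob_greater)

lemma expectation_diff:
  assumes "n \<ge> 1"
  shows "measure_pmf.expectation (Y (Suc n)) g - measure_pmf.expectation (Y n) g
     = (\<Sum>j=1..n. weight n j * (g (Suc j) - g j))"
proof -
  \<comment> \<open>Both expectations are summed up to \<open>Suc n\<close>; the last term is zero
    in each, and the sum ends at \<open>n\<close>.\<close>
  have z: "measure_pmf.prob (Y (Suc n)) {Suc n<..} = 0" "measure_pmf.prob (Y n) {Suc n<..} = 0"
    using supp[of n] supp[of "Suc n"] assms by (auto simp: measure_pmf_zero_iff)
  have "set_pmf (Y n) \<subseteq> {1..Suc n}" using supp[OF assms] by auto
  note E = expectation_by_parts[OF this, of g] expectation_by_parts[OF supp[of "Suc n"], of g]
  have "(\<Sum>j=1..n. weight n j * (g (Suc j) - g j))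
      = (\<Sum>j=1..n. (g (Suc j) - g j) * measure_pmf.prob (Y (Suc n)) {j<..})
        - (\<Sum>j=1..n. (g (Suc j) - g j) * measure_pmf.prob (Y n) {j<..})"
    unfolding sum_subtractf[symmetric] by (intro sum.cong) (auto simp: weight_def algebra_simps)
  then show ?thesis using E z assms by simp
qed

lemma weight_sum:
  assumes "n \<ge> 1"
  shows "(\<Sum>j=1..n. weight n j)
     = measure_pmf.expectation (Y (Suc n)) real - measure_pmf.expectation (Y n) real"
  using expectation_diff[OF assms, of real] by simp

definition incr_surv :: "nat \<Rightarrow> nat \<Rightarrow> real" where
  "incr_surv k n = surv k (Suc n) - surv k n"

lemma incr_surv_Suc:
  assumes "a < n"
  shows "incr_surv (Suc k) n = (\<Sum>j=1..n. weight n j * incr_surv k j)"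
  using assms expectation_diff[of n "surv k"] by (simp add: incr_surv_def surv_Suc)

text \<open>The increment recursion is valid only above \<open>a\<close>; for
  \<open>n \<le> a\<close> the survival probability at \<open>n\<close> is 0, so the sign is clear.
  Above \<open>a\<close>, nonnegative weights preserve the sign.\<close>

lemma incr_surv_nonneg: "0 \<le> incr_surv k n"
proof (induction k arbitrary: n)
  case 0
  then show ?case by (simp add: incr_surv_def surv_0)
next
  case (Suc k)
  show ?case
  proof (cases "n \<le> a")
    case True
    then show ?thesis by (simp add: incr_surv_def surv_stopped surv_nonneg)
  next
    case False
    then show ?thesis using Suc weight_nonneg[of n] by (auto simp: incr_surv_Suc intro!: sum_nonneg)
  qed
qed

lemma surv_mono:
  assumes "m \<le> n"
  shows "surv k m \<le> surv k n"
proof (rule lift_Suc_mono_le[of "surv k", OF _ assms])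
  show "surv k n \<le> surv k (Suc n)" for n
    using incr_surv_nonneg[of k n] by (simp add: incr_surv_def)
qed

lemma incr_surv_le_1: "incr_surv k n \<le> 1"
  using surv_le_1[of k "Suc n"] surv_nonneg[of k n] by (simp add: incr_surv_def)

text \<open>Here \<open>2 ^ n\<close> serves as a Lyapunov function, since from \<open>n\<close> the chain goes down with probability bounded below.\<close>

lemma surv_geometric:
  "\<exists>\<rho>. 0 < \<rho> \<and> \<rho> < 1 \<and> (\<forall>k n. 1 \<le> n \<longrightarrow> n \<le> N \<longrightarrow> surv k n \<le> \<rho> ^ k * 2 ^ n)"
proof -
  \<comment> \<open>The inserted 0 keeps the set nonempty when \<open>N < 2\<close>.\<close>
  define q where "q = Max (insert 0 ((\<lambda>n. pmf (Y n) n) ` {2..N}))"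
  have q: "q < 1" unfolding q_def using stay by (subst Max_less_iff) auto
  have q0: "0 \<le> q" unfolding q_def by (intro Max_ge) auto
  have qn: "pmf (Y n) n \<le> q" if "2 \<le> n" "n \<le> N" for n
    unfolding q_def using that by (intro Max_ge) auto
  \<comment> \<open>Every proper step down at least halves the power of 2, so the mean of
    \<open>2 ^ Y n\<close> is at most \<open>2 ^ (n-1) * (1 + pmf (Y n) n)\<close>, that is, at most
    \<open>(1+q)/2\<close> times \<open>2 ^ n\<close>.\<close>
  define \<rho> where "\<rho> = (1+q)/2"
  have \<rho>: "0 < \<rho>" "\<rho> < 1" using q q0 by (auto simp: \<rho>_def)
  have "surv k n \<le> \<rho> ^ k * 2 ^ n" if "1 \<le> n" "n \<le> N" for k n
    using that
  proof (induction k arbitrary: n)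
    case 0
    have "(1::real) \<le> 2 ^ n" by simp
    then show ?case unfolding power_0 mult_1_left using surv_le_1[of 0 n] by linarith
  next
    case (Suc k)
    show ?case
    proof (cases "n \<le> a")
      case True
      then show ?thesis using \<rho> by (simp add: surv_stopped)
    next
      case False
      then have n: "a < n" "2 \<le> n" using a by auto
      have "surv (Suc k) n = (\<Sum>j=1..n. pmf (Y n) j * surv k j)" by (rule surv_Suc_sum[OF n(1)])
      also have "\<dots> \<le> (\<Sum>j=1..n. pmf (Y n) j * (\<rho> ^ k * (2 ^ (n-1) + 2 ^ (n-1) * indicator {n} j)))"
      proof (intro sum_mono mult_left_mono)
        fix j assume j: "j \<in> {1..n}"
        have "surv k j \<le> \<rho> ^ k * 2 ^ j" using Suc.prems j by (intro Suc.IH) auto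
        also have "\<dots> \<le> \<rho> ^ k * (2 ^ (n-1) + 2 ^ (n-1) * indicator {n} j)"
        proof (intro mult_left_mono)
          show "(2::real) ^ j \<le> 2 ^ (n-1) + 2 ^ (n-1) * indicator {n} j"
          proof (cases "j = n")
            case True
            have "(2::real) ^ n = 2 * 2 ^ (n-1)" using n(2) by (subst power_Suc[symmetric]) auto
            then show ?thesis using True by simp
          next
            case False
            then have "j \<le> n - 1" using j by auto
            then show ?thesis using False by (simp add: power_increasing)
          qed
        qed (use \<rho> in auto)
        finally show "surv k j \<le> \<rho> ^ k * (2 ^ (n-1) + 2 ^ (n-1) * indicator {n} j)" .
      qed auto
      also have "\<dots> = \<rho> ^ k * 2 ^ (n-1) * ((\<Sum>j=1..n. pmf (Y n) j) + (\<Sum>j=1..n. pmf (Y n) j * indicator {n} j))"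
        unfolding sum.distrib[symmetric] sum_distrib_left by (intro sum.cong) (auto simp: algebra_simps)
      also have "(\<Sum>j=1..n. pmf (Y n) j) = 1"
        using supp[of n] n by (intro sum_pmf_eq_1) auto
      also have "(\<Sum>j=1..n. pmf (Y n) j * indicator {n} j) = pmf (Y n) n"
        using n by (simp add: indicator_def of_bool_def if_distrib cong: if_cong)
      also have "\<rho> ^ k * 2 ^ (n-1) * (1 + pmf (Y n) n) \<le> \<rho> ^ k * 2 ^ (n-1) * (2 * \<rho>)"
        using qn[of n] n Suc.prems \<rho> by (intro mult_left_mono) (auto simp: \<rho>_def)
      also have "\<dots> = \<rho> ^ Suc k * 2 ^ Suc (n-1)" by (simp only: power_Suc mult_ac)
      also have "Suc (n-1) = n" using n(2) by simp
      finally show ?thesis .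
    qed
  qed
  then show ?thesis using \<rho> by (intro exI[of _ \<rho>] conjI allI impI)
qed

text \<open>The 2 leaves room for the change of centre: if \<open>j\<close> exceeds
  \<open>\<alpha> n\<close> by twice the allowed deviation, then \<open>Y (Suc n) > j\<close> is
  still a large deviation from \<open>\<alpha> (n+1)\<close>. On the lower side
  \<open>Y n \<le> j\<close> is one. Adding at most \<open>n\<close> such probabilities loses a
  power of \<open>n\<close>; this is where the exponent \<open>-2-e\<close> is spent.\<close>

lemma weight_far:
  "\<exists>n0. \<forall>n\<ge>n0. (\<Sum>j\<in>{j\<in>{1..n}. \<bar>real j - \<alpha> * real n\<bar> > 2 * C * log_decay e (real n) * real n}. weight n j)
      \<le> 2 * C * real n powr (-1-e)"
proof -
  have "filterlim (\<lambda>x. C * log_decay e x * (x - 1)) at_top at_top"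
    unfolding log_decay_def using C e by real_asymp
  then have "eventually (\<lambda>x. C * log_decay e x * (x - 1) \<ge> \<alpha>) at_top"
    by (simp add: filterlim_at_top)
  from eventually_compose_filterlim[OF this filterlim_real_sequentially]
  obtain n2 where n2: "\<And>n. n \<ge> n2 \<Longrightarrow> C * log_decay e (real n) * (real n - 1) \<ge> \<alpha>"
    by (auto simp: eventually_sequentially)
  have "(\<Sum>j\<in>{j\<in>{1..n}. \<bar>real j - \<alpha> * real n\<bar> > 2 * C * log_decay e (real n) * real n}. weight n j)
      \<le> 2 * C * real n powr (-1-e)" if n: "n \<ge> max (max n1 n2) 2" for n
  proof -
    define x where "x = real n"
    define l where "l = C * log_decay e x"
    define l' where "l' = C * log_decay e (x+1)"
    have x: "x \<ge> 2" using n by (simp add: x_def)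
    have l0: "0 \<le> l" using C by (simp add: l_def log_decay_def)
    have l1: "l * (x - 1) \<ge> \<alpha>" using n2[of n] n by (simp add: l_def x_def)
    have l': "l' \<le> l"
      unfolding l'_def l_def log_decay_def using C e x by (intro mult_left_mono powr_mono2') auto
    have one: "weight n j \<le> C * x powr (-2-e)" if "j \<in> {1..n}" "\<bar>real j - \<alpha> * x\<bar> > 2 * l * x" for j
    proof (cases "real j > \<alpha> * x")
      case True
      then have j: "real j > \<alpha> * x + 2 * l * x" using that by (simp add: abs_if split: if_splits)
      have "l' * (x+1) \<le> l * (x+1)" using l' x by (intro mult_right_mono) auto
      then have "\<alpha> * (x + 1) + l' * (x + 1) \<le> real j"
        using j l1 by (simp add: algebra_simps)
      then have "real i - \<alpha> * (x + 1) > l' * (x + 1)" if "i > j" for i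
        using that of_nat_less_iff[of j i, where 'a = real] by linarith
      then have sub: "{j<..} \<subseteq> {i. \<bar>real i - \<alpha> * real (Suc n)\<bar> > C * log_decay e (real (Suc n)) * real (Suc n)}"
        unfolding l'_def x_def of_nat_Suc by (force simp: add.commute)
      have "weight n j \<le> measure_pmf.prob (Y (Suc n)) {j<..}" by (simp add: weight_def)
      also have "\<dots> \<le> measure_pmf.prob (Y (Suc n)) {i. \<bar>real i - \<alpha> * real (Suc n)\<bar> > C * log_decay e (real (Suc n)) * real (Suc n)}"
        by (intro measure_pmf.finite_measure_mono sub) auto
      also have "\<dots> \<le> C * real (Suc n) powr (-2-e)" using n by (intro conc) auto
      also have "\<dots> \<le> C * x powr (-2-e)"
        using C e x by (intro mult_left_mono powr_mono2') (auto simp: x_def)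
      finally show ?thesis .
    next
      case False
      have "2 * l * x = l * x + l * x" by simp
      moreover have "0 \<le> l * x" using l0 x by simp
      ultimately have j: "real j < \<alpha> * x - l * x" using that False by (simp add: abs_if split: if_splits)
      have "weight n j \<le> measure_pmf.prob (Y n) {..j}"
        by (simp add: weight_def prob_greater)
      also have "\<dots> \<le> measure_pmf.prob (Y n) {i. \<bar>real i - \<alpha> * real n\<bar> > C * log_decay e (real n) * real n}"
        using j by (intro measure_pmf.finite_measure_mono) (auto simp: l_def x_def abs_if)
      also have "\<dots> \<le> C * x powr (-2-e)" using n conc[of n] by (simp add: x_def)
      finally show ?thesis .
    qed
    let ?F = "{j\<in>{1..n}. \<bar>real j - \<alpha> * real n\<bar> > 2 * C * log_decay e (real n) * real n}"
    have "(\<Sum>j\<in>?F. weight n j) \<le> (\<Sum>j\<in>?F. C * x powr (-2-e))"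
      by (intro sum_mono one) (auto simp: l_def x_def)
    also have "\<dots> = real (card ?F) * (C * x powr (-2-e))" by simp
    also have "\<dots> \<le> x * (C * x powr (-2-e))"
    proof (intro mult_right_mono)
      have "card ?F \<le> card {1..n}" by (intro card_mono) auto
      then show "real (card ?F) \<le> x" by (simp add: x_def)
    qed (use C in auto)
    also have "\<dots> = C * (x powr 1 * x powr (-2-e))" using x by simp
    also have "\<dots> = C * x powr (-1-e)" by (subst powr_add[symmetric]) simp
    also have "\<dots> \<le> 2 * C * x powr (-1-e)" using C by simp
    finally show ?thesis by (simp add: x_def)
  qed
  then show ?thesis by blast
qed

lemma lyapunov_pmf:
  "\<exists>c n0. 0 \<le> c \<and> (\<forall>n s. n0 \<le> n \<longrightarrow> -(1+e/2) \<le> s \<longrightarrow> -2 \<le> s \<longrightarrow> s \<le> 1 \<longrightarrow>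
      (\<Sum>j=1..n. pmf (Y n) j * lyapunov e c s j) \<le> \<alpha> powr s * lyapunov e c s n)"
proof -
  obtain c n0 where c: "0 \<le> c" and
    V: "\<forall>n s w. n0 \<le> n \<longrightarrow> -(1+e/2) \<le> s \<longrightarrow> -2 \<le> s \<longrightarrow> s \<le> 1 \<longrightarrow>
      (\<forall>j\<in>{1..n}. 0 \<le> w j) \<longrightarrow>
      (\<Sum>j=1..n. w j) \<le> 1 * (1 + C * log_decay e (real n)) \<longrightarrow>
      (\<Sum>j\<in>{j\<in>{1..n}. \<bar>real j - \<alpha> * real n\<bar> > C * log_decay e (real n) * real n}. w j)
        \<le> C * real n powr (-1-e) \<longrightarrow>
      (\<Sum>j=1..n. w j * lyapunov e c s j) \<le> 1 * \<alpha> powr s * lyapunov e c s n"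
    using weighted_lyapunov[OF \<alpha> e C zero_less_one] by (elim exE conjE) (rule that)
  show ?thesis
  proof (intro exI[of _ c] exI[of _ "max (max n0 n1) 1"] conjI allI impI c)
    fix n s assume n: "max (max n0 n1) 1 \<le> n" and s: "-(1+e/2) \<le> s" "-2 \<le> s" "s \<le> 1"
    have "(\<Sum>j=1..n. pmf (Y n) j * lyapunov e c s j) \<le> 1 * \<alpha> powr s * lyapunov e c s n"
    proof (intro V[rule_format] s)
      have "(\<Sum>j=1..n. pmf (Y n) j) = 1" using supp[of n] n by (intro sum_pmf_eq_1) auto
      then show "(\<Sum>j=1..n. pmf (Y n) j) \<le> 1 * (1 + C * log_decay e (real n))"
        using C by (simp add: log_decay_def)
      have "(\<Sum>j\<in>{j\<in>{1..n}. \<bar>real j - \<alpha> * real n\<bar> > C * log_decay e (real n) * real n}. pmf (Y n) j)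
         = measure_pmf.prob (Y n) {j\<in>{1..n}. \<bar>real j - \<alpha> * real n\<bar> > C * log_decay e (real n) * real n}"
        by (simp add: measure_measure_pmf_finite)
      also have "\<dots> \<le> measure_pmf.prob (Y n) {j. \<bar>real j - \<alpha> * real n\<bar> > C * log_decay e (real n) * real n}"
        by (intro measure_pmf.finite_measure_mono) auto
      also have "\<dots> \<le> C * real n powr (-2-e)" using conc[of n] n by simp
      also have "\<dots> \<le> C * real n powr (-1-e)" using C n by (intro mult_left_mono powr_mono) auto
      finally show "(\<Sum>j\<in>{j\<in>{1..n}. \<bar>real j - \<alpha> * real n\<bar> > C * log_decay e (real n) * real n}. pmf (Y n) j)
        \<le> C * real n powr (-1-e)" .
    qed (use n in auto)
    then show "(\<Sum>j=1..n. pmf (Y n) j * lyapunov e c s j) \<le> \<alpha> powr s * lyapunov e c s n" by simp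
  qed
qed

text \<open>The kernel has mass about \<alpha> instead of 1, hence one more factor \<alpha> per
  round than in \<open>lyapunov_pmf\<close>. With \<open>s = r-1\<close> and \<open>s = -r-1\<close>
  the rates are \<open>\<alpha> powr r\<close> and \<open>\<alpha> powr (-r)\<close>, the same as
  for the two tails.\<close>

lemma lyapunov_weight:
  "\<exists>c n0. 0 \<le> c \<and> (\<forall>n s. n0 \<le> n \<longrightarrow> -(1+e/2) \<le> s \<longrightarrow> -2 \<le> s \<longrightarrow> s \<le> 1 \<longrightarrow>
      (\<Sum>j=1..n. weight n j * lyapunov e c s j) \<le> \<alpha> * \<alpha> powr s * lyapunov e c s n)"
proof -
  have C2: "0 < 2 * C" using C by simp
  obtain c n0 where c: "0 \<le> c" and
    V: "\<forall>n s w. n0 \<le> n \<longrightarrow> -(1+e/2) \<le> s \<longrightarrow> -2 \<le> s \<longrightarrow> s \<le> 1 \<longrightarrow>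
      (\<forall>j\<in>{1..n}. 0 \<le> w j) \<longrightarrow>
      (\<Sum>j=1..n. w j) \<le> \<alpha> * (1 + 2 * C * log_decay e (real n)) \<longrightarrow>
      (\<Sum>j\<in>{j\<in>{1..n}. \<bar>real j - \<alpha> * real n\<bar> > 2 * C * log_decay e (real n) * real n}. w j)
        \<le> 2 * C * real n powr (-1-e) \<longrightarrow>
      (\<Sum>j=1..n. w j * lyapunov e c s j) \<le> \<alpha> * \<alpha> powr s * lyapunov e c s n"
    using weighted_lyapunov[OF \<alpha> e C2 \<alpha>(1)] by (elim exE conjE) (rule that)
  obtain n2 where n2: "\<And>n. n \<ge> n2 \<Longrightarrow> (\<Sum>j\<in>{j\<in>{1..n}. \<bar>real j - \<alpha> * real n\<bar> > 2 * C * log_decay e (real n) * real n}. weight n j)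
      \<le> 2 * C * real n powr (-1-e)" using weight_far by blast
  show ?thesis
  proof (intro exI[of _ c] exI[of _ "max (max n0 n1) (max n2 1)"] conjI allI impI c)
    fix n s assume n: "max (max n0 n1) (max n2 1) \<le> n" and s: "-(1+e/2) \<le> s" "-2 \<le> s" "s \<le> 1"
    show "(\<Sum>j=1..n. weight n j * lyapunov e c s j) \<le> \<alpha> * \<alpha> powr s * lyapunov e c s n"
    proof (intro V[rule_format] s)
      have "0 \<le> \<alpha> * (C * log_decay e (real n))" using C \<alpha> by (simp add: log_decay_def)
      then show "(\<Sum>j=1..n. weight n j) \<le> \<alpha> * (1 + 2 * C * log_decay e (real n))"
        using incr[of n] n weight_sum[of n] by (simp add: algebra_simps)
      show "(\<Sum>j\<in>{j\<in>{1..n}. \<bar>real j - \<alpha> * real n\<bar> > 2 * C * log_decay e (real n) * real n}. weight n j)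
        \<le> 2 * C * real n powr (-1-e)" using n n2 by simp
    qed (use n weight_nonneg in auto)
  qed
qed

text \<open>In terms of \<open>t = \<alpha> ^ k * n\<close> the right-hand sides are
  \<open>K * t powr r\<close>, \<open>K * t powr (-r)\<close>, and these same two divided by
  \<open>n\<close>.\<close>

definition tail_bounds :: "real \<Rightarrow> real \<Rightarrow> bool" where
  "tail_bounds r K \<longleftrightarrow> 0 < r \<and> r \<le> 1 \<and> 0 < K \<and> (\<forall>k n. n \<ge> 1 \<longrightarrow>
     surv k n \<le> K * (\<alpha> powr r) ^ k * real n powr r \<and>
     1 - surv k n \<le> K * (\<alpha> powr (-r)) ^ k * real n powr (-r) \<and>
     incr_surv k n \<le> K * (\<alpha> powr r) ^ k * real n powr (r-1) \<and>
     incr_surv k n \<le> K * (\<alpha> powr (-r)) ^ k * real n powr (-r-1))"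

lemma tail_bounds_exist: "\<exists>r K. tail_bounds r K"
proof -
  obtain c n2 where c: "0 \<le> c" and W:
    "\<forall>n s. n2 \<le> n \<longrightarrow> -(1+e/2) \<le> s \<longrightarrow> -2 \<le> s \<longrightarrow> s \<le> 1 \<longrightarrow>
      (\<Sum>j=1..n. pmf (Y n) j * lyapunov e c s j) \<le> \<alpha> powr s * lyapunov e c s n"
    using lyapunov_pmf by (elim exE conjE) (rule that)
  obtain c' n3 where c': "0 \<le> c'" and W':
    "\<forall>n s. n3 \<le> n \<longrightarrow> -(1+e/2) \<le> s \<longrightarrow> -2 \<le> s \<longrightarrow> s \<le> 1 \<longrightarrow>
      (\<Sum>j=1..n. weight n j * lyapunov e c' s j) \<le> \<alpha> * \<alpha> powr s * lyapunov e c' s n"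
    using lyapunov_weight by (elim exE conjE) (rule that)
  \<comment> \<open>\<open>Suc a\<close> ensures that the first-step recursions hold from
    \<open>n0\<close> on.\<close>
  define n0 where "n0 = max (max n2 n3) (Suc a)"
  obtain \<rho> where \<rho>: "0 < \<rho>" "\<rho> < 1" 
    and geo: "\<forall>k n. 1 \<le> n \<longrightarrow> n \<le> n0 \<longrightarrow> surv k n \<le> \<rho> ^ k * 2 ^ n"
    using surv_geometric[of n0] by (elim exE conjE) (rule that)
  \<comment> \<open>The bounds 1 and \<open>e/2\<close> put all four exponents \<open>r\<close>,
    \<open>-r\<close>, \<open>r-1\<close>, \<open>-r-1\<close> into the admissible range of the
    Lyapunov estimates; the last term gives \<open>\<rho> \<le> \<alpha> powr r\<close>, so that
    small starting points decay fast enough.\<close>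
  define r where "r = min (min 1 (e/2)) (ln \<rho> / ln \<alpha>)"
  have r: "0 < r" "r \<le> 1"
    unfolding r_def using e \<rho> \<alpha> by (auto simp: divide_neg_neg intro: order_trans[OF min.cobounded1])
  have "r \<le> min 1 (e/2)" unfolding r_def by (rule min.cobounded1)
  then have r3: "r \<le> e / 2" by simp
  have "r * ln \<alpha> \<ge> ln \<rho>"
  proof -
    have "r \<le> ln \<rho> / ln \<alpha>" by (simp add: r_def)
    then show ?thesis using \<alpha> by (simp add: neg_le_divide_eq)
  qed
  then have "exp (ln \<rho>) \<le> exp (r * ln \<alpha>)" by simp
  then have \<rho>r: "\<rho> \<le> \<alpha> powr r" using \<alpha> \<rho> by (simp add: powr_def)
  have q1: "1 \<le> \<alpha> powr (-r)" using \<alpha> r powr_mono'[of "-r" 0 \<alpha>] by simp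
  have geo': "surv k n \<le> 2 ^ n0 * (\<alpha> powr r) ^ k" if "1 \<le> n" "n \<le> n0" for k n
  proof -
    have "surv k n \<le> \<rho> ^ k * 2 ^ n" by (rule geo[rule_format, OF that])
    also have "\<dots> \<le> (\<alpha> powr r) ^ k * 2 ^ n0"
      using that \<rho>r \<rho> by (intro mult_mono power_mono power_increasing) auto
    finally show ?thesis by (simp add: mult.commute)
  qed
  \<comment> \<open>Initial data for \<open>k = 0\<close>: \<open>1 - surv 0 n\<close> is the
    indicator of \<open>n \<le> a\<close> and \<open>incr_surv 0 n\<close> that of
    \<open>n = a\<close>; both are dominated by \<open>(a/n) powr s\<close>.\<close>
  have ineg: "1 \<le> real a powr s * real n powr (-s)" if "1 \<le> n" "n \<le> a" "s \<ge> 0" for n s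
  proof -
    have "real n powr s * real n powr (-s) \<le> real a powr s * real n powr (-s)"
      using that by (intro mult_right_mono powr_mono2) auto
    moreover have "real n powr s * real n powr (-s) = 1" using that by (simp flip: powr_add)
    ultimately show ?thesis by simp
  qed
  have "\<exists>K>0. \<forall>k n. n \<ge> 1 \<longrightarrow> surv k n \<le> K * (\<alpha> powr r) ^ k * real n powr r"
  proof (rule lyapunov_comparison[OF c e, where ?n0.0 = n0 and w = "\<lambda>n. pmf (Y n)" and K = "2 ^ n0"])
    fix n assume "n \<ge> n0"
    then show "(\<Sum>j = 1..n. pmf (Y n) j * lyapunov e c r j) \<le> \<alpha> powr r * lyapunov e c r n"
      using r r3 e by (intro W[rule_format]) (auto simp: n0_def)
  next
    fix k n assume "n \<ge> n0"
    then show "surv (Suc k) n \<le> (\<Sum>j = 1..n. pmf (Y n) j * surv k j)"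
      by (subst surv_Suc_sum) (auto simp: n0_def)
  next
    fix n assume n: "(1::nat) \<le> n"
    have "1 * 1 \<le> 2 ^ n0 * real n powr r" using n r by (intro mult_mono) (auto simp: ge_one_powr_ge_zero)
    then show "surv 0 n \<le> 2 ^ n0 * real n powr r" using surv_le_1[of 0 n] by simp
  qed (use \<alpha> geo' in auto)
  then obtain K1 where K1: "0 < K1" "\<forall>k n. n \<ge> 1 \<longrightarrow> surv k n \<le> K1 * (\<alpha> powr r) ^ k * real n powr r"
    by (elim exE conjE) (rule that)
  have "\<exists>K>0. \<forall>k n. n \<ge> 1 \<longrightarrow> 1 - surv k n \<le> K * (\<alpha> powr (-r)) ^ k * real n powr (-r)"
  proof (rule lyapunov_comparison[OF c e, where ?n0.0 = n0 and w = "\<lambda>n. pmf (Y n)" and K = "real a powr r"])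
    fix n assume "n \<ge> n0"
    then show "(\<Sum>j = 1..n. pmf (Y n) j * lyapunov e c (-r) j) \<le> \<alpha> powr (-r) * lyapunov e c (-r) n"
      using r r3 e by (intro W[rule_format]) (auto simp: n0_def)
  next
    fix k n assume n: "n \<ge> n0"
    have "(\<Sum>j=1..n. pmf (Y n) j) = 1" using supp[of n] n by (intro sum_pmf_eq_1) (auto simp: n0_def)
    then show "1 - surv (Suc k) n \<le> (\<Sum>j = 1..n. pmf (Y n) j * (1 - surv k j))"
      using n by (subst surv_Suc_sum) (auto simp: n0_def algebra_simps sum_subtractf)
  next
    fix n assume n: "(1::nat) \<le> n"
    show "1 - surv 0 n \<le> real a powr r * real n powr (-r)"
      using n ineg[of n r] r by (auto simp: surv_0)
  next
    fix k n
    \<comment> \<open>For the exponent \<open>-r\<close> the rate is at least 1, so the small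
      starting points need only the trivial bound.\<close>
    have "1 * 1 \<le> real a powr r * (\<alpha> powr (-r)) ^ k"
      using q1 a r by (intro mult_mono one_le_power) (auto simp: ge_one_powr_ge_zero)
    then show "1 - surv k n \<le> real a powr r * (\<alpha> powr (-r)) ^ k"
      using surv_nonneg[of k n] by linarith
  qed (use \<alpha> a in auto)
  then obtain K2 where K2: "0 < K2" "\<forall>k n. n \<ge> 1 \<longrightarrow> 1 - surv k n \<le> K2 * (\<alpha> powr (-r)) ^ k * real n powr (-r)"
    by (elim exE conjE) (rule that)
  have q': "\<alpha> * \<alpha> powr (r-1) = \<alpha> powr r" "\<alpha> * \<alpha> powr (-r-1) = \<alpha> powr (-r)"
    using \<alpha> by (simp_all add: powr_diff)
  have inc0: "incr_surv 0 n \<le> real a powr s * real n powr (-s)" if "1 \<le> n" "s \<ge> 0" for n s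
    using that ineg[of n s] by (auto simp: incr_surv_def surv_0)
  have "\<exists>K>0. \<forall>k n. n \<ge> 1 \<longrightarrow> incr_surv k n \<le> K * (\<alpha> powr r) ^ k * real n powr (r-1)"
  proof (rule lyapunov_comparison[OF c' e, where ?n0.0 = n0 and w = weight and K = "2 ^ n0 + real a powr (1-r)"])
    fix n assume "n \<ge> n0"
    then show "(\<Sum>j = 1..n. weight n j * lyapunov e c' (r-1) j) \<le> \<alpha> powr r * lyapunov e c' (r-1) n"
      unfolding q'(1)[symmetric] using r r3 e by (intro W'[rule_format]) (auto simp: n0_def)
  next
    fix k n assume n: "n \<ge> n0"
    then show "incr_surv (Suc k) n \<le> (\<Sum>j = 1..n. weight n j * incr_surv k j)"
      by (subst incr_surv_Suc) (auto simp: n0_def)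
    fix j assume "j \<in> {1..n}"
    then show "0 \<le> weight n j" by (intro weight_nonneg) auto
  next
    fix n assume n: "(1::nat) \<le> n"
    have "incr_surv 0 n \<le> real a powr (1-r) * real n powr (-(1-r))"
      using n r by (intro inc0) auto
    also have "\<dots> \<le> (2 ^ n0 + real a powr (1-r)) * real n powr (-(1-r))"
      by (intro mult_right_mono) auto
    finally show "incr_surv 0 n \<le> (2 ^ n0 + real a powr (1-r)) * real n powr (r-1)" by simp
  next
    fix k n assume n: "(1::nat) \<le> n" "n < n0"
    \<comment> \<open>\<open>n < n0\<close> gives \<open>Suc n \<le> n0\<close>; this is why the
      geometric bound was taken up to and including \<open>n0\<close>.\<close>
    have "incr_surv k n \<le> surv k (Suc n)" using surv_nonneg by (simp add: incr_surv_def)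
    also have "\<dots> \<le> 2 ^ n0 * (\<alpha> powr r) ^ k" using n by (intro geo') auto
    also have "\<dots> \<le> (2 ^ n0 + real a powr (1-r)) * (\<alpha> powr r) ^ k"
      by (intro mult_right_mono) auto
    finally show "incr_surv k n \<le> (2 ^ n0 + real a powr (1-r)) * (\<alpha> powr r) ^ k" .
  qed (use \<alpha> in \<open>auto intro: add_pos_nonneg\<close>)
  then obtain K3 where K3: "0 < K3" "\<forall>k n. n \<ge> 1 \<longrightarrow> incr_surv k n \<le> K3 * (\<alpha> powr r) ^ k * real n powr (r-1)"
    by (elim exE conjE) (rule that)
  have "\<exists>K>0. \<forall>k n. n \<ge> 1 \<longrightarrow> incr_surv k n \<le> K * (\<alpha> powr (-r)) ^ k * real n powr (-r-1)"
  proof (rule lyapunov_comparison[OF c' e, where ?n0.0 = n0 and w = weight and K = "real a powr (1+r)"])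
    fix n assume "n \<ge> n0"
    then show "(\<Sum>j = 1..n. weight n j * lyapunov e c' (-r-1) j) \<le> \<alpha> powr (-r) * lyapunov e c' (-r-1) n"
      unfolding q'(2)[symmetric] using r r3 e by (intro W'[rule_format]) (auto simp: n0_def)
  next
    fix k n assume n: "n \<ge> n0"
    then show "incr_surv (Suc k) n \<le> (\<Sum>j = 1..n. weight n j * incr_surv k j)"
      by (subst incr_surv_Suc) (auto simp: n0_def)
    fix j assume "j \<in> {1..n}"
    then show "0 \<le> weight n j" by (intro weight_nonneg) auto
  next
    fix n assume n: "(1::nat) \<le> n"
    show "incr_surv 0 n \<le> real a powr (1+r) * real n powr (-r-1)"
      using inc0[of n "1+r"] r n by (simp add: minus_diff_commute)
  next
    fix k n
    have "1 * 1 \<le> real a powr (1+r) * (\<alpha> powr (-r)) ^ k"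
      using q1 a r by (intro mult_mono one_le_power) (auto simp: ge_one_powr_ge_zero)
    then show "incr_surv k n \<le> real a powr (1+r) * (\<alpha> powr (-r)) ^ k"
      using incr_surv_le_1[of k n] by linarith
  qed (use \<alpha> a in auto)
  then obtain K4 where K4: "0 < K4" "\<forall>k n. n \<ge> 1 \<longrightarrow> incr_surv k n \<le> K4 * (\<alpha> powr (-r)) ^ k * real n powr (-r-1)"
    by (elim exE conjE) (rule that)
  define K where "K = K1 + K2 + K3 + K4"
  have K: "K1 \<le> K" "K2 \<le> K" "K3 \<le> K" "K4 \<le> K" "0 < K" using K1 K2 K3 K4 by (auto simp: K_def)
  have mono: "x \<le> K * p * q" if "x \<le> K' * p * q" "K' \<le> K" "0 \<le> p" "0 \<le> q" for x p q K' :: real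
    using that by (meson mult_right_mono order_trans)
  have "tail_bounds r K"
    unfolding tail_bounds_def
    by (intro conjI allI impI r K mono[OF K1(2)[rule_format]] mono[OF K2(2)[rule_format]]
          mono[OF K3(2)[rule_format]] mono[OF K4(2)[rule_format]]) auto
  then show ?thesis by blast
qed

end

section \<open>The limit function\<close>

context election
begin

definition surv_at :: "nat \<Rightarrow> real \<Rightarrow> real" where
  "surv_at k x = surv k (nat \<lfloor>x\<rfloor>)"

lemma surv_at_mono: "x \<le> y \<Longrightarrow> surv_at k x \<le> surv_at k y"
  unfolding surv_at_def by (intro surv_mono nat_mono floor_mono)

lemma surv_diff_le:
  assumes "m \<le> n" "\<And>j. j \<in> {m..<n} \<Longrightarrow> incr_surv k j \<le> B"
  shows "surv k n - surv k m \<le> (real n - real m) * B"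
proof -
  have "surv k n - surv k m = (\<Sum>j=m..<n. incr_surv k j)"
    using assms(1) by (simp add: incr_surv_def sum_Suc_diff')
  also have "\<dots> \<le> real (card {m..<n}) * B" using assms(2) by (intro sum_bounded_above) auto
  finally show ?thesis using assms(1) by (simp add: of_nat_diff)
qed

text \<open>The two bounds are \<open>K / n\<close> times a number and \<open>K / n\<close> times
  its reciprocal, one of which is at most 1. What matters is the uniformity in
  \<open>k\<close>.\<close>

lemma incr_surv_le_inverse:
  assumes "tail_bounds r K" "n \<ge> 1"
  shows "incr_surv k n \<le> K / real n"
proof -
  define X where "X = (\<alpha> powr r) ^ k * real n powr r"
  have X: "X > 0" using \<alpha> assms by (simp add: X_def)
  have iX: "(\<alpha> powr (-r)) ^ k * real n powr (-r) = inverse X"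
    using \<alpha> assms by (simp add: X_def powr_minus power_inverse)
  have *: "incr_surv k n \<le> K * (\<alpha> powr r) ^ k * real n powr (r-1)"
    "incr_surv k n \<le> K * (\<alpha> powr (-r)) ^ k * real n powr (-r-1)" and K: "0 < K"
    using assms unfolding tail_bounds_def by blast+
  have "K * (\<alpha> powr r) ^ k * real n powr (r-1) = K / real n * X"
    using assms by (simp add: powr_diff X_def)
  then have 1: "incr_surv k n \<le> K / real n * X" using * by simp
  have "K * (\<alpha> powr (-r)) ^ k * real n powr (-r-1) = K / real n * ((\<alpha> powr (-r)) ^ k * real n powr (-r))"
    using assms by (simp add: powr_diff)
  then have 2: "incr_surv k n \<le> K / real n * inverse X" using * unfolding iX by simp
  show ?thesis
  proof (cases "X \<le> 1")
    case True
    have "K / real n * X \<le> K / real n * 1" using True K by (intro mult_left_mono) auto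
    then show ?thesis using 1 by simp
  next
    case False
    then have "inverse X \<le> 1" by (simp add: inverse_le_1_iff)
    then have "K / real n * inverse X \<le> K / real n * 1" using K by (intro mult_left_mono) auto
    then show ?thesis using 2 by simp
  qed
qed

lemma surv_abs_diff_le:
  assumes "tail_bounds r K" "0 < b" "b \<le> real m" "b \<le> real n"
  shows "\<bar>surv k n - surv k m\<bar> \<le> \<bar>real n - real m\<bar> * (K / b)"
proof -
  have K: "0 < K" using assms by (simp add: tail_bounds_def)
  have *: "surv k n - surv k m \<le> (real n - real m) * (K / b)" if "m \<le> n" "b \<le> real m" for m n
  proof (rule surv_diff_le[OF that(1)])
    fix j assume j: "j \<in> {m..<n}"
    then have "b \<le> real j" using that by auto
    moreover from this have "j \<ge> 1" using assms(2) by (cases j) auto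
    ultimately show "incr_surv k j \<le> K / b"
      using incr_surv_le_inverse[OF assms(1), of j k] frac_le[of K K b "real j"] K assms(2) by linarith
  qed
  show ?thesis
  proof (cases "m \<le> n")
    case True
    then show ?thesis using * assms surv_mono[OF True, of k] by simp
  next
    case False
    then show ?thesis using *[of n m] assms surv_mono[of n m k] by simp
  qed
qed

text \<open>Condition on the first round. Typical values of \<open>Y n\<close> lie within
  \<open>C * log_decay e n * n\<close> of \<open>\<alpha> n\<close>, where the slope is of order
  \<open>1/n\<close>; the remaining values cost at most their probability. Admitting every
  \<open>m\<close> within 1 of \<open>\<alpha> n\<close> takes care of integer parts later.\<close>

lemma surv_step:
  assumes B: "tail_bounds r K"
  shows "\<exists>C' n0. 0 < C' \<and> (\<forall>k n m. n0 \<le> n \<longrightarrow> \<bar>real m - \<alpha> * real n\<bar> \<le> 1 \<longrightarrow>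
    \<bar>surv (Suc k) n - surv k m\<bar> \<le> C' * log_decay e (real n))"
proof -
  have K: "0 < K" using B by (simp add: tail_bounds_def)
  have "((\<lambda>x. C * log_decay e x) \<longlongrightarrow> C * 0) at_top"
    by (intro tendsto_intros log_decay_tendsto_0 e)
  from order_tendstoD(2)[OF this, of "\<alpha>/2"] \<alpha>
  have ev1: "eventually (\<lambda>x. C * log_decay e x < \<alpha> / 2) at_top" by simp
  have "((\<lambda>x::real. (1/x) / log_decay e x) \<longlongrightarrow> 0) at_top"
    unfolding log_decay_def using e by real_asymp
  then have "eventually (\<lambda>x::real. (1/x) / log_decay e x < 1) at_top"
    by (intro order_tendstoD) auto
  with eventually_gt_at_top[of 1] have ev2: "eventually (\<lambda>x. 1/x < log_decay e x) at_top"
    by eventually_elim (simp add: log_decay_def field_simps)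
  from eventually_compose_filterlim[OF eventually_conj[OF ev1 ev2] filterlim_real_sequentially]
  obtain n2 where n2: "\<And>n. n \<ge> n2 \<Longrightarrow> C * log_decay e (real n) < \<alpha> / 2"
      "\<And>n. n \<ge> n2 \<Longrightarrow> 1 / real n < log_decay e (real n)"
    by (auto simp: eventually_sequentially)
  define n3 where "n3 = nat \<lceil>2 / \<alpha>\<rceil>"
  define C' where "C' = 2 * K / \<alpha> * (C + 1) + C"
  have "\<bar>surv (Suc k) n - surv k m\<bar> \<le> C' * log_decay e (real n)"
    if n: "max (max n1 n2) (max n3 (Suc a)) \<le> n" and m: "\<bar>real m - \<alpha> * real n\<bar> \<le> 1" for k n m
  proof -
    define l where "l = log_decay e (real n)"
    define far where "far = {j. \<bar>real j - \<alpha> * real n\<bar> > C * l * real n}"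
    have l: "0 \<le> l" "C * l < \<alpha> / 2" "1 / real n < l"
      using n n2[of n] by (auto simp: l_def log_decay_def)
    have n0: "real n > 0" using n by simp
    have "2 / \<alpha> \<le> real n" using n by (simp add: n3_def)
    then have an: "1 \<le> \<alpha> * real n / 2" using \<alpha> by (simp add: field_simps)
    then have mb: "\<alpha> * real n / 2 \<le> real m" using m by (auto simp: abs_if split: if_splits)
    define D where "D = 2 * K / \<alpha> * (C * l + 1 / real n)"
    have D: "D \<ge> 0" using K \<alpha> C l by (simp add: D_def)
    have near: "\<bar>surv k j - surv k m\<bar> \<le> D + indicator far j" for j
    proof (cases "j \<in> far")
      case True
      then show ?thesis using D surv_nonneg[of k j] surv_le_1[of k j] surv_nonneg[of k m] surv_le_1[of k m]
        by (simp add: abs_if)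
    next
      case False
      then have j: "\<bar>real j - \<alpha> * real n\<bar> \<le> C * l * real n" by (simp add: far_def)
      have "C * l * real n \<le> \<alpha> / 2 * real n" using l n0 by (intro mult_right_mono) auto
      with j have jb: "\<alpha> * real n / 2 \<le> real j" by (auto simp: abs_if split: if_splits)
      have "\<bar>surv k j - surv k m\<bar> \<le> \<bar>real j - real m\<bar> * (K / (\<alpha> * real n / 2))"
        using an by (intro surv_abs_diff_le[OF B] mb jb) auto
      also have "\<dots> \<le> (C * l * real n + 1) * (K / (\<alpha> * real n / 2))"
        using j m K an by (intro mult_right_mono) auto
      also have "\<dots> = D" using n0 \<alpha> by (simp add: D_def field_simps)
      finally show ?thesis using False by simp
    qed
    have p1: "(\<Sum>j=1..n. pmf (Y n) j) = 1" using supp[of n] n by (intro sum_pmf_eq_1) auto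
    have "\<bar>surv (Suc k) n - surv k m\<bar> = \<bar>\<Sum>j=1..n. pmf (Y n) j * (surv k j - surv k m)\<bar>"
      using n p1 by (subst surv_Suc_sum) (auto simp: right_diff_distrib sum_subtractf simp flip: sum_distrib_right)
    also have "\<dots> \<le> (\<Sum>j=1..n. pmf (Y n) j * (D + indicator far j))"
      by (rule order_trans[OF sum_abs]) (auto simp: abs_mult intro!: sum_mono mult_left_mono near)
    also have "\<dots> = D + (\<Sum>j=1..n. pmf (Y n) j * indicator far j)"
      using p1 by (simp add: distrib_left sum.distrib flip: sum_distrib_right)
    also have "(\<Sum>j=1..n. pmf (Y n) j * indicator far j) = measure_pmf.prob (Y n) far"
      using expectation_pmf_sum[OF supp[of n], of "indicator far"] n by simp
    also have "\<dots> \<le> C * real n powr (-2-e)" unfolding far_def l_def using n by (intro conc) auto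
    also have "\<dots> \<le> C * l"
    proof (intro mult_left_mono)
      have "real n powr (-2-e) \<le> real n powr (-1)" using n e by (intro powr_mono) auto
      then show "real n powr (-2-e) \<le> l" using l n0 by (simp add: powr_minus_divide)
    qed (use C in auto)
    also have "D + C * l \<le> C' * l"
    proof -
      have "D \<le> 2 * K / \<alpha> * (C * l + l)"
        unfolding D_def using l K \<alpha> by (intro mult_left_mono add_left_mono) auto
      also have "\<dots> = 2 * K / \<alpha> * (C + 1) * l" by (simp add: algebra_simps)
      finally show ?thesis by (simp add: C'_def distrib_right)
    qed
    finally show ?thesis by (simp add: l_def)
  qed
  moreover have "0 < C'" using C K \<alpha> by (simp add: C'_def add_pos_pos)
  ultimately show ?thesis by blast
qed

lemma surv_at_step:
  assumes B: "tail_bounds r K"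
  shows "\<exists>C' x0. 0 < C' \<and> 1 < x0 \<and> (\<forall>k x. x0 \<le> x \<longrightarrow> \<bar>surv_at (Suc k) x - surv_at k (\<alpha> * x)\<bar> \<le> C' * log_decay e x)"
proof -
  obtain C' n0 where C': "0 < C'" and step: "\<forall>k n m. n0 \<le> n \<longrightarrow> \<bar>real m - \<alpha> * real n\<bar> \<le> 1 \<longrightarrow>
    \<bar>surv (Suc k) n - surv k m\<bar> \<le> C' * log_decay e (real n)"
    using surv_step[OF B] by (elim exE conjE) (rule that)
  have "\<bar>surv_at (Suc k) x - surv_at k (\<alpha> * x)\<bar> \<le> C' * 2 powr (1+e) * log_decay e x"
    if x: "max 4 (real n0 + 1) \<le> x" for k x
  proof -
    define n where "n = nat \<lfloor>x\<rfloor>"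
    have n: "x - 1 < real n" "real n \<le> x" using x floor_nat_bounds[of x] by (simp_all add: n_def)
    define m where "m = nat \<lfloor>\<alpha> * x\<rfloor>"
    have "0 \<le> \<alpha> * x" using \<alpha> x by simp
    then have m: "\<alpha> * x - 1 < real m" "real m \<le> \<alpha> * x"
      using floor_nat_bounds[of "\<alpha> * x"] by (simp_all add: m_def)
    have ax: "\<alpha> * x \<le> \<alpha> * (real n + 1)" "\<alpha> * real n \<le> \<alpha> * x"
      using n \<alpha> by (auto intro!: mult_left_mono)
    then have "\<bar>real m - \<alpha> * real n\<bar> \<le> 1"
      using m \<alpha> unfolding distrib_left abs_le_iff by linarith
    moreover have "n0 \<le> n" using n x by linarith
    ultimately have "\<bar>surv (Suc k) n - surv k m\<bar> \<le> C' * log_decay e (real n)" using step by blast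
    also have "\<dots> \<le> C' * (2 powr (1+e) * log_decay e x)"
    proof (intro mult_left_mono)
      \<comment> \<open>Aims at \<open>x \<le> (x-1) powr 2\<close>, hence
        \<open>ln x \<le> 2 * ln n\<close>: passing from the integer part to \<open>x\<close> costs
        a factor \<open>2 powr (1+e)\<close> in the error.\<close>
      have "0 \<le> x * (x - 3)" using x by simp
      moreover have "(x - 1) powr 2 = x * (x - 3) + x + 1"
        using x by (simp add: powr_numeral power2_eq_square algebra_simps)
      ultimately have "x \<le> (x - 1) powr 2" by linarith
      also have "\<dots> \<le> real n powr 2" using n x by (intro powr_mono2) auto
      finally have "ln x \<le> ln (real n powr 2)" using x by (intro ln_mono) auto
      moreover have "ln (real n powr 2) = 2 * ln (real n)" using x n by (subst ln_powr) auto
      ultimately have "ln x / 2 \<le> ln (real n)" by linarith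
      then have "ln (real n) powr (-1-e) \<le> (ln x / 2) powr (-1-e)"
        using x e by (intro powr_mono2') auto
      also have "\<dots> = ln x powr (-1-e) * (1/2) powr (-1-e)"
        using x by (subst powr_mult[symmetric]) auto
      also have "(1/2) powr (-1-e) = 2 powr (1+e)"
        by (simp add: powr_divide powr_minus_divide[of 2 "1+e"] minus_diff_commute field_simps flip: powr_add)
      finally show "log_decay e (real n) \<le> 2 powr (1+e) * log_decay e x"
        by (simp add: log_decay_def mult.commute)
    qed (use C' in auto)
    finally show ?thesis by (simp add: surv_at_def n_def m_def mult.assoc)
  qed
  moreover have "0 < C' * 2 powr (1+e)" using C' by simp
  moreover have "1 < max 4 (real n0 + 1)" by simp
  ultimately show ?thesis by blast
qed

lemma surv_at_telescope:
  assumes B: "tail_bounds r K"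
  shows "\<exists>C' x0. 0 < C' \<and> 1 < x0 \<and>
    (\<forall>k m x. x0 \<le> x \<longrightarrow> \<bar>surv_at (k + m) (x / \<alpha> ^ m) - surv_at k x\<bar> \<le> C' * ln x powr (-e))"
proof -
  obtain C' x0 where C': "0 < C'" and x0: "1 < x0"
    and step: "\<forall>k x. x0 \<le> x \<longrightarrow> \<bar>surv_at (Suc k) x - surv_at k (\<alpha> * x)\<bar> \<le> C' * log_decay e x"
    using surv_at_step[OF B] by (elim exE conjE) (rule that)
  define D where "D = C' / (e * (- ln \<alpha>))"
  have la: "- ln \<alpha> > 0" using \<alpha> by simp
  have D: "D > 0" unfolding D_def using C' e la by (intro divide_pos_pos mult_pos_pos)
  \<comment> \<open>The induction needs this sharper form: the error of each scale is at most
    \<open>D\<close> times the drop of \<open>ln powr (-e)\<close> across it, and the drops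
    telescope to a bound free of \<open>k\<close> and \<open>m\<close>.\<close>
  have tel: "\<bar>surv_at (k + m) (x / \<alpha> ^ m) - surv_at k x\<bar> \<le> D * (ln x powr (-e) - ln (x / \<alpha> ^ m) powr (-e))"
    if x: "x0 \<le> x" for k m x
  proof (induction m)
    case 0
    then show ?case by simp
  next
    case (Suc m)
    define z where "z = x / \<alpha> ^ Suc m"
    have az: "\<alpha> * z = x / \<alpha> ^ m" using \<alpha> by (simp add: z_def)
    have am: "0 < \<alpha> ^ m" "\<alpha> ^ m \<le> 1" using \<alpha> by (simp_all add: power_le_one)
    have "x * 1 \<le> x * (1 / \<alpha> ^ m)"
      using am x x0 by (intro mult_left_mono) (auto simp: field_simps)
    then have axz: "x \<le> \<alpha> * z" using az by simp
    have "0 \<le> z" unfolding z_def using x x0 \<alpha> by (intro divide_nonneg_pos) auto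
    then have z: "\<alpha> * z \<le> z" using mult_right_mono[of \<alpha> 1 z] \<alpha> by simp
    have lnz: "ln (\<alpha> * z) = ln z - (- ln \<alpha>)" using axz z x x0 \<alpha> by (simp add: ln_mult)
    have "e * (- ln \<alpha>) * ln z powr (-1-e) \<le> (ln z - (- ln \<alpha>)) powr (-e) - ln z powr (-e)"
    proof (rule powr_neg_diff_ge[OF e la])
      have "0 < ln (\<alpha> * z)" using axz x x0 by simp
      then show "- ln \<alpha> < ln z" using lnz by simp
    qed
    then have "D * (e * (- ln \<alpha>) * ln z powr (-1-e)) \<le> D * (ln (\<alpha> * z) powr (-e) - ln z powr (-e))"
      unfolding lnz using D by (intro mult_left_mono) auto
    moreover have "D * (e * (- ln \<alpha>) * ln z powr (-1-e)) = C' * log_decay e z"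
      using e la by (simp add: D_def log_decay_def)
    ultimately have "C' * log_decay e z \<le> D * (ln (\<alpha> * z) powr (-e) - ln z powr (-e))" by simp
    moreover have "\<bar>surv_at (Suc (k + m)) z - surv_at (k + m) (\<alpha> * z)\<bar> \<le> C' * log_decay e z"
      using step axz z x by auto
    ultimately have "\<bar>surv_at (Suc (k + m)) z - surv_at (k + m) (\<alpha> * z)\<bar> \<le> D * (ln (\<alpha> * z) powr (-e) - ln z powr (-e))"
      by linarith
    moreover have "surv_at (k + Suc m) (x / \<alpha> ^ Suc m) = surv_at (Suc (k + m)) z" by (simp add: z_def)
    ultimately show ?case using Suc.IH unfolding z_def[symmetric] az[symmetric] right_diff_distrib
      by (simp only: abs_le_iff) linarith
  qed
  have "\<bar>surv_at (k + m) (x / \<alpha> ^ m) - surv_at k x\<bar> \<le> D * ln x powr (-e)" if "x0 \<le> x" for k m x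
  proof -
    have "D * (ln x powr (-e) - ln (x / \<alpha> ^ m) powr (-e)) \<le> D * ln x powr (-e)"
      using D by (intro mult_left_mono) auto
    then show ?thesis using tel[OF that, of k m] by linarith
  qed
  then show ?thesis using D x0 by blast
qed

definition H :: "real \<Rightarrow> real" where
  "H t = lim (\<lambda>m. surv_at m (t / \<alpha> ^ m))"

text \<open>Restart the telescope at level \<open>m\<close>: its bound depends only on the starting
  scale \<open>t / \<alpha> ^ m\<close>, which tends to infinity.\<close>

lemma H_lim:
  assumes t: "0 < t"
  shows "(\<lambda>m. surv_at m (t / \<alpha> ^ m)) \<longlonglongrightarrow> H t"
proof -
  obtain r K where B: "tail_bounds r K" using tail_bounds_exist by blast
  obtain C' x0 where C': "0 < C'" "1 < x0"
    and tel: "\<forall>k m x. x0 \<le> x \<longrightarrow> \<bar>surv_at (k + m) (x / \<alpha> ^ m) - surv_at k x\<bar> \<le> C' * ln x powr (-e)"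
    using surv_at_telescope[OF B] by (elim exE conjE) (rule that)
  have lim: "filterlim (\<lambda>m. t / \<alpha> ^ m) at_top sequentially"
    using filterlim_divide_power_at_top t \<alpha> by blast
  have "Cauchy (\<lambda>m. surv_at m (t / \<alpha> ^ m))"
  proof (rule CauchyI')
    fix \<eta> :: real assume \<eta>: "0 < \<eta>"
    have "((\<lambda>x. C' * ln x powr (-e)) \<longlongrightarrow> C' * 0) at_top"
      by (intro tendsto_intros ln_powr_tendsto_0 e)
    from order_tendstoD(2)[OF this, of \<eta>] \<eta>
    have "eventually (\<lambda>x. C' * ln x powr (-e) < \<eta>) at_top" by simp
    from eventually_compose_filterlim[OF eventually_conj[OF this eventually_ge_at_top[of x0]] lim]
    obtain M where M: "\<And>m. m \<ge> M \<Longrightarrow> C' * ln (t / \<alpha> ^ m) powr (-e) < \<eta> \<and> x0 \<le> t / \<alpha> ^ m"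
      by (auto simp: eventually_sequentially)
    show "\<exists>M. \<forall>m\<ge>M. \<forall>n>m. dist (surv_at m (t / \<alpha> ^ m)) (surv_at n (t / \<alpha> ^ n)) < \<eta>"
    proof (intro exI[of _ M] allI impI)
      fix m n assume m: "M \<le> m" "m < n"
      have "\<bar>surv_at (m + (n - m)) (t / \<alpha> ^ m / \<alpha> ^ (n - m)) - surv_at m (t / \<alpha> ^ m)\<bar> \<le> C' * ln (t / \<alpha> ^ m) powr (-e)"
        using tel M[OF m(1)] by blast
      moreover have "\<alpha> ^ m * \<alpha> ^ (n - m) = \<alpha> ^ n" using m by (simp flip: power_add)
      then have "t / \<alpha> ^ m / \<alpha> ^ (n - m) = t / \<alpha> ^ n" by simp
      moreover have "m + (n - m) = n" using m by simp
      ultimately have "\<bar>surv_at n (t / \<alpha> ^ n) - surv_at m (t / \<alpha> ^ m)\<bar> \<le> C' * ln (t / \<alpha> ^ m) powr (-e)"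
        by (simp only:)
      then show "dist (surv_at m (t / \<alpha> ^ m)) (surv_at n (t / \<alpha> ^ n)) < \<eta>"
        unfolding dist_real_def using conjunct1[OF M[OF m(1)]] by linarith
    qed
  qed
  then show ?thesis unfolding H_def by (simp add: Cauchy_convergent_iff convergent_LIMSEQ_iff)
qed

text \<open>With \<open>t = \<alpha> ^ k * n\<close> the entry number \<open>k + m\<close> of the
  sequence defining \<open>H t\<close> starts from \<open>n / \<alpha> ^ m\<close>, so the telescope
  begins at \<open>n\<close> after \<open>k\<close> rounds. Its bound involves only
  \<open>n\<close>, whence uniformity in \<open>k\<close>.\<close>

lemma H_scaled:
  "\<exists>C' x0. 0 < C' \<and> 1 < x0 \<and>
    (\<forall>k n. x0 \<le> real n \<longrightarrow> \<bar>H (\<alpha> ^ k * real n) - surv k n\<bar> \<le> C' * ln (real n) powr (-e))"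
proof -
  obtain r K where B: "tail_bounds r K" using tail_bounds_exist by blast
  obtain C' x0 where C': "0 < C'" "1 < x0"
    and tel: "\<forall>k m x. x0 \<le> x \<longrightarrow> \<bar>surv_at (k + m) (x / \<alpha> ^ m) - surv_at k x\<bar> \<le> C' * ln x powr (-e)"
    using surv_at_telescope[OF B] by (elim exE conjE) (rule that)
  have "\<bar>H (\<alpha> ^ k * real n) - surv k n\<bar> \<le> C' * ln (real n) powr (-e)" if n: "x0 \<le> real n" for k n
  proof -
    have "0 < \<alpha> ^ k * real n" using n C' \<alpha> by simp
    from LIMSEQ_ignore_initial_segment[OF H_lim[OF this], of k]
    have "(\<lambda>m. surv_at (k + m) (real n / \<alpha> ^ m)) \<longlonglongrightarrow> H (\<alpha> ^ k * real n)"
      using \<alpha> by (simp add: power_add add.commute)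
    then have "(\<lambda>m. \<bar>surv_at (k + m) (real n / \<alpha> ^ m) - surv_at k (real n)\<bar>) \<longlonglongrightarrow> \<bar>H (\<alpha> ^ k * real n) - surv_at k (real n)\<bar>"
      by (intro tendsto_intros)
    then have "\<bar>H (\<alpha> ^ k * real n) - surv_at k (real n)\<bar> \<le> C' * ln (real n) powr (-e)"
      using tel n by (intro LIMSEQ_le_const2) auto
    then show ?thesis by (simp add: surv_at_def)
  qed
  then show ?thesis using C' by blast
qed

lemma H_mono: "0 < s \<Longrightarrow> s \<le> t \<Longrightarrow> H s \<le> H t"
  using \<alpha> by (intro LIMSEQ_le[OF H_lim H_lim]) (auto intro!: surv_at_mono divide_right_mono)

lemma H_nonneg: "0 < t \<Longrightarrow> 0 \<le> H t"
  by (intro LIMSEQ_le_const[OF H_lim]) (auto simp: surv_at_def surv_nonneg)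

lemma H_le_1: "0 < t \<Longrightarrow> H t \<le> 1"
  by (intro LIMSEQ_le_const2[OF H_lim]) (auto simp: surv_at_def surv_le_1)

lemma eventually_floor_ge_1:
  assumes "0 < t"
  shows "eventually (\<lambda>m. nat \<lfloor>t / \<alpha> ^ m\<rfloor> \<ge> 1) sequentially"
proof -
  have "eventually (\<lambda>m. 1 \<le> t / \<alpha> ^ m) sequentially"
    using filterlim_divide_power_at_top[OF assms \<alpha>] by (simp add: filterlim_at_top)
  then show ?thesis by eventually_elim (auto simp: le_nat_iff le_floor_iff)
qed

lemma H_le_powr:
  assumes "tail_bounds r K" "0 < t"
  shows "H t \<le> K * t powr r"
proof (rule tendsto_le[OF _ _ H_lim[OF assms(2)]])
  show "(\<lambda>m. K * ((\<alpha> powr r) ^ m * real (nat \<lfloor>t / \<alpha> ^ m\<rfloor>) powr r)) \<longlonglongrightarrow> K * t powr r"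
    by (intro tendsto_intros floor_scaled_powr_tendsto assms \<alpha>)
  show "eventually (\<lambda>m. surv_at m (t / \<alpha> ^ m) \<le> K * ((\<alpha> powr r) ^ m * real (nat \<lfloor>t / \<alpha> ^ m\<rfloor>) powr r)) sequentially"
    using eventually_floor_ge_1[OF assms(2)]
    by eventually_elim (use assms(1) in \<open>simp add: surv_at_def tail_bounds_def mult.assoc\<close>)
qed auto

lemma one_minus_H_le_powr:
  assumes "tail_bounds r K" "0 < t"
  shows "1 - H t \<le> K * t powr (-r)"
proof (rule tendsto_le[OF _ _ tendsto_diff[OF tendsto_const H_lim[OF assms(2)]]])
  show "(\<lambda>m. K * ((\<alpha> powr (-r)) ^ m * real (nat \<lfloor>t / \<alpha> ^ m\<rfloor>) powr (-r))) \<longlonglongrightarrow> K * t powr (-r)"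
    by (intro tendsto_intros floor_scaled_powr_tendsto assms \<alpha>)
  show "eventually (\<lambda>m. 1 - surv_at m (t / \<alpha> ^ m) \<le> K * ((\<alpha> powr (-r)) ^ m * real (nat \<lfloor>t / \<alpha> ^ m\<rfloor>) powr (-r))) sequentially"
    using eventually_floor_ge_1[OF assms(2)]
    by eventually_elim (use assms(1) in \<open>simp add: surv_at_def tail_bounds_def mult.assoc\<close>)
qed auto

text \<open>Treats \<open>p = r\<close> and \<open>p = -r\<close> together. Since
  \<open>p \<le> 1\<close>, the increment bound is largest at the left end; splitting
  \<open>\<alpha> powr p\<close> as \<open>\<alpha> * \<alpha> powr (p-1)\<close> distributes the
  scaling over the length of the interval and the power of its left end.\<close>

lemma H_diff_le_aux:
  assumes K: "0 < K" and p: "p \<le> 1" and st: "0 < s" "s \<le> t"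
    and B: "\<And>k n. n \<ge> 1 \<Longrightarrow> incr_surv k n \<le> K * (\<alpha> powr p) ^ k * real n powr (p-1)"
  shows "H t - H s \<le> K * ((t - s) * s powr (p-1))"
proof (rule tendsto_le[OF _ _ tendsto_diff[OF H_lim H_lim]])
  let ?n = "\<lambda>x m. real (nat \<lfloor>x / \<alpha> ^ m\<rfloor>)"
  show "(\<lambda>m. K * ((\<alpha> ^ m * ?n t m - \<alpha> ^ m * ?n s m) * ((\<alpha> powr (p-1)) ^ m * ?n s m powr (p-1))))
     \<longlonglongrightarrow> K * ((t - s) * s powr (p-1))"
    using st \<alpha> by (intro tendsto_intros floor_scaled_powr_tendsto floor_scaled_tendsto) auto
  show "eventually (\<lambda>m. surv_at m (t / \<alpha> ^ m) - surv_at m (s / \<alpha> ^ m)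
    \<le> K * ((\<alpha> ^ m * ?n t m - \<alpha> ^ m * ?n s m) * ((\<alpha> powr (p-1)) ^ m * ?n s m powr (p-1)))) sequentially"
    using eventually_floor_ge_1[OF st(1)]
  proof eventually_elim
    case (elim m)
    have le: "nat \<lfloor>s / \<alpha> ^ m\<rfloor> \<le> nat \<lfloor>t / \<alpha> ^ m\<rfloor>"
      using st \<alpha> by (intro nat_mono floor_mono divide_right_mono) auto
    have "surv_at m (t / \<alpha> ^ m) - surv_at m (s / \<alpha> ^ m) \<le> (?n t m - ?n s m) * (K * (\<alpha> powr p) ^ m * ?n s m powr (p-1))"
      unfolding surv_at_def
    proof (rule surv_diff_le[OF le])
      fix j assume j: "j \<in> {nat \<lfloor>s / \<alpha> ^ m\<rfloor>..<nat \<lfloor>t / \<alpha> ^ m\<rfloor>}"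
      have "incr_surv m j \<le> K * (\<alpha> powr p) ^ m * real j powr (p-1)" using B j elim by auto
      also have "\<dots> \<le> K * (\<alpha> powr p) ^ m * ?n s m powr (p-1)"
      proof (intro mult_left_mono powr_mono2')
        show "0 < ?n s m" using elim by linarith
        show "?n s m \<le> real j" using j by simp
      qed (use K p in auto)
      finally show "incr_surv m j \<le> K * (\<alpha> powr p) ^ m * ?n s m powr (p-1)" .
    qed
    also have "\<alpha> powr p = \<alpha> * \<alpha> powr (p-1)" using \<alpha> by (simp add: powr_diff)
    also have "(?n t m - ?n s m) * (K * (\<alpha> * \<alpha> powr (p-1)) ^ m * ?n s m powr (p-1))
      = K * ((\<alpha> ^ m * ?n t m - \<alpha> ^ m * ?n s m) * ((\<alpha> powr (p-1)) ^ m * ?n s m powr (p-1)))"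
      by (simp add: power_mult_distrib algebra_simps)
    finally show ?case .
  qed
qed (use st in auto)

lemma H_diff_le:
  assumes "tail_bounds r K" "0 < s" "s \<le> t"
  shows "H t - H s \<le> K * ((t - s) * s powr (r-1))"
    and "H t - H s \<le> K * ((t - s) * s powr (-r-1))"
  using assms by (auto simp: tail_bounds_def intro!: H_diff_le_aux)

end

section \<open>Convergence of the number of rounds\<close>

context election
begin

lemma surv_Suc_le: "surv (Suc k) n \<le> surv k n"
proof (induction k arbitrary: n)
  case 0
  then show ?case by (cases "n \<le> a") (auto simp: surv_stopped surv_0 surv_le_1)
next
  case (Suc k)
  show ?case
  proof (cases "n \<le> a")
    case False
    then have "a < n" by simp
    show ?thesis unfolding surv_Suc_sum[OF \<open>a < n\<close>]
      using Suc by (intro sum_mono mult_left_mono) auto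
  qed (simp add: surv_stopped)
qed

lemma surv_tendsto_0:
  assumes "1 \<le> n"
  shows "(\<lambda>k. surv k n) \<longlonglongrightarrow> 0"
proof -
  obtain r K where B: "tail_bounds r K" using tail_bounds_exist by blast
  then have r: "0 < r" by (simp add: tail_bounds_def)
  have "\<alpha> powr r < 1" using powr_less_mono'[of \<alpha> 0 r] \<alpha> r by simp
  then have "(\<lambda>k. (\<alpha> powr r) ^ k) \<longlonglongrightarrow> 0" by (intro LIMSEQ_realpow_zero) auto
  from tendsto_mult_right[OF tendsto_mult_left[OF this, of K], of "real n powr r"]
  have lim: "(\<lambda>k. K * (\<alpha> powr r) ^ k * real n powr r) \<longlonglongrightarrow> 0" by simp
  show ?thesis
  proof (rule tendsto_sandwich[OF _ _ tendsto_const lim])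
    show "eventually (\<lambda>k. surv k n \<le> K * (\<alpha> powr r) ^ k * real n powr r) sequentially"
      using B assms by (simp add: tail_bounds_def)
  qed (simp add: surv_nonneg)
qed

lemma rounds_cdf_eq: "rounds_cdf Y a n k = 1 - surv k n"
  by (simp add: surv_def)

text \<open>\<open>embed_pmf\<close> is meaningful only for a nonnegative function of total mass 1.
  The first is monotonicity in the number of rounds, the second is almost sure termination,
  \<open>surv_tendsto_0\<close>.\<close>

lemma pmf_rounds:
  assumes n: "1 \<le> n"
  shows "pmf (rounds Y a n) k = (if k = 0 then rounds_cdf Y a n 0
    else rounds_cdf Y a n k - rounds_cdf Y a n (k - 1))"
  unfolding rounds_def
proof (rule pmf_embed_pmf)
  let ?f = "\<lambda>k. if k = 0 then rounds_cdf Y a n 0 else rounds_cdf Y a n k - rounds_cdf Y a n (k - 1)"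
  show nn: "0 \<le> ?f k" for k
    using surv_Suc_le[of "k - 1" n] surv_le_1[of 0 n] by (cases k) (auto simp: rounds_cdf_eq)
  have "(\<Sum>i<Suc m. ?f i) = rounds_cdf Y a n m" for m
    by (induction m) auto
  moreover have "(\<lambda>m. rounds_cdf Y a n m) \<longlonglongrightarrow> 1 - 0"
    unfolding rounds_cdf_eq by (intro tendsto_intros surv_tendsto_0 n)
  ultimately have "(\<lambda>m. \<Sum>i<Suc m. ?f i) \<longlonglongrightarrow> 1" by simp
  then have "?f sums 1" unfolding sums_def by (rule LIMSEQ_imp_Suc)
  then have "(\<Sum>i. ennreal (?f i)) = ennreal 1"
    by (intro suminf_ennreal_eq nn)
  then show "(\<integral>\<^sup>+k. ennreal (?f k) \<partial>count_space UNIV) = 1"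
    by (simp add: nn_integral_count_space_nat)
qed

lemma prob_rounds:
  assumes n: "1 \<le> n"
  shows "measure_pmf.prob (rounds Y a n) {..k} = 1 - surv k n"
proof -
  have "measure_pmf.prob (rounds Y a n) {..k} = (\<Sum>i\<le>k. pmf (rounds Y a n) i)"
    by (simp add: measure_measure_pmf_finite)
  also have "\<dots> = rounds_cdf Y a n k"
    by (induction k) (auto simp: pmf_rounds[OF n])
  finally show ?thesis by (simp add: rounds_cdf_eq)
qed

text \<open>For \<open>n \<ge> 1\<close>, the probability of more than \<open>k\<close> rounds,
  extended by 1 to negative \<open>k\<close> so that it can be compared with \<open>H\<close> on all
  integers.\<close>

definition survZ :: "nat \<Rightarrow> int \<Rightarrow> real" where
  "survZ n k = (if k < 0 then 1 else surv (nat k) n)"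

lemma prob_int_rounds:
  assumes n: "1 \<le> n"
  shows "measure_pmf.prob (map_pmf int (rounds Y a n)) {..k} = 1 - survZ n k"
proof (cases "k < 0")
  case True
  then have "int -` {..k} = {}" by auto
  then show ?thesis using True by (simp add: survZ_def)
next
  case False
  then have "int -` {..k} = {..nat k}" by auto
  then show ?thesis using False prob_rounds[OF n] by (simp add: survZ_def)
qed

lemma pmf_int_rounds:
  assumes n: "1 \<le> n"
  shows "pmf (map_pmf int (rounds Y a n)) k = survZ n (k - 1) - survZ n k"
proof -
  let ?p = "map_pmf int (rounds Y a n)"
  have "{..k} = {..k-1} \<union> {k}" by auto
  then have "measure_pmf.prob ?p {..k} = measure_pmf.prob ?p {..k-1} + measure_pmf.prob ?p {k}"
    by (simp only:, intro measure_pmf.finite_measure_Union) auto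
  then show ?thesis by (simp add: prob_int_rounds[OF n] measure_pmf_single del: measure_map_pmf)
qed

text \<open>The tail-sum formula for the mean. Subtracting the indicator of \<open>k < 0\<close>
  leaves only the terms with \<open>k \<ge> 0\<close>, in the same shape as the two-sided sum in
  \<open>meanH\<close>.\<close>

lemma integral_survZ:
  assumes n: "1 \<le> n"
  shows "measure_pmf.expectation (rounds Y a n) real
    = (\<integral>k. survZ n k - (if k < 0 then 1 else 0) \<partial>count_space UNIV)"
proof -
  have "(\<integral>\<^sup>+k. ennreal (real k) \<partial>measure_pmf (rounds Y a n))
      = (\<Sum>t. emeasure (measure_pmf (rounds Y a n)) {k. t < k})"
    using nn_integral_nat_function[of "\<lambda>k. k" "measure_pmf (rounds Y a n)"]
    by (simp add: ennreal_of_nat_eq_real_of_nat)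
  also have "\<dots> = (\<Sum>t. ennreal (surv t n))"
  proof (intro suminf_cong)
    fix t :: nat
    have "{k. t < k} = UNIV - {..t}" by auto
    then have "measure_pmf.prob (rounds Y a n) {k. t < k} = surv t n"
      using measure_pmf.prob_compl[of "{..t}" "rounds Y a n"] prob_rounds[OF n] by simp
    then show "emeasure (measure_pmf (rounds Y a n)) {k. t < k} = ennreal (surv t n)"
      by (simp add: measure_pmf.emeasure_eq_measure)
  qed
  also have "\<dots> = (\<integral>\<^sup>+k. (if k < 0 then 0 else ennreal (surv (nat k) n)) \<partial>count_space UNIV)"
    by (rule nn_integral_int_nat[symmetric])
  also have "\<dots> = (\<integral>\<^sup>+k. ennreal (survZ n k - (if k < 0 then 1 else 0)) \<partial>count_space UNIV)"
    by (intro nn_integral_cong) (auto simp: survZ_def)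
  finally have eq: "(\<integral>\<^sup>+k. ennreal (real k) \<partial>measure_pmf (rounds Y a n))
    = (\<integral>\<^sup>+k. ennreal (survZ n k - (if k < 0 then 1 else 0)) \<partial>count_space UNIV)" .
  have "measure_pmf.expectation (rounds Y a n) real = enn2real (\<integral>\<^sup>+k. ennreal (real k) \<partial>measure_pmf (rounds Y a n))"
    by (rule integral_eq_nn_integral) auto
  also have "\<dots> = (\<integral>k. survZ n k - (if k < 0 then 1 else 0) \<partial>count_space UNIV)"
    unfolding eq by (rule integral_eq_nn_integral[symmetric]) (auto simp: survZ_def surv_nonneg)
  finally show ?thesis .
qed

section \<open>Uniform and summed closeness to the limit function\<close>

text \<open>The smaller of \<open>t powr r\<close> and \<open>t powr (-r)\<close> for positive
  \<open>t\<close> and \<open>r\<close>. In this form its square root is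
  \<open>peak (r/2) t\<close>, and along \<open>t = \<alpha> powr k * n\<close> it is geometric in
  the distance of \<open>k\<close> from \<open>log (1/\<alpha>) n\<close>.\<close>

definition peak :: "real \<Rightarrow> real \<Rightarrow> real" where
  "peak r t = exp (- (r * \<bar>ln t\<bar>))"

lemma peak_eq_min:
  assumes "0 < t" "0 < r"
  shows "peak r t = min (t powr r) (t powr (-r))"
  using assms by (auto simp: peak_def powr_def min_def abs_if mult_le_0_iff)

lemma peak_scaled:
  assumes "0 < t"
  shows "peak r (\<alpha> powr x * t) = (\<alpha> powr r) powr \<bar>x - log (1/\<alpha>) t\<bar>"
proof -
  have "ln (\<alpha> powr x * t) = ln \<alpha> * (x - log (1/\<alpha>) t)"
    using assms \<alpha> by (simp add: ln_mult log_def ln_div algebra_simps)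
  then have "\<bar>ln (\<alpha> powr x * t)\<bar> = - ln \<alpha> * \<bar>x - log (1/\<alpha>) t\<bar>"
    using \<alpha> by (simp add: abs_mult)
  moreover have "(\<alpha> powr r) powr \<bar>x - log (1/\<alpha>) t\<bar> = exp (r * \<bar>x - log (1/\<alpha>) t\<bar> * ln \<alpha>)"
    using \<alpha> by (subst powr_powr) (simp add: powr_def)
  ultimately show ?thesis by (simp add: peak_def)
qed

lemma peak_sum_bound:
  assumes "0 < r"
  shows "\<exists>S\<ge>0. \<forall>t>0. (\<integral>\<^sup>+k. ennreal (peak r (\<alpha> powr real_of_int k * t)) \<partial>count_space UNIV) \<le> ennreal S"
proof -
  have "\<alpha> powr r < 1" using powr_less_mono'[of \<alpha> 0 r] \<alpha> assms by simp
  then show ?thesis using int_power_sum_bound[of "\<alpha> powr r"] \<alpha> by (auto simp: peak_scaled)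
qed

text \<open>Read off from the second bound at \<open>k = 0\<close>, \<open>n = 1\<close>, where the
  process has already stopped because \<open>a \<ge> 1\<close>.\<close>

lemma tail_bounds_ge_1: "tail_bounds r K \<Longrightarrow> 1 \<le> K"
  using a unfolding tail_bounds_def by (elim conjE allE[of _ 0] allE[of _ 1]) (simp add: surv_0)

lemma H_diff_peak:
  assumes B: "tail_bounds r K" and st: "0 < s" "s \<le> t"
  shows "H t - H s \<le> K * ((t - s) / s) * peak r s"
proof -
  have e: "s powr (r-1) = s powr r / s" "s powr (-r-1) = s powr (-r) / s" using st by (simp_all add: powr_diff)
  have "0 < r" using B by (simp add: tail_bounds_def)
  then show ?thesis
    using H_diff_le[OF B st] unfolding e peak_eq_min[OF st(1) \<open>0 < r\<close>] by (auto simp: min_def)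
qed

text \<open>Both quantities lie in [0,1] and share the same two tail bounds, so their difference
  does as well. For negative \<open>k\<close> the scaled point is at least 1, and
  \<open>K \<ge> 1\<close> makes the bounds trivial there.\<close>

lemma survZ_H_peak:
  assumes B: "tail_bounds r K" and n: "1 \<le> n"
  shows "\<bar>survZ n k - H (\<alpha> powr real_of_int k * real n)\<bar> \<le> K * peak r (\<alpha> powr real_of_int k * real n)"
proof -
  define t where "t = \<alpha> powr real_of_int k * real n"
  have t: "0 < t" using n \<alpha> by (simp add: t_def)
  have r: "0 < r" "0 < K" using B by (auto simp: tail_bounds_def)
  have pw: "(\<alpha> powr s) ^ nat k * real n powr s = t powr s" if "0 \<le> k" for s
  proof -
    have "(\<alpha> powr s) ^ nat k = \<alpha> powr (s * real (nat k))" using \<alpha> by (simp add: powr_power mult.commute)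
    then show ?thesis using that n \<alpha> by (simp add: t_def powr_mult powr_powr mult.commute)
  qed
  have H: "0 \<le> H t" "H t \<le> 1" "H t \<le> K * t powr r" "1 - H t \<le> K * t powr (-r)"
    using H_nonneg[OF t] H_le_1[OF t] H_le_powr[OF B t] one_minus_H_le_powr[OF B t] by auto
  have Z: "0 \<le> survZ n k" "survZ n k \<le> 1" by (auto simp: survZ_def surv_nonneg surv_le_1)
  have Z1: "survZ n k \<le> K * t powr r"
  proof (cases "k < 0")
    case True
    have "1 * 1 \<le> \<alpha> powr real_of_int k * real n"
      using True n \<alpha> powr_mono'[of "real_of_int k" 0 \<alpha>] by (intro mult_mono) auto
    then have "1 \<le> t" by (simp add: t_def)
    then have "1 * 1 \<le> K * t powr r"
      using tail_bounds_ge_1[OF B] r by (intro mult_mono) (auto simp: ge_one_powr_ge_zero)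
    then show ?thesis using True by (simp add: survZ_def)
  next
    case False
    have "surv (nat k) n \<le> K * (\<alpha> powr r) ^ nat k * real n powr r"
      using B n unfolding tail_bounds_def by blast
    then show ?thesis using False pw[of r] by (simp add: survZ_def mult.assoc)
  qed
  have Z2: "1 - survZ n k \<le> K * t powr (-r)"
  proof (cases "k < 0")
    case True
    then show ?thesis using r by (simp add: survZ_def)
  next
    case False
    have "1 - surv (nat k) n \<le> K * (\<alpha> powr (-r)) ^ nat k * real n powr (-r)"
      using B n unfolding tail_bounds_def by blast
    then show ?thesis using False pw[of "-r"] by (simp add: survZ_def mult.assoc)
  qed
  have "\<bar>survZ n k - H t\<bar> \<le> K * t powr r" "\<bar>survZ n k - H t\<bar> \<le> K * t powr (-r)"
    using H Z Z1 Z2 by linarith+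
  then show ?thesis unfolding t_def[symmetric] peak_eq_min[OF t r(1)] by (auto simp: min_def)
qed

text \<open>Nonnegative \<open>k\<close> is covered by \<open>H_scaled\<close>. For negative
  \<open>k\<close> the argument of \<open>H\<close> is at least \<open>n\<close>, so
  \<open>H\<close> is within \<open>K * n powr (-r)\<close> of 1.\<close>

lemma survZ_H_uniform:
  "\<exists>\<eta>. \<eta> \<longlonglongrightarrow> 0 \<and> (\<forall>n. 0 \<le> \<eta> n) \<and>
    eventually (\<lambda>n. \<forall>k. \<bar>survZ n k - H (\<alpha> powr real_of_int k * real n)\<bar> \<le> \<eta> n) sequentially"
proof -
  obtain r K where B: "tail_bounds r K" using tail_bounds_exist by blast
  have r: "0 < r" "0 < K" using B by (auto simp: tail_bounds_def)
  obtain C' x0 where C': "0 < C'" "1 < x0" and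
    sc: "\<forall>k n. x0 \<le> real n \<longrightarrow> \<bar>H (\<alpha> ^ k * real n) - surv k n\<bar> \<le> C' * ln (real n) powr (-e)"
    using H_scaled by (elim exE conjE) (rule that)
  define \<eta> where "\<eta> n = C' * ln (real n) powr (-e) + K * real n powr (-r)" for n :: nat
  have "((\<lambda>x. C' * ln x powr (-e) + K * x powr (-r)) \<longlongrightarrow> 0) at_top"
    using e r by real_asymp
  from filterlim_compose[OF this filterlim_real_sequentially] have "\<eta> \<longlonglongrightarrow> 0"
    by (simp add: \<eta>_def[abs_def])
  moreover have "0 \<le> \<eta> n" for n using C' r by (simp add: \<eta>_def)
  moreover have "eventually (\<lambda>n. \<forall>k. \<bar>survZ n k - H (\<alpha> powr real_of_int k * real n)\<bar> \<le> \<eta> n) sequentially"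
    using eventually_compose_filterlim[OF eventually_ge_at_top[of x0] filterlim_real_sequentially]
  proof eventually_elim
    case (elim n)
    then have n: "1 \<le> n" using C' by linarith
    show ?case
    proof
      fix k :: int
      show "\<bar>survZ n k - H (\<alpha> powr real_of_int k * real n)\<bar> \<le> \<eta> n"
      proof (cases "k < 0")
        case True
        define t where "t = \<alpha> powr real_of_int k * real n"
        have "1 * real n \<le> t"
          unfolding t_def using True n \<alpha> powr_mono'[of "real_of_int k" 0 \<alpha>] by (intro mult_right_mono) auto
        then have nt: "real n \<le> t" by simp
        then have t: "0 < t" using n by linarith
        have "1 - H t \<le> K * t powr (-r)" by (rule one_minus_H_le_powr[OF B t])
        also have "\<dots> \<le> K * real n powr (-r)" using nt n r by (intro mult_left_mono powr_mono2') auto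
        also have "\<dots> \<le> \<eta> n" using C' by (simp add: \<eta>_def)
        finally show ?thesis using True H_le_1[OF t] by (simp add: survZ_def t_def)
      next
        case False
        then have "\<alpha> powr real_of_int k = \<alpha> ^ nat k" using \<alpha> by (simp flip: powr_realpow)
        then have "\<bar>survZ n k - H (\<alpha> powr real_of_int k * real n)\<bar> \<le> C' * ln (real n) powr (-e)"
          using sc elim False by (simp add: survZ_def abs_minus_commute)
        also have "\<dots> \<le> \<eta> n" using r by (simp add: \<eta>_def)
        finally show ?thesis .
      qed
    qed
  qed
  ultimately show ?thesis by blast
qed

text \<open>The uniform bound \<open>\<eta> n\<close> and the summable bound \<open>K * peak r\<close> are combined by \<open>min x y \<le> sqrt (x * y)\<close>.\<close>

lemma survZ_H_sum:
  "\<exists>s. s \<longlonglongrightarrow> 0 \<and> (\<forall>n. 0 \<le> s n) \<and>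
    eventually (\<lambda>n. (\<integral>\<^sup>+k. ennreal \<bar>survZ n k - H (\<alpha> powr real_of_int k * real n)\<bar> \<partial>count_space UNIV) \<le> ennreal (s n)) sequentially"
proof -
  obtain r K where B: "tail_bounds r K" using tail_bounds_exist by blast
  have r: "0 < r" "0 < K" using B by (auto simp: tail_bounds_def)
  obtain \<eta> where \<eta>: "\<eta> \<longlonglongrightarrow> 0" "\<And>n. 0 \<le> \<eta> n"
    and ev: "eventually (\<lambda>n. \<forall>k. \<bar>survZ n k - H (\<alpha> powr real_of_int k * real n)\<bar> \<le> \<eta> n) sequentially"
    using survZ_H_uniform by blast
  have r2: "0 < r / 2" using r by simp
  obtain S where S: "0 \<le> S" "\<And>t. 0 < t \<Longrightarrow>
      (\<integral>\<^sup>+k. ennreal (peak (r/2) (\<alpha> powr real_of_int k * t)) \<partial>count_space UNIV) \<le> ennreal S"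
    using peak_sum_bound[OF r2] by blast
  define s where "s n = sqrt (\<eta> n * K) * S" for n
  have "s \<longlonglongrightarrow> sqrt (0 * K) * S" unfolding s_def by (intro tendsto_intros \<eta>)
  moreover have "0 \<le> s n" for n using \<eta> r S by (simp add: s_def)
  moreover have "eventually (\<lambda>n. (\<integral>\<^sup>+k. ennreal \<bar>survZ n k - H (\<alpha> powr real_of_int k * real n)\<bar> \<partial>count_space UNIV) \<le> ennreal (s n)) sequentially"
    using ev eventually_ge_at_top[of 1]
  proof eventually_elim
    case (elim n)
    have "\<bar>survZ n k - H (\<alpha> powr real_of_int k * real n)\<bar>
        \<le> sqrt (\<eta> n * K) * peak (r/2) (\<alpha> powr real_of_int k * real n)" for k
    proof -
      let ?x = "\<bar>survZ n k - H (\<alpha> powr real_of_int k * real n)\<bar>"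
      let ?p = "peak (r/2) (\<alpha> powr real_of_int k * real n)"
      have pp: "peak r (\<alpha> powr real_of_int k * real n) = ?p * ?p"
        by (simp add: peak_def flip: exp_add)
      have "?x * ?x \<le> \<eta> n * (K * (?p * ?p))"
        using elim survZ_H_peak[OF B, of n k] \<eta> unfolding pp by (intro mult_mono) auto
      then have "sqrt (?x * ?x) \<le> sqrt ((\<eta> n * K) * (?p * ?p))"
        by (subst real_sqrt_le_iff) (simp add: mult.assoc)
      moreover have "0 \<le> ?p" by (simp add: peak_def)
      ultimately show ?thesis by (simp add: real_sqrt_mult)
    qed
    then have "(\<integral>\<^sup>+k. ennreal \<bar>survZ n k - H (\<alpha> powr real_of_int k * real n)\<bar> \<partial>count_space UNIV)
      \<le> (\<integral>\<^sup>+k. ennreal (sqrt (\<eta> n * K)) * ennreal (peak (r/2) (\<alpha> powr real_of_int k * real n)) \<partial>count_space UNIV)"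
      using \<eta> r by (intro nn_integral_mono) (simp add: peak_def flip: ennreal_mult)
    also have "\<dots> = ennreal (sqrt (\<eta> n * K)) * (\<integral>\<^sup>+k. ennreal (peak (r/2) (\<alpha> powr real_of_int k * real n)) \<partial>count_space UNIV)"
      by (intro nn_integral_cmult) simp
    also have "\<dots> \<le> ennreal (sqrt (\<eta> n * K)) * ennreal S"
      using elim by (intro mult_left_mono S) auto
    also have "\<dots> = ennreal (s n)" using S \<eta> r by (simp add: s_def ennreal_mult)
    finally show ?case .
  qed
  ultimately show ?thesis by auto
qed

section \<open>The limiting distribution function\<close>

definition F :: "real \<Rightarrow> real" where
  "F x = 1 - H (\<alpha> powr x)"

lemma F_shift:
  assumes "1 \<le> n"
  shows "F (real_of_int k - log (1/\<alpha>) (real n)) = 1 - H (\<alpha> powr real_of_int k * real n)"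
proof -
  have "\<alpha> powr (- log (1/\<alpha>) (real n)) = (1/\<alpha>) powr (log (1/\<alpha>) (real n))"
    using \<alpha> by (simp add: powr_divide powr_minus_divide)
  also have "\<dots> = real n" using \<alpha> assms by (intro powr_log_cancel) auto
  finally have "\<alpha> powr (- log (1/\<alpha>) (real n)) = real n" .
  then show ?thesis unfolding F_def using powr_add[of \<alpha> "real_of_int k" "- log (1/\<alpha>) (real n)"] by simp
qed

lemma F_mono: "x \<le> y \<Longrightarrow> F x \<le> F y"
  unfolding F_def using \<alpha> H_mono[of "\<alpha> powr y" "\<alpha> powr x"] powr_mono'[of x y \<alpha>] by simp

lemma F_at_top: "(F \<longlongrightarrow> 1) at_top"
proof -
  obtain r K where B: "tail_bounds r K" using tail_bounds_exist by blast
  have r: "0 < r" "0 < K" using B by (auto simp: tail_bounds_def)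
  have lim: "((\<lambda>x. 1 - K * (\<alpha> powr x) powr r) \<longlongrightarrow> 1) at_top" using r \<alpha> by real_asymp
  show ?thesis
  proof (rule tendsto_sandwich[OF _ _ lim tendsto_const])
    show "eventually (\<lambda>x. 1 - K * (\<alpha> powr x) powr r \<le> F x) at_top"
      using H_le_powr[OF B] \<alpha> by (auto simp: F_def)
    show "eventually (\<lambda>x. F x \<le> 1) at_top"
      using H_nonneg \<alpha> by (auto simp: F_def)
  qed
qed

lemma F_at_bot: "(F \<longlongrightarrow> 0) at_bot"
proof -
  obtain r K where B: "tail_bounds r K" using tail_bounds_exist by blast
  have r: "0 < r" "0 < K" using B by (auto simp: tail_bounds_def)
  have lim: "((\<lambda>x. K * (\<alpha> powr x) powr (-r)) \<longlongrightarrow> 0) at_bot" using r \<alpha> by real_asymp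
  show ?thesis
  proof (rule tendsto_sandwich[OF _ _ tendsto_const lim])
    show "eventually (\<lambda>x. F x \<le> K * (\<alpha> powr x) powr (-r)) at_bot"
      using one_minus_H_le_powr[OF B] \<alpha> by (auto simp: F_def)
    show "eventually (\<lambda>x. 0 \<le> F x) at_bot"
      using H_le_1 \<alpha> by (auto simp: F_def)
  qed
qed

text \<open>\<open>H\<close> changes by at most \<open>K\<close> times the relative change of its
  argument, which is \<open>exp (b * (y - x)) - 1\<close>. This is linear in \<open>y - x\<close> up
  to a constant only on bounded ranges, so increments longer than 1 use \<open>F \<le> 1\<close>
  instead; they account for the \<open>+ 1\<close> in \<open>L\<close>.\<close>

lemma F_lipschitz: "\<exists>L>0. \<forall>x y. x \<le> y \<longrightarrow> F y - F x \<le> L * (y - x)"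
proof -
  obtain r K where B: "tail_bounds r K" using tail_bounds_exist by blast
  have r: "0 < r" "0 < K" using B by (auto simp: tail_bounds_def)
  define b where "b = - ln \<alpha>"
  have b: "0 < b" using \<alpha> by (simp add: b_def)
  define L where "L = K * b * exp b + 1"
  have L: "0 < L" using r b by (simp add: L_def add_pos_pos)
  have "F y - F x \<le> L * (y - x)" if xy: "x \<le> y" for x y
  proof (cases "y - x \<le> 1")
    case True
    define s t where "s = \<alpha> powr y" and "t = \<alpha> powr x"
    have st: "0 < s" "s \<le> t" using \<alpha> xy by (auto simp: s_def t_def intro: powr_mono')
    have ts: "t / s = exp (b * (y - x))"
      using \<alpha> by (simp add: s_def t_def powr_def b_def algebra_simps flip: exp_diff)
    have "F y - F x = H t - H s" by (simp add: F_def s_def t_def)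
    also have "\<dots> \<le> K * ((t - s) / s) * peak r s" by (rule H_diff_peak[OF B st])
    also have "\<dots> \<le> K * ((t - s) / s) * 1"
      using r st by (intro mult_left_mono) (auto simp: peak_def)
    also have "(t - s) / s = t / s - 1" using st by (simp add: field_simps)
    also have "\<dots> = exp (b * (y - x)) * (1 - exp (- (b * (y - x))))"
      unfolding ts by (simp add: right_diff_distrib flip: exp_add)
    also have "\<dots> \<le> exp b * (b * (y - x))"
    proof (intro mult_mono)
      show "exp (b * (y - x)) \<le> exp b" using True b mult_left_mono[of "y - x" 1 b] by simp
      show "1 - exp (- (b * (y - x))) \<le> b * (y - x)" using exp_ge_add_one_self[of "- (b * (y - x))"] by linarith
    qed (use b xy in auto)
    then have "K * (exp (b * (y - x)) * (1 - exp (- (b * (y - x))))) * 1 \<le> K * (exp b * (b * (y - x)))"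
      using r by simp
    also have "\<dots> \<le> L * (y - x)" using xy by (simp add: L_def algebra_simps)
    finally show ?thesis .
  next
    case False
    have "F y - F x \<le> 1" using H_nonneg[of "\<alpha> powr y"] H_le_1[of "\<alpha> powr x"] \<alpha> by (simp add: F_def)
    also have "1 \<le> 1 * (y - x)" using False by simp
    also have "\<dots> \<le> L * (y - x)" using r b xy by (intro mult_right_mono) (auto simp: L_def)
    finally show ?thesis .
  qed
  then show ?thesis using L by blast
qed

section \<open>The mean and its periodic fluctuation\<close>

text \<open>The tail-sum formula for the mean with \<open>H\<close> in place of the survival
  probability. The indicator makes the two-sided sum converge, since \<open>H\<close> tends to 1 as
  \<open>k\<close> goes to minus infinity.\<close>

definition meanH :: "real \<Rightarrow> real" where
  "meanH t = (\<integral>k. H (\<alpha> powr real_of_int k * t) - (if k < 0 then 1 else 0) \<partial>count_space (UNIV::int set))"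

definition \<phi> :: "real \<Rightarrow> real" where
  "\<phi> t = meanH t - log (1/\<alpha>) t"

lemma integrable_H:
  assumes t: "0 < t"
  shows "integrable (count_space UNIV) (\<lambda>k::int. H (\<alpha> powr real_of_int k * t) - (if k < 0 then 1 else 0))"
proof -
  obtain r K where B: "tail_bounds r K" using tail_bounds_exist by blast
  have r: "0 < r" "0 < K" using B by (auto simp: tail_bounds_def)
  define c where "c = K * (t powr r + t powr (-r))"
  have c: "0 \<le> c" using r by (simp add: c_def)
  have r1: "0 < \<alpha> powr r" "\<alpha> powr r < 1" using powr_less_mono'[of \<alpha> 0 r] \<alpha> r by auto
  obtain S where S: "0 \<le> S" and Sb: "\<forall>y::real. (\<integral>\<^sup>+k. ennreal ((\<alpha> powr r) powr \<bar>real_of_int k - y\<bar>) \<partial>count_space UNIV) \<le> ennreal S"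
    using int_power_sum_bound[OF r1] by blast
  have bd: "\<bar>H (\<alpha> powr real_of_int k * t) - (if k < 0 then 1 else 0)\<bar> \<le> c * (\<alpha> powr r) powr \<bar>real_of_int k\<bar>" for k
  proof -
    define u where "u = \<alpha> powr real_of_int k * t"
    have u: "0 < u" using t \<alpha> by (simp add: u_def)
    show ?thesis
    proof (cases "k < 0")
      case True
      have "\<bar>H u - 1\<bar> = 1 - H u" using H_le_1[OF u] by simp
      also have "\<dots> \<le> K * u powr (-r)" by (rule one_minus_H_le_powr[OF B u])
      also have "\<dots> = K * t powr (-r) * (\<alpha> powr r) powr \<bar>real_of_int k\<bar>"
        using True t \<alpha> by (simp add: u_def powr_mult powr_powr mult.commute)
      also have "\<dots> \<le> c * (\<alpha> powr r) powr \<bar>real_of_int k\<bar>"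
        using r by (intro mult_right_mono) (auto simp: c_def)
      finally show ?thesis using True by (simp add: u_def)
    next
      case False
      have "\<bar>H u\<bar> = H u" using H_nonneg[OF u] by simp
      also have "\<dots> \<le> K * u powr r" by (rule H_le_powr[OF B u])
      also have "\<dots> = K * t powr r * (\<alpha> powr r) powr \<bar>real_of_int k\<bar>"
        using False t \<alpha> by (simp add: u_def powr_mult powr_powr mult.commute)
      also have "\<dots> \<le> c * (\<alpha> powr r) powr \<bar>real_of_int k\<bar>"
        using r by (intro mult_right_mono) (auto simp: c_def)
      finally show ?thesis using False by (simp add: u_def)
    qed
  qed
  have "(\<integral>\<^sup>+k. ennreal \<bar>H (\<alpha> powr real_of_int k * t) - (if k < 0 then 1 else 0)\<bar> \<partial>count_space UNIV)
      \<le> (\<integral>\<^sup>+k. ennreal c * ennreal ((\<alpha> powr r) powr \<bar>real_of_int k - 0\<bar>) \<partial>count_space UNIV)"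
    using bd c by (intro nn_integral_mono) (simp flip: ennreal_mult)
  also have "\<dots> = ennreal c * (\<integral>\<^sup>+k. ennreal ((\<alpha> powr r) powr \<bar>real_of_int k - 0\<bar>) \<partial>count_space UNIV)"
    by (intro nn_integral_cmult) simp
  also have "\<dots> \<le> ennreal c * ennreal S" by (intro mult_left_mono Sb[rule_format]) auto
  also have "\<dots> = ennreal (c * S)" using c S by (simp add: ennreal_mult)
  finally show ?thesis by (rule integral_count_space_bound) (use c S in simp)
qed

text \<open>The relative change \<open>(t - s) / s\<close> is the same at every scale
  \<open>\<alpha> powr k\<close>, so it factors out of the sum over \<open>k\<close>, and the
  remaining sum of \<open>peak\<close> is bounded uniformly in \<open>s\<close>. The logarithm obeys
  a bound of the same form.\<close>

lemma phi_diff: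
  "\<exists>D>0. \<forall>s t. 0 < s \<longrightarrow> s \<le> t \<longrightarrow> \<bar>\<phi> t - \<phi> s\<bar> \<le> D * ((t - s) / s)"
proof -
  obtain r K where B: "tail_bounds r K" using tail_bounds_exist by blast
  have r: "0 < r" "0 < K" using B by (auto simp: tail_bounds_def)
  obtain S where S: "0 \<le> S" "\<And>t. 0 < t \<Longrightarrow>
      (\<integral>\<^sup>+k. ennreal (peak r (\<alpha> powr real_of_int k * t)) \<partial>count_space UNIV) \<le> ennreal S"
    using peak_sum_bound[OF r(1)] by blast
  define D where "D = K * S + 1 / (- ln \<alpha>)"
  have la: "0 < - ln \<alpha>" using \<alpha> by simp
  have D: "0 < D" unfolding D_def using r S la by (intro add_nonneg_pos) auto
  have "\<bar>\<phi> t - \<phi> s\<bar> \<le> D * ((t - s) / s)" if st: "0 < s" "s \<le> t" for s t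
  proof -
    define c where "c = K * ((t - s) / s)"
    have c: "0 \<le> c" using r st by (simp add: c_def)
    have bd: "\<bar>H (\<alpha> powr real_of_int k * t) - H (\<alpha> powr real_of_int k * s)\<bar>
      \<le> c * peak r (\<alpha> powr real_of_int k * s)" for k :: int
    proof -
      define x where "x = \<alpha> powr real_of_int k"
      have x: "0 < x" using \<alpha> by (simp add: x_def)
      then have xs: "0 < x * s" "x * s \<le> x * t" using st by auto
      have "\<bar>H (x * t) - H (x * s)\<bar> = H (x * t) - H (x * s)" using H_mono[OF xs] by simp
      also have "\<dots> \<le> K * ((x * t - x * s) / (x * s)) * peak r (x * s)" by (rule H_diff_peak[OF B xs])
      also have "(x * t - x * s) / (x * s) = (t - s) / s" using x st by (simp add: field_simps)
      finally show ?thesis by (simp add: c_def x_def)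
    qed
    have "(\<integral>\<^sup>+k. ennreal \<bar>H (\<alpha> powr real_of_int k * t) - H (\<alpha> powr real_of_int k * s)\<bar> \<partial>count_space UNIV)
      \<le> (\<integral>\<^sup>+k. ennreal c * ennreal (peak r (\<alpha> powr real_of_int k * s)) \<partial>count_space UNIV)"
      using bd c by (intro nn_integral_mono) (simp add: peak_def flip: ennreal_mult)
    also have "\<dots> = ennreal c * (\<integral>\<^sup>+k. ennreal (peak r (\<alpha> powr real_of_int k * s)) \<partial>count_space UNIV)"
      by (intro nn_integral_cmult) simp
    also have "\<dots> \<le> ennreal c * ennreal S" using st by (intro mult_left_mono S) auto
    also have "\<dots> = ennreal (c * S)" using c S by (simp add: ennreal_mult)
    finally have "\<bar>\<integral>k. H (\<alpha> powr real_of_int k * t) - H (\<alpha> powr real_of_int k * s) \<partial>count_space (UNIV::int set)\<bar> \<le> c * S"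
      by (rule integral_count_space_bound) (use c S in simp)
    also have "(\<integral>k. H (\<alpha> powr real_of_int k * t) - H (\<alpha> powr real_of_int k * s) \<partial>count_space (UNIV::int set))
       = meanH t - meanH s"
      unfolding meanH_def using st
      by (subst Bochner_Integration.integral_diff[symmetric]) (auto intro!: integrable_H Bochner_Integration.integral_cong)
    finally have m: "\<bar>meanH t - meanH s\<bar> \<le> c * S" .
    have "log (1/\<alpha>) t - log (1/\<alpha>) s = (ln t - ln s) / (- ln \<alpha>)"
      using \<alpha> by (simp add: log_def ln_div diff_divide_distrib)
    moreover have "0 \<le> ln t - ln s" using st by simp
    moreover have "ln t - ln s \<le> (t - s) / s"
    proof -
      have "ln (t / s) \<le> t / s - 1" using st by (intro ln_le_minus_one) auto
      then show ?thesis using st by (simp add: ln_div diff_divide_distrib)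
    qed
    ultimately have l: "\<bar>log (1/\<alpha>) t - log (1/\<alpha>) s\<bar> \<le> (1 / (- ln \<alpha>)) * ((t - s) / s)"
      using la divide_right_mono[of "ln t - ln s" "(t - s) / s" "- ln \<alpha>"]
      by (simp add: mult.commute)
    have "\<bar>\<phi> t - \<phi> s\<bar> \<le> c * S + (1 / (- ln \<alpha>)) * ((t - s) / s)"
      using m l unfolding \<phi>_def by linarith
    also have "\<dots> = D * ((t - s) / s)" unfolding D_def c_def distrib_right by (simp add: mult_ac)
    finally show ?thesis .
  qed
  then show ?thesis using D by blast
qed

lemma phi_lipschitz:
  assumes t: "0 < t"
  shows "\<exists>e>0. \<exists>L. L-lipschitz_on (cball t e \<inter> {0<..}) \<phi>"
proof -
  obtain D where D: "0 < D" and d: "\<forall>s t. 0 < s \<longrightarrow> s \<le> t \<longrightarrow> \<bar>\<phi> t - \<phi> s\<bar> \<le> D * ((t - s) / s)"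
    using phi_diff by blast
  have one: "\<bar>\<phi> v - \<phi> u\<bar> \<le> 2 * D / t * (v - u)" if "u \<in> cball t (t/2)" "u \<le> v" for u v
  proof -
    have u: "t / 2 \<le> u" using that(1) by (auto simp: dist_real_def abs_if split: if_splits)
    have "\<bar>\<phi> v - \<phi> u\<bar> \<le> D * ((v - u) / u)" using d u t that(2) by auto
    also have "\<dots> \<le> D * ((v - u) / (t / 2))" using D u t that(2) by (intro mult_left_mono divide_left_mono) auto
    also have "\<dots> = 2 * D / t * (v - u)" by simp
    finally show ?thesis .
  qed
  \<comment> \<open>On the ball of radius \<open>t/2\<close> all points are at least
    \<open>t/2\<close>, so the factor \<open>1/s\<close> is at most \<open>2/t\<close>.\<close>
  have "(2 * D / t)-lipschitz_on (cball t (t/2) \<inter> {0<..}) \<phi>"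
  proof (rule lipschitz_onI)
    fix u v assume "u \<in> cball t (t/2) \<inter> {0<..}" "v \<in> cball t (t/2) \<inter> {0<..}"
    then show "dist (\<phi> u) (\<phi> v) \<le> 2 * D / t * dist u v"
      using one[of u v] one[of v u] by (cases "u \<le> v") (auto simp: dist_real_def abs_minus_commute)
  qed (use D t in simp)
  then show ?thesis using t by (intro exI[of _ "t/2"]) auto
qed

lemma phi_continuous: "continuous_on {0<..} \<phi>"
proof (rule continuous_at_imp_continuous_on, rule ballI)
  fix t :: real assume "t \<in> {0<..}"
  then have t: "0 < t" by simp
  obtain e L where e: "e > 0" and L: "L-lipschitz_on (cball t e \<inter> {0<..}) \<phi>"
    using phi_lipschitz[OF t] by blast
  have "continuous_on (ball t e \<inter> {0<..}) \<phi>"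
    using lipschitz_on_continuous_on[OF L] by (rule continuous_on_subset) auto
  then show "isCont \<phi> t"
    using e t by (subst (asm) continuous_on_eq_continuous_at) auto
qed

text \<open>Shifting \<open>k\<close> by one turns \<open>H\<close> at \<open>\<alpha> * t\<close>
  into \<open>H\<close> at \<open>t\<close> but moves the jump of the indicator, which lowers
  \<open>meanH\<close> by 1; the logarithm drops by 1 too.\<close>

lemma phi_periodic:
  assumes t: "0 < t"
  shows "\<phi> (\<alpha> * t) = \<phi> t"
proof -
  define g where "g k = H (\<alpha> powr real_of_int k * t) - (if k < 0 then 1 else 0)" for k :: int
  have bij: "bij (\<lambda>k::int. k + 1)" by (intro bij_betwI[where g = "\<lambda>k. k - 1"]) auto
  have int: "integrable (count_space UNIV) g" unfolding g_def by (rule integrable_H[OF t])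
  have int0: "integrable (count_space UNIV) (indicator {0::int} :: int \<Rightarrow> real)"
    by (rule integrable_real_indicator) auto
  have "meanH (\<alpha> * t) = (\<integral>k. g (k + 1) - indicator {0} (k + 1) \<partial>count_space (UNIV::int set))"
    unfolding meanH_def g_def using \<alpha>
    by (intro Bochner_Integration.integral_cong) (auto simp: indicator_def powr_add mult.assoc)
  also have "\<dots> = (\<integral>k. g k - indicator {0} k \<partial>count_space UNIV)"
    by (rule integral_bij_count_space[OF bij])
  also have "\<dots> = (\<integral>k. g k \<partial>count_space UNIV) - (\<integral>k. indicator {0::int} k \<partial>count_space UNIV)"
    by (rule Bochner_Integration.integral_diff[OF int int0])
  also have "(\<integral>k. indicator {0::int} k \<partial>count_space UNIV) = (1::real)"
    by (simp add: measure_count_space)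
  finally have "meanH (\<alpha> * t) = meanH t - 1" by (simp add: meanH_def g_def)
  moreover have "log (1/\<alpha>) (\<alpha> * t) = log (1/\<alpha>) t - 1"
    using \<alpha> t by (simp add: log_def ln_mult ln_div field_simps)
  ultimately show ?thesis by (simp add: \<phi>_def)
qed

lemma expectation_limit:
  "(\<lambda>n. measure_pmf.expectation (rounds Y a n) real - log (1/\<alpha>) (real n) - \<phi> (real n)) \<longlonglongrightarrow> 0"
proof -
  obtain s where s: "s \<longlonglongrightarrow> 0" "\<And>n. 0 \<le> s n" and
    ev: "eventually (\<lambda>n. (\<integral>\<^sup>+k. ennreal \<bar>survZ n k - H (\<alpha> powr real_of_int k * real n)\<bar> \<partial>count_space UNIV) \<le> ennreal (s n)) sequentially"
    using survZ_H_sum by blast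
  have "eventually (\<lambda>n. norm (measure_pmf.expectation (rounds Y a n) real - log (1/\<alpha>) (real n) - \<phi> (real n)) \<le> s n) sequentially"
    using ev eventually_ge_at_top[of 1]
  proof eventually_elim
    case (elim n)
    \<comment> \<open>Gives integrability of the difference, which permits splitting the sum, as
      well as the bound on its value.\<close>
    note I = integral_count_space_bound[OF elim(1) s(2)]
    have n: "0 < real n" using elim by simp
    have "(\<integral>k. survZ n k - (if k < 0 then 1 else 0) \<partial>count_space UNIV)
       = (\<integral>k. (survZ n k - H (\<alpha> powr real_of_int k * real n)) +
            (H (\<alpha> powr real_of_int k * real n) - (if k < 0 then 1 else 0)) \<partial>count_space UNIV)"
      by (intro Bochner_Integration.integral_cong) auto
    also have "\<dots> = (\<integral>k. survZ n k - H (\<alpha> powr real_of_int k * real n) \<partial>count_space UNIV) + meanH (real n)"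
      unfolding meanH_def by (intro Bochner_Integration.integral_add I integrable_H n)
    finally have "measure_pmf.expectation (rounds Y a n) real - log (1/\<alpha>) (real n) - \<phi> (real n)
       = (\<integral>k. survZ n k - H (\<alpha> powr real_of_int k * real n) \<partial>count_space UNIV)"
      using integral_survZ[of n] elim by (simp add: \<phi>_def)
    then show ?case using I(2) by simp
  qed
  then show ?thesis by (rule tendsto_0_le[OF s(1), where K = 1, OF eventually_mono]) (use s in simp)
qed

text \<open>The ceiling is at most an integer \<open>k\<close> exactly when its argument is, so the
  discretised law has precisely the values of \<open>F\<close> at the shifted integers.\<close>

lemma limit_law_cdf:
  assumes f: "f \<in> borel_measurable borel"
    and p: "prob_space (density lborel (\<lambda>x. ennreal (f x)))"
    and F: "\<And>x. F x = measure (density lborel (\<lambda>x. ennreal (f x))) {..x}"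
  defines "W \<equiv> \<lambda>n. distr (density lborel (\<lambda>x. ennreal (f x))) (count_space UNIV) (\<lambda>z. \<lceil>z + log (1/\<alpha>) (real n)\<rceil>)"
  shows "prob_space (W n)" "sets (W n) = sets (count_space UNIV)"
    "measure (W n) {..k} = F (real_of_int k - log (1/\<alpha>) (real n))"
proof -
  interpret prob_space "density lborel (\<lambda>x. ennreal (f x))" by fact
  have m: "(\<lambda>z. \<lceil>z + log (1/\<alpha>) (real n)\<rceil>) \<in> measurable (density lborel (\<lambda>x. ennreal (f x))) (count_space UNIV)"
    by measurable
  show "prob_space (W n)" unfolding W_def by (rule prob_space_distr[OF m])
  show "sets (W n) = sets (count_space UNIV)" by (simp add: W_def)
  have "(\<lambda>z. \<lceil>z + log (1/\<alpha>) (real n)\<rceil>) -` {..k} = {..real_of_int k - log (1/\<alpha>) (real n)}"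
    by (auto simp: ceiling_le_iff algebra_simps)
  then show "measure (W n) {..k} = F (real_of_int k - log (1/\<alpha>) (real n))"
    unfolding W_def F using measure_distr[OF m, of "{..k}"] by simp
qed

lemma cdf_limit:
  "(\<lambda>n. SUP k::int. \<bar>measure_pmf.prob (map_pmf int (rounds Y a n)) {..k}
      - F (real_of_int k - log (1/\<alpha>) (real n))\<bar>) \<longlonglongrightarrow> 0" (is ?A)
  and pmf_limit:
  "(\<lambda>n. SUP k::int. \<bar>pmf (map_pmf int (rounds Y a n)) k
      - (F (real_of_int k - log (1/\<alpha>) (real n)) - F (real_of_int k - 1 - log (1/\<alpha>) (real n)))\<bar>) \<longlonglongrightarrow> 0" (is ?B)
proof -
  obtain \<eta> where \<eta>: "\<eta> \<longlonglongrightarrow> 0" "\<And>n. 0 \<le> \<eta> n"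
    and ev: "eventually (\<lambda>n. \<forall>k. \<bar>survZ n k - H (\<alpha> powr real_of_int k * real n)\<bar> \<le> \<eta> n) sequentially"
    using survZ_H_uniform by blast
  show ?A
  proof (rule SUP_abs_tendsto_0[OF \<eta>(1)])
    show "eventually (\<lambda>n. \<forall>k::int. \<bar>measure_pmf.prob (map_pmf int (rounds Y a n)) {..k}
      - F (real_of_int k - log (1/\<alpha>) (real n))\<bar> \<le> \<eta> n) sequentially"
      using ev eventually_ge_at_top[of 1]
      by eventually_elim
         (simp add: prob_int_rounds F_shift abs_minus_commute del: measure_map_pmf)
  qed
  have \<eta>2: "(\<lambda>n. 2 * \<eta> n) \<longlonglongrightarrow> 0" using tendsto_mult_left[OF \<eta>(1), of 2] by simp
  show ?B
  proof (rule SUP_abs_tendsto_0[OF \<eta>2])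
    show "eventually (\<lambda>n. \<forall>k::int. \<bar>pmf (map_pmf int (rounds Y a n)) k
      - (F (real_of_int k - log (1/\<alpha>) (real n)) - F (real_of_int k - 1 - log (1/\<alpha>) (real n)))\<bar> \<le> 2 * \<eta> n) sequentially"
      using ev eventually_ge_at_top[of 1]
    proof eventually_elim
      case (elim n)
      show ?case
      proof
        fix k :: int
        show "\<bar>pmf (map_pmf int (rounds Y a n)) k
          - (F (real_of_int k - log (1/\<alpha>) (real n)) - F (real_of_int k - 1 - log (1/\<alpha>) (real n)))\<bar> \<le> 2 * \<eta> n"
          using elim(1)[rule_format, of k] elim(1)[rule_format, of "k - 1"]
            F_shift[OF elim(2), of k] F_shift[OF elim(2), of "k - 1"] pmf_int_rounds[OF elim(2), of k]
          by simp
      qed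
    qed
  qed
qed

lemma dTV_dW_limit:
  assumes f: "f \<in> borel_measurable borel"
    and p: "prob_space (density lborel (\<lambda>x. ennreal (f x)))"
    and F: "\<And>x. F x = measure (density lborel (\<lambda>x. ennreal (f x))) {..x}"
  defines "W \<equiv> \<lambda>n. distr (density lborel (\<lambda>x. ennreal (f x))) (count_space UNIV) (\<lambda>z. \<lceil>z + log (1/\<alpha>) (real n)\<rceil>)"
  shows "(\<lambda>n. dTV (measure_pmf (map_pmf int (rounds Y a n))) (W n)) \<longlonglongrightarrow> 0"
    "(\<lambda>n. dW (measure_pmf (map_pmf int (rounds Y a n))) (W n)) \<longlonglongrightarrow> 0"
proof -
  obtain s where s: "s \<longlonglongrightarrow> 0" "\<And>n. 0 \<le> s n" and
    ev: "eventually (\<lambda>n. (\<integral>\<^sup>+k. ennreal \<bar>survZ n k - H (\<alpha> powr real_of_int k * real n)\<bar> \<partial>count_space UNIV) \<le> ennreal (s n)) sequentially"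
    using survZ_H_sum by blast
  have W: "prob_space (W n)" "sets (W n) = sets (count_space UNIV)"
    "measure (W n) {..k} = F (real_of_int k - log (1/\<alpha>) (real n))" for n k
    unfolding W_def by (rule limit_law_cdf[OF f p F])+
  have M: "prob_space (measure_pmf q)" "sets (measure_pmf q) = sets (count_space UNIV)" for q :: "int pmf"
    by (auto intro: measure_pmf.prob_space_axioms)
  have bd: "eventually (\<lambda>n. (\<integral>\<^sup>+k. ennreal \<bar>measure (measure_pmf (map_pmf int (rounds Y a n))) {..k} - measure (W n) {..k}\<bar> \<partial>count_space UNIV) \<le> ennreal (s n)) sequentially"
    using ev eventually_ge_at_top[of 1]
    by eventually_elim (simp add: W(3) prob_int_rounds F_shift abs_minus_commute del: measure_map_pmf)
  show "(\<lambda>n. dTV (measure_pmf (map_pmf int (rounds Y a n))) (W n)) \<longlonglongrightarrow> 0"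
  proof (rule tendsto_sandwich[OF _ _ tendsto_const s(1)])
    have *: "eventually (\<lambda>n. 0 \<le> dTV (measure_pmf (map_pmf int (rounds Y a n))) (W n) \<and>
      dTV (measure_pmf (map_pmf int (rounds Y a n))) (W n) \<le> s n) sequentially"
      using bd by eventually_elim (intro dTV_le_cdf_diff M W s)
    show "eventually (\<lambda>n. 0 \<le> dTV (measure_pmf (map_pmf int (rounds Y a n))) (W n)) sequentially"
      using * by eventually_elim simp
    show "eventually (\<lambda>n. dTV (measure_pmf (map_pmf int (rounds Y a n))) (W n) \<le> s n) sequentially"
      using * by eventually_elim simp
  qed
  have es: "(\<lambda>n. ennreal (s n)) \<longlonglongrightarrow> 0" using tendsto_ennrealI[OF s(1)] by simp
  show "(\<lambda>n. dW (measure_pmf (map_pmf int (rounds Y a n))) (W n)) \<longlonglongrightarrow> 0"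
  proof (rule tendsto_sandwich[OF _ _ tendsto_const es])
    show "eventually (\<lambda>n. dW (measure_pmf (map_pmf int (rounds Y a n))) (W n) \<le> ennreal (s n)) sequentially"
      using bd
    proof eventually_elim
      case (elim n)
      show ?case by (rule order_trans[OF dW_le_cdf_diff[OF M W(1,2)] elim])
    qed
  qed simp
qed

end

theorem theorem2p1:
  fixes Y :: "nat \<Rightarrow> nat pmf" and \<alpha> :: real and a :: nat
  assumes "condition1 Y \<alpha>" and "a \<ge> 1"
  shows "\<exists>(F::real \<Rightarrow> real) (f::real \<Rightarrow> real) (\<phi>::real \<Rightarrow> real).
     f \<in> borel_measurable lborel \<and> (\<exists>B. \<forall>x. 0 \<le> f x \<and> f x \<le> B) \<and>
     prob_space (density lborel (\<lambda>x. ennreal (f x))) \<and>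
     (\<forall>x. F x = measure (density lborel (\<lambda>x. ennreal (f x))) {..x}) \<and>
     (\<lambda>n. SUP k::int. \<bar>measure_pmf.prob (map_pmf int (rounds Y a n)) {..k}
                        - F (real_of_int k - log (1/\<alpha>) (real n))\<bar>) \<longlonglongrightarrow> 0 \<and>
     (\<lambda>n. dTV (measure_pmf (map_pmf int (rounds Y a n)))
               (distr (density lborel (\<lambda>x. ennreal (f x))) (count_space UNIV)
                  (\<lambda>z. \<lceil>z + log (1/\<alpha>) (real n)\<rceil>))) \<longlonglongrightarrow> 0 \<and>
     (\<lambda>n. dW (measure_pmf (map_pmf int (rounds Y a n)))
               (distr (density lborel (\<lambda>x. ennreal (f x))) (count_space UNIV)
                  (\<lambda>z. \<lceil>z + log (1/\<alpha>) (real n)\<rceil>))) \<longlonglongrightarrow> 0 \<and>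
     (\<lambda>n. SUP k::int. \<bar>pmf (map_pmf int (rounds Y a n)) k
                        - (F (real_of_int k - log (1/\<alpha>) (real n))
                           - F (real_of_int k - 1 - log (1/\<alpha>) (real n)))\<bar>) \<longlonglongrightarrow> 0 \<and>
     continuous_on {0<..} \<phi> \<and>
     (\<forall>t>0. \<exists>e>0. \<exists>L. L-lipschitz_on (cball t e \<inter> {0<..}) \<phi>) \<and>
     (\<forall>t>0. \<phi> (\<alpha> * t) = \<phi> t) \<and>
     (\<lambda>n. measure_pmf.expectation (rounds Y a n) real
            - log (1/\<alpha>) (real n) - \<phi> (real n)) \<longlonglongrightarrow> 0"
proof -
  obtain e C n1 where "election Y \<alpha> a e C n1"
    using condition1_imp_election[OF assms] by blast
  then interpret election Y \<alpha> a e C n1 .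
  obtain L where L: "0 < L" "\<And>x y. x \<le> y \<Longrightarrow> F y - F x \<le> L * (y - x)"
    using F_lipschitz by blast
  obtain f where f: "f \<in> borel_measurable borel" "\<forall>x. 0 \<le> f x \<and> f x \<le> L"
    "prob_space (density lborel (\<lambda>x. ennreal (f x)))"
    "\<forall>x. F x = measure (density lborel (\<lambda>x. ennreal (f x))) {..x}"
    using lipschitz_cdf_density[OF L(1) F_mono L(2) F_at_bot F_at_top] by blast
  have F: "\<And>x. F x = measure (density lborel (\<lambda>x. ennreal (f x))) {..x}" using f(4) by blast
  show ?thesis
  proof (rule exI[of _ F], rule exI[of _ f], rule exI[of _ \<phi>], intro conjI)
    show "f \<in> borel_measurable lborel" using f(1) by simp
    show "\<exists>B. \<forall>x. 0 \<le> f x \<and> f x \<le> B" using f(2) by blast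
    show "\<forall>t>0. \<exists>e>0. \<exists>L. L-lipschitz_on (cball t e \<inter> {0<..}) \<phi>" using phi_lipschitz by blast
    show "\<forall>t>0. \<phi> (\<alpha> * t) = \<phi> t" using phi_periodic by blast
  qed (rule f(3) f(4) cdf_limit pmf_limit dTV_dW_limit[OF f(1) f(3) F] phi_continuous expectation_limit)+
qed

end
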